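(* Let $p$ be a real polynomial and $0<\gamma\le 1$, and let $T_p^\gamma(t)$, $t\ge 0$, be the exponential-type multiplier operators on $\mathcal{X}$ given by $T_p^\gamma(t)f=\sum_{k=0}^\infty e^{-(p(k))^\gamma t}Y_kf$ for $t>0$ and $T_p^\gamma(0)f=f$. Assume they are regular, i.e. the leading coefficient of $p$ is positive, $p(0)=0$ and $\deg p>0$. Assume that for every $t>0$ the kernel $\varphi_{p,t}^\gamma(\cos\theta)$ of $T_p^\gamma(t)$ is positive. Then $\{T_p^\gamma(t)\mid 0\le t<\infty\}$ is a strongly continuous semigroup of contraction operators of class $(\mathscr{C}_0)$ on $\mathcal{X}$. Denote by $\mathcal{A}_p^\gamma$ its infinitesimal generator. Then for all $t>0$ and $f\in\mathcal{X}$ one has $T_p^\gamma(t)f\in\mathcal{D}(\mathcal{A}_p^\gamma)$, and there is a constant $N$ depending only on $n,\gamma,p$ and $\mathcal{X}$ such that $$\big\|\mathcal{A}_p^\gamma T_p^\gamma(t)f\big\|_{\mathcal{X}}\le \frac{N}{t}\|f\|_{\mathcal{X}}\qquad (t>0,\ f\in\mathcal{X}).$$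
   Context: Let $n\ge 2$, let $\mathbb{S}^n$ be the unit sphere of $\mathbb{R}^{n+1}$ with surface measure $d\omega$ and total measure $|\mathbb{S}^n|$, and put $\lambda=(n-1)/2$. $\mathcal{X}$ denotes either $\mathcal{L}^q(\mathbb{S}^n)$ for some $1\le q<\infty$ (complex-valued functions, usual norm) or $\mathcal{C}(\mathbb{S}^n)$ (maximum norm). $P_k^\lambda$ is the Gegenbauer polynomial defined by $(1-2tr+r^2)^{-\lambda}=\sum_{k\ge 0}P_k^\lambda(t)r^k$, and $Y_kf(x)=\frac{\Gamma(\lambda)(k+\lambda)}{2\pi^{\lambda+1}}\int_{\mathbb{S}^n}P_k^\lambda(x\cdot y)f(y)\,d\omega(y)$ is the projection of $f$ onto spherical harmonics of degree $k$. The powers $(p(k))^\gamma$ are real nonnegative powers (so $p(k)\ge 0$ for all integers $k\ge0$ is implicit). The kernel of $T_p^\gamma(t)$, $t>0$, is $\varphi_{p,t}^\gamma(\cos\theta)=\frac{1}{|\mathbb{S}^n|}\sum_{k=0}^\infty e^{-(p(k))^\gamma t}\frac{k+\lambda}{\lambda}P_k^\lambda(\cos\theta)$, so that $T_p^\gamma(t)f(x)=\int_{\mathbb{S}^n}f(y)\varphi_{p,t}^\gamma(x\cdot y)\,d\omega(y)$. "Positive kernel" means $\varphi_{p,t}^\gamma(\cos\theta)\ge 0$ for $0\le\theta\le\pi$. A family $\{T(t)\mid 0\le t<\infty\}$ of bounded linear operators on $\mathcal{X}$ is a semigroup of class $(\mathscr{C}_0)$ if $T(t_1+t_2)=T(t_1)T(t_2)$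 for $t_1,t_2\ge0$, $T(0)=I$, and $\|T(t)f-f\|_{\mathcal{X}}\to0$ as $t\to0+$ for every $f\in\mathcal{X}$; it is a contraction semigroup if $\|T(t)f\|_{\mathcal{X}}\le\|f\|_{\mathcal{X}}$. Its infinitesimal generator is $\mathcal{A}f=\lim_{t\to0+}(T(t)f-f)/t$ (limit in $\mathcal{X}$), with domain $\mathcal{D}(\mathcal{A})$ the set of $f\in\mathcal{X}$ for which the limit exists. *)

theory Defs
  imports "HOL-Analysis.Analysis" "HOL-Computational_Algebra.Polynomial"
begin

text \<open>
  The sphere \<open>S^n\<close> is \<^term>\<open>sphere 0 1\<close> in a Euclidean space \<open>'a\<close> with \<open>DIM('a) = n + 1\<close>.
  Functions on the sphere are functions on \<open>'a\<close> whose values off the sphere are ignored.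
\<close>

text \<open>
  Surface measure by polar coordinates: the area of a Borel set \<open>A\<close> of the sphere is \<open>DIM('a)\<close>
  times the volume of the cone \<open>{r x | 0 < r \<le> 1, x \<in> A}\<close>. It is not normalised.
\<close>

definition surface_measure :: "'a::euclidean_space measure" where
  "surface_measure =
     scale_measure (ennreal (real DIM('a)))
       (distr (restrict_space lborel (cball 0 1 - {0})) (restrict_space borel (sphere 0 1))
         (\<lambda>x. x /\<^sub>R norm x))"

lemma space_surface_measure [simp]:
  "space (surface_measure :: 'a::euclidean_space measure) = sphere 0 1"
  by (simp add: surface_measure_def space_scale_measure space_restrict_space)

lemma sets_surface_measure [simp, measurable_cong]:
  "sets (surface_measure :: 'a::euclidean_space measure)
     = sets (restrict_space borel (sphere 0 1))"
  by (simp add: surface_measure_def)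

lemma emeasure_surface_measure:
  fixes A :: "'a::euclidean_space set"
  assumes "A \<in> sets borel" "A \<subseteq> sphere 0 1"
  shows "emeasure surface_measure A
           = ennreal (real DIM('a)) *
             emeasure lborel {x. x \<noteq> 0 \<and> norm x \<le> 1 \<and> x /\<^sub>R norm x \<in> A}"
proof -
  have meas: "(\<lambda>x. x /\<^sub>R norm x)
      \<in> restrict_space lborel (cball 0 1 - {0 :: 'a})
          \<rightarrow>\<^sub>M restrict_space borel (sphere 0 1)"
    by (intro measurable_restrict_space2 measurable_restrict_space1)
       (auto simp: space_restrict_space)
  have A: "A \<in> sets (restrict_space borel (sphere 0 1))"
    using assms by (auto simp: sets_restrict_space_iff)
  have eq: "(\<lambda>x. x /\<^sub>R norm x) -` A \<inter> space (restrict_space lborel (cball 0 1 - {0 :: 'a}))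
        = {x. x \<noteq> 0 \<and> norm x \<le> 1 \<and> x /\<^sub>R norm x \<in> A}"
    by (auto simp: space_restrict_space)
  show ?thesis
    unfolding surface_measure_def
    by (subst emeasure_scale_measure, subst emeasure_distr[OF meas A], unfold eq,
        subst emeasure_restrict_space) auto
qed

definition sphere_index :: "'a::euclidean_space itself \<Rightarrow> real" where
  \<comment> \<open>\<open>(n - 1) / 2\<close> for the sphere \<open>S^n\<close> of \<open>'a\<close>\<close>
  "sphere_index _ = (real DIM('a) - 2) / 2"

text \<open>
  \<^term>\<open>gegenbauer l k t\<close> is the coefficient of \<open>r^k\<close> in \<open>(1 - 2 t r + r\<^sup>2) powr (-l)\<close>;
  \<^term>\<open>fps_binomial a\<close> is the binomial series \<open>(1 + X) powr a\<close>.
\<close>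

definition gegenbauer :: "real \<Rightarrow> nat \<Rightarrow> real \<Rightarrow> real" where
  "gegenbauer l k t =
     fps_nth (fps_compose (fps_binomial (- l)) (fps_X ^ 2 - fps_const (2 * t) * fps_X)) k"

definition harmonic_proj :: "nat \<Rightarrow> ('a::euclidean_space \<Rightarrow> complex) \<Rightarrow> 'a \<Rightarrow> complex" where
  "harmonic_proj k f x =
     (let l = sphere_index TYPE('a) in
      (Gamma l * (real k + l) / (2 * pi powr (l + 1))) *\<^sub>R
        (LINT y|surface_measure. gegenbauer l k (x \<bullet> y) *\<^sub>R f y))"

text \<open>
  The space \<open>L^q\<close> is represented by its functions rather than by their equivalence classes, so
  the norm is a seminorm on the carrier, and equality in the space is \<open>fs_eq\<close>. Outside the
  carrier \<open>fs_norm\<close> is meaningless (a non-integrable function gets norm \<open>0\<close>), so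
  limits also require membership in the carrier.
\<close>

datatype fspace = Lq real | Cont

fun fs_carrier :: "fspace \<Rightarrow> ('a::euclidean_space \<Rightarrow> complex) set" where
  "fs_carrier (Lq q) =
     {f. f \<in> borel_measurable surface_measure
         \<and> integrable surface_measure (\<lambda>x. norm (f x) powr q)}"
| "fs_carrier Cont = {f. continuous_on (sphere 0 1) f}"

fun fs_norm :: "fspace \<Rightarrow> ('a::euclidean_space \<Rightarrow> complex) \<Rightarrow> real" where
  "fs_norm (Lq q) f = (LINT x|surface_measure. norm (f x) powr q) powr (1 / q)"
| "fs_norm Cont f = (SUP x\<in>sphere 0 1. norm (f x))"

definition fs_eq ::
  "fspace \<Rightarrow> ('a::euclidean_space \<Rightarrow> complex) \<Rightarrow> ('a \<Rightarrow> complex) \<Rightarrow> bool" where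
  "fs_eq X f g \<longleftrightarrow> fs_norm X (\<lambda>x. f x - g x) = 0"

definition fs_tendsto ::
  "fspace \<Rightarrow> ('i \<Rightarrow> 'a::euclidean_space \<Rightarrow> complex) \<Rightarrow> ('a \<Rightarrow> complex) \<Rightarrow> 'i filter \<Rightarrow> bool" where
  "fs_tendsto X u g F \<longleftrightarrow>
     (\<forall>\<^sub>F i in F. u i \<in> fs_carrier X) \<and> g \<in> fs_carrier X \<and>
     ((\<lambda>i. fs_norm X (\<lambda>x. u i x - g x)) \<longlongrightarrow> 0) F"

definition fs_lim ::
  "fspace \<Rightarrow> 'i filter \<Rightarrow> ('i \<Rightarrow> 'a::euclidean_space \<Rightarrow> complex) \<Rightarrow> 'a \<Rightarrow> complex" where
  \<comment> \<open>the limit in the space; as an element of \<open>L^q\<close> it is unique only almost everywhere\<close>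
  "fs_lim X F u = (SOME g. fs_tendsto X u g F)"

definition fs_bounded_linear ::
  "fspace \<Rightarrow> (('a::euclidean_space \<Rightarrow> complex) \<Rightarrow> 'a \<Rightarrow> complex) \<Rightarrow> bool" where
  "fs_bounded_linear X L \<longleftrightarrow>
     (\<forall>f\<in>fs_carrier X. L f \<in> fs_carrier X) \<and>
     (\<forall>f\<in>fs_carrier X. \<forall>g\<in>fs_carrier X.
        fs_eq X (L (\<lambda>x. f x + g x)) (\<lambda>x. L f x + L g x)) \<and>
     (\<forall>c. \<forall>f\<in>fs_carrier X. fs_eq X (L (\<lambda>x. c * f x)) (\<lambda>x. c * L f x)) \<and>
     (\<exists>B. \<forall>f\<in>fs_carrier X. fs_norm X (L f) \<le> B * fs_norm X f)"

text \<open>Families \<open>T\<close> of operators are indexed by all reals; only \<open>T t\<close> with \<open>t \<ge> 0\<close> matters.\<close>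

definition C0_semigroup ::
  "fspace \<Rightarrow> (real \<Rightarrow> ('a::euclidean_space \<Rightarrow> complex) \<Rightarrow> 'a \<Rightarrow> complex) \<Rightarrow> bool" where
  "C0_semigroup X T \<longleftrightarrow>
     (\<forall>t\<ge>0. fs_bounded_linear X (T t)) \<and>
     (\<forall>s\<ge>0. \<forall>t\<ge>0. \<forall>f\<in>fs_carrier X. fs_eq X (T (s + t) f) (T s (T t f))) \<and>
     (\<forall>f\<in>fs_carrier X. fs_eq X (T 0 f) f) \<and>
     (\<forall>f\<in>fs_carrier X. fs_tendsto X (\<lambda>t. T t f) f (at_right 0))"

definition contractive ::
  "fspace \<Rightarrow> (real \<Rightarrow> ('a::euclidean_space \<Rightarrow> complex) \<Rightarrow> 'a \<Rightarrow> complex) \<Rightarrow> bool" where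
  "contractive X T \<longleftrightarrow> (\<forall>t\<ge>0. \<forall>f\<in>fs_carrier X. fs_norm X (T t f) \<le> fs_norm X f)"

definition diff_quotient ::
  "(real \<Rightarrow> ('a::euclidean_space \<Rightarrow> complex) \<Rightarrow> 'a \<Rightarrow> complex) \<Rightarrow>
     ('a \<Rightarrow> complex) \<Rightarrow> real \<Rightarrow> 'a \<Rightarrow> complex" where
  "diff_quotient T f t x = (T t f x - f x) /\<^sub>R t"

definition generator_dom ::
  "fspace \<Rightarrow> (real \<Rightarrow> ('a::euclidean_space \<Rightarrow> complex) \<Rightarrow> 'a \<Rightarrow> complex) \<Rightarrow>
     ('a \<Rightarrow> complex) set" where
  "generator_dom X T =
     {f \<in> fs_carrier X. \<exists>g. fs_tendsto X (diff_quotient T f) g (at_right 0)}"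

definition generator ::
  "fspace \<Rightarrow> (real \<Rightarrow> ('a::euclidean_space \<Rightarrow> complex) \<Rightarrow> 'a \<Rightarrow> complex) \<Rightarrow>
     ('a \<Rightarrow> complex) \<Rightarrow> 'a \<Rightarrow> complex" where
  "generator X T f = fs_lim X (at_right 0) (diff_quotient T f)"

definition exp_mult_op ::
  "fspace \<Rightarrow> real poly \<Rightarrow> real \<Rightarrow> real \<Rightarrow> ('a::euclidean_space \<Rightarrow> complex) \<Rightarrow> 'a \<Rightarrow> complex" where
  "exp_mult_op X p \<gamma> t f =
     (if t = 0 then f
      else fs_lim X sequentially
        (\<lambda>m x. \<Sum>k<m. exp (- ((poly p (real k)) powr \<gamma>) * t) *\<^sub>R harmonic_proj k f x))"

definition exp_mult_kernel ::
  "'a::euclidean_space itself \<Rightarrow> real poly \<Rightarrow> real \<Rightarrow> real \<Rightarrow> real \<Rightarrow> real" where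
  "exp_mult_kernel _ p \<gamma> t u =
     (let l = sphere_index TYPE('a) in
      1 / measure (surface_measure :: 'a measure) (sphere 0 1) *
        (\<Sum>k. exp (- ((poly p (real k)) powr \<gamma>) * t) * ((real k + l) / l) * gegenbauer l k u))"

definition positive_kernel :: "'a::euclidean_space itself \<Rightarrow> real poly \<Rightarrow> real \<Rightarrow> real \<Rightarrow> bool" where
  "positive_kernel _ p \<gamma> t \<longleftrightarrow>
     (\<forall>\<theta>. 0 \<le> \<theta> \<and> \<theta> \<le> pi \<longrightarrow> 0 \<le> exp_mult_kernel TYPE('a) p \<gamma> t (cos \<theta>))"

definition regular_symbol :: "real poly \<Rightarrow> bool" where
  "regular_symbol p \<longleftrightarrow> lead_coeff p > 0 \<and> poly p 0 = 0 \<and> degree p > 0"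

end

theory Submission
  imports Defs "HOL-Complex_Analysis.Complex_Analysis" "HOL-Real_Asymp.Real_Asymp"
begin

text \<open>
  Every operator is convolution with a zonal kernel. The Gegenbauer differential equation and Green's
  identity on the sphere make the projections of different degrees orthogonal; the Cesaro kernels of
  order \<open>n + 1\<close> are nonnegative, so by Korovkin's argument they form an approximate identity, which
  fixes the normalisation \<open>Y\<^sub>k Y\<^sub>k = Y\<^sub>k\<close>. This gives the semigroup law, and positivity of the
  kernel of \<open>T t\<close> with Korovkin's argument again gives contractivity and strong continuity.
  For the last estimate, \<open>t A T t\<close> has the multiplier \<open>-m\<close> with
  \<open>m k = t (p k)\<^sup>\<gamma> exp (- t (p k)\<^sup>\<gamma>)\<close>. Summation by parts bounds its
  norm by \<open>\<Sum>k. (k + 1)^(n + 1) |\<Delta>^(n + 2) m k|\<close>, and Cauchy's inequality on discs of radius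
  proportional to \<open>k\<close>, where \<open>m\<close> extends holomorphically, bounds this sum uniformly in \<open>t\<close>.
\<close>

section \<open>Gegenbauer polynomials\<close>

text \<open>Two obstacles shape the proof. Elements of \<open>L^q\<close> are represented by
  functions and \<open>fs_lim\<close> chooses its value, so an operator defined by a limit is known
  only up to null sets; each is traded at once for an explicit convolution, whose values exist at
  every point and ignore the chosen representative. And the generator bound must not depend on t.
  Crude estimates serve for convergence at fixed t only; uniformity comes from scaling: the weighted
  difference of order n + 2 at k is bounded by a multiple of
  \<open>\<tau> / (1 + \<tau>)^2 / k\<close> with \<open>\<tau>\<close> proportional to
  \<open>t k^b\<close>, so t only translates the sum on a logarithmic scale. The order n + 2 comes
  from the generating function \<open>(1 - r^2) (1 - 2 u r + r^2)^(-(l + 1))\<close> of the zonal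
  kernels: \<open>2 (l + 1) = n + 1\<close> factors \<open>1 / (1 - r)\<close> compensate the
  oscillating denominator, and one more cancels \<open>1 - r\<close> in the numerator. Finitely many
  small k, where p may vanish, are bounded trivially. The condition \<open>p(0) = 0\<close> gives
  the kernels mass one.\<close>

definition gegenbauer_fps :: "real \<Rightarrow> real \<Rightarrow> real fps" where
  "gegenbauer_fps l u =
     fps_compose (fps_binomial (- l)) (fps_X ^ 2 - fps_const (2 * u) * fps_X)"

lemma gegenbauer_eq_nth: "gegenbauer l k u = fps_nth (gegenbauer_fps l u) k"
  by (simp add: gegenbauer_def gegenbauer_fps_def)

abbreviation quad_fps :: "real \<Rightarrow> real fps" where
  "quad_fps u \<equiv> 1 - fps_const (2 * u) * fps_X + fps_X ^ 2"

lemma quad_fps_nonzero: "quad_fps u \<noteq> 0"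
proof
  assume "quad_fps u = 0"
  then have "fps_nth (quad_fps u) 0 = 0" by (simp only: fps_zero_nth)
  moreover have "fps_nth (quad_fps u) 0 = 1" by simp
  ultimately show False by simp
qed

text \<open>The factorisation \<open>(1 + g)^(-l) = (1 + g) (1 + g)^(-(l + 1))\<close> raises the
  exponent; the zonal generating function below lives at \<open>l + 1\<close>.\<close>

lemma gegenbauer_fps_quad: "gegenbauer_fps l u = quad_fps u * gegenbauer_fps (l + 1) u"
proof -
  let ?g = "fps_X ^ 2 - fps_const (2 * u) * fps_X :: real fps"
  have g0: "fps_nth ?g 0 = 0" by simp
  have "fps_binomial (- l) = fps_binomial 1 * fps_binomial (- (l + 1))"
    using fps_binomial_add_mult[of 1 "- (l + 1)"] by simp
  then have "fps_compose (fps_binomial (- l)) ?g =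
      fps_compose (1 + fps_X) ?g * fps_compose (fps_binomial (- (l + 1))) ?g"
    using fps_compose_mult_distrib[OF g0, of "1 + fps_X"] by (simp add: fps_binomial_1)
  then show ?thesis
    using g0 by (simp add: gegenbauer_fps_def fps_compose_add_distrib algebra_simps)
qed

text \<open>The binomial series satisfies \<open>(1 + X) b' = - l b\<close>. Composing this with
  \<open>g = X^2 - 2 u X\<close> and applying the chain rule yields an equation free of powers, from
  which the coefficients can be read off.\<close>

lemma gegenbauer_fps_ODE:
  "quad_fps u * fps_deriv (gegenbauer_fps l u) =
     fps_const (2 * l) * (fps_const u - fps_X) * gegenbauer_fps l u"
proof -
  let ?g = "fps_X ^ 2 - fps_const (2 * u) * fps_X :: real fps"
  let ?b = "fps_binomial (- l)"
  have g0: "fps_nth ?g 0 = 0" by simp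
  have "(1 + fps_X) * fps_deriv ?b = fps_const (- l) * ?b"
  proof -
    have "(1 + fps_X :: real fps) * inverse (1 + fps_X) = 1" by (rule inverse_mult_eq_1') simp
    then show ?thesis
      unfolding fps_binomial_deriv
      by (subst fps_divide_unit) (simp_all add: mult.left_commute[of "1 + fps_X"])
  qed
  then have "fps_compose ((1 + fps_X) * fps_deriv ?b) ?g = fps_compose (fps_const (- l) * ?b) ?g"
    by simp
  then have 1: "(1 + ?g) * fps_compose (fps_deriv ?b) ?g = fps_const (- l) * fps_compose ?b ?g"
    by (simp only: fps_compose_mult_distrib[OF g0] fps_compose_add_distrib fps_const_compose fps_compose_1
        fps_X_fps_compose_startby0[OF g0])
  have 2: "fps_deriv ?g = fps_const 2 * (fps_X - fps_const u)"
    by (simp add: power2_eq_square algebra_simps numeral_fps_const flip: fps_const_mult)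
  have "fps_deriv (gegenbauer_fps l u) = fps_compose (fps_deriv ?b) ?g * fps_deriv ?g"
    unfolding gegenbauer_fps_def by (rule fps_compose_deriv[OF g0])
  moreover have "quad_fps u = 1 + ?g" by simp
  ultimately have "quad_fps u * fps_deriv (gegenbauer_fps l u) =
      ((1 + ?g) * fps_compose (fps_deriv ?b) ?g) * fps_deriv ?g"
    by (simp only: mult.assoc)
  also have "\<dots> = fps_const (- l) * fps_compose ?b ?g * (fps_const 2 * (fps_X - fps_const u))"
    unfolding 1 2 ..
  also have "\<dots> = fps_const (2 * l) * (fps_const u - fps_X) * gegenbauer_fps l u"
    unfolding gegenbauer_fps_def
    by (simp add: algebra_simps flip: fps_const_mult fps_const_neg)
  finally show ?thesis .
qed

lemma gegenbauer_0 [simp]: "gegenbauer l 0 u = 1"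
  by (simp add: gegenbauer_def fps_compose_nth)

lemma fps_nth_quad_mult:
  "fps_nth (quad_fps u * A) (Suc (Suc k)) =
     fps_nth A (Suc (Suc k)) - 2 * u * fps_nth A (Suc k) + fps_nth A k"
proof -
  have "quad_fps u * A = A - fps_const (2 * u) * (fps_X * A) + fps_X * (fps_X * A)"
    by (simp add: algebra_simps power2_eq_square)
  then show ?thesis by simp
qed

lemma gegenbauer_1: "gegenbauer l (Suc 0) u = 2 * l * u"
proof -
  have "fps_nth (quad_fps u * fps_deriv (gegenbauer_fps l u)) 0 =
     fps_nth (fps_const (2 * l) * (fps_const u - fps_X) * gegenbauer_fps l u) 0"
    by (simp only: gegenbauer_fps_ODE)
  then show ?thesis by (simp add: gegenbauer_eq_nth [symmetric])
qed

lemma gegenbauer_recurrence: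
  "real (k + 2) * gegenbauer l (Suc (Suc k)) u =
     2 * (real k + 1 + l) * u * gegenbauer l (Suc k) u - (real k + 2 * l) * gegenbauer l k u"
proof -
  let ?H = "gegenbauer_fps l u"
  have R: "fps_const (2 * l) * (fps_const u - fps_X) * ?H =
      fps_const (2 * l * u) * ?H - fps_const (2 * l) * (fps_X * ?H)"
    by (simp add: algebra_simps flip: fps_const_mult)
  have eq: "fps_nth (quad_fps u * fps_deriv ?H) j =
      fps_nth (fps_const (2 * l * u) * ?H - fps_const (2 * l) * (fps_X * ?H)) j" for j
    by (simp only: gegenbauer_fps_ODE R)
  show ?thesis
  \<comment> \<open>The coefficients of \<open>X^(k + 1)\<close> are compared;
    \<open>fps_nth_quad_mult\<close> covers the indices from two on, so k = 0 is separate.\<close>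
  proof (cases k)
    case 0
    have "quad_fps u * fps_deriv ?H = fps_deriv ?H - fps_const (2 * u) * (fps_X * fps_deriv ?H)
      + fps_X * (fps_X * fps_deriv ?H)"
      by (simp add: algebra_simps power2_eq_square)
    then show ?thesis
      using eq[of 1] 0 by (simp add: gegenbauer_eq_nth [symmetric] algebra_simps)
  next
    case (Suc j)
    show ?thesis
      using eq[of "Suc (Suc j)"] Suc unfolding fps_nth_quad_mult
      by (simp add: gegenbauer_eq_nth [symmetric] algebra_simps)
  qed
qed

section \<open>Polynomials in the argument and their differential equation\<close>

fun gegenbauer_poly :: "real \<Rightarrow> nat \<Rightarrow> real poly" where
  "gegenbauer_poly l 0 = 1"
| "gegenbauer_poly l (Suc 0) = [:0, 2 * l:]"
| "gegenbauer_poly l (Suc (Suc k)) =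
     smult (1 / real (k + 2))
       (smult (2 * (real k + 1 + l)) ([:0, 1:] * gegenbauer_poly l (Suc k)) -
        smult (real k + 2 * l) (gegenbauer_poly l k))"

lemma gegenbauer_eq_poly: "gegenbauer l k u = poly (gegenbauer_poly l k) u"
proof (induction l k rule: gegenbauer_poly.induct)
  case (3 l k)
  have "gegenbauer l (Suc (Suc k)) u = (2 * (real k + 1 + l) * u * gegenbauer l (Suc k) u
      - (real k + 2 * l) * gegenbauer l k u) / real (k + 2)"
    using gegenbauer_recurrence[of k l u] by (simp add: field_simps)
  with 3 show ?case by (simp add: mult_ac)
qed (simp_all add: gegenbauer_1)

lemma gegenbauer_poly_recurrence_deriv:
  fixes l u :: real
  defines "P \<equiv> \<lambda>k. poly (gegenbauer_poly l k) u"
  defines "D \<equiv> \<lambda>k. poly (pderiv (gegenbauer_poly l k)) u"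
  shows "real (k + 2) * P (Suc (Suc k)) = 2 * (real k + 1 + l) * u * P (Suc k) - (real k + 2 * l) * P k"
    and "real (k + 2) * D (Suc (Suc k)) =
      2 * (real k + 1 + l) * (P (Suc k) + u * D (Suc k)) - (real k + 2 * l) * D k"
  by (simp_all add: P_def D_def pderiv_smult pderiv_diff pderiv_pCons pderiv_mult algebra_simps
      del: of_nat_Suc of_nat_add)

text \<open>The two relations need each other, hence one induction: the differentiated recurrence
  and the first relation at k give the second at k + 1, and with it the undifferentiated recurrence
  gives the first at k + 1.\<close>

lemma gegenbauer_poly_deriv_relations:
  fixes l u :: real
  defines "P \<equiv> \<lambda>k. poly (gegenbauer_poly l k) u"
  defines "D \<equiv> \<lambda>k. poly (pderiv (gegenbauer_poly l k)) u"
  shows "real (Suc k) * P (Suc k) = u * D (Suc k) - D k \<and>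
         D (Suc k) = u * D k + (real k + 2 * l) * P k"
proof (induction k)
  case 0
  show ?case by (simp add: P_def D_def pderiv_pCons one_pCons)
next
  case (Suc k)
  have rec1: "real (k + 2) * P (Suc (Suc k)) =
      2 * (real k + 1 + l) * u * P (Suc k) - (real k + 2 * l) * P k"
    and rec2: "real (k + 2) * D (Suc (Suc k)) =
      2 * (real k + 1 + l) * (P (Suc k) + u * D (Suc k)) - (real k + 2 * l) * D k"
    unfolding P_def D_def by (rule gegenbauer_poly_recurrence_deriv)+
  have I: "real (Suc k) * P (Suc k) = u * D (Suc k) - D k"
    and II: "D (Suc k) = u * D k + (real k + 2 * l) * P k"
    using Suc by auto
  have Dk: "D k = u * D (Suc k) - real (Suc k) * P (Suc k)"
    using I by simp
  have "real (k + 2) * D (Suc (Suc k)) =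
      real (k + 2) * (u * D (Suc k) + (real (Suc k) + 2 * l) * P (Suc k))"
    unfolding rec2 Dk by (simp add: algebra_simps)
  then have II': "D (Suc (Suc k)) = u * D (Suc k) + (real (Suc k) + 2 * l) * P (Suc k)"
    by simp
  \<comment> \<open>Eliminating \<open>D k\<close> between the two relations leaves the derivative
    multiplied by \<open>1 - u^2\<close>.\<close>
  have III: "(1 - u * u) * D (Suc k) = (real k + 2 * l) * P k - real (Suc k) * u * P (Suc k)"
  proof -
    have "D (Suc k) = u * (u * D (Suc k) - real (Suc k) * P (Suc k)) + (real k + 2 * l) * P k"
      using II unfolding Dk .
    then show ?thesis by (simp add: algebra_simps)
  qed
  have "real (Suc (Suc k)) * P (Suc (Suc k)) = u * D (Suc (Suc k)) - D (Suc k)"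
  proof -
    have "u * D (Suc (Suc k)) - D (Suc k) =
        (real (Suc k) + 2 * l) * u * P (Suc k) - (1 - u * u) * D (Suc k)"
      unfolding II' by (simp add: algebra_simps)
    also have "\<dots> = 2 * (real k + 1 + l) * u * P (Suc k) - (real k + 2 * l) * P k"
      unfolding III by (simp add: algebra_simps)
    also have "\<dots> = real (k + 2) * P (Suc (Suc k))" using rec1 by simp
    finally show ?thesis by simp
  qed
  with II' show ?case by blast
qed

lemma gegenbauer_poly_deriv_1_minus_square:
  "[:1, 0, -1:] * pderiv (gegenbauer_poly l (Suc k)) =
     smult (real k + 2 * l) (gegenbauer_poly l k) -
     smult (real (Suc k)) ([:0, 1:] * gegenbauer_poly l (Suc k))"
proof (rule poly_ext)
  fix u
  let ?P = "\<lambda>k. poly (gegenbauer_poly l k) u"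
  let ?D = "\<lambda>k. poly (pderiv (gegenbauer_poly l k)) u"
  have Dk: "?D k = u * ?D (Suc k) - real (Suc k) * ?P (Suc k)"
    and "?D (Suc k) = u * ?D k + (real k + 2 * l) * ?P k"
    using gegenbauer_poly_deriv_relations[of k l u] by auto
  then have "?D (Suc k) = u * (u * ?D (Suc k) - real (Suc k) * ?P (Suc k)) + (real k + 2 * l) * ?P k"
    by simp
  then have "(1 - u * u) * ?D (Suc k) = (real k + 2 * l) * ?P k - real (Suc k) * (u * ?P (Suc k))"
    by (simp add: algebra_simps)
  then show "poly ([:1, 0, -1:] * pderiv (gegenbauer_poly l (Suc k))) u =
     poly (smult (real k + 2 * l) (gegenbauer_poly l k) -
     smult (real (Suc k)) ([:0, 1:] * gegenbauer_poly l (Suc k))) u"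
    by (simp add: algebra_simps)
qed

text \<open>Differentiating the first-order relation above brings in the derivative of degree
  \<open>k - 1\<close>, which the first of the two derivative relations expresses through degree k.
  The eigenvalue \<open>k (k + 2 l)\<close> is what separates the degrees later.\<close>

lemma gegenbauer_poly_ODE:
  fixes l u :: real and k :: nat
  defines "Q \<equiv> gegenbauer_poly l k"
  shows "(1 - u\<^sup>2) * poly (pderiv (pderiv Q)) u - (2 * l + 1) * u * poly (pderiv Q) u =
      - (real k * (real k + 2 * l)) * poly Q u"
proof (cases k)
  case 0
  then show ?thesis by (simp add: Q_def)
next
  case (Suc j)
  let ?P = "\<lambda>k. poly (gegenbauer_poly l k) u"
  let ?D = "\<lambda>k. poly (pderiv (gegenbauer_poly l k)) u"
  have "poly (pderiv ([:1, 0, -1:] * pderiv (gegenbauer_poly l (Suc j)))) u =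
     poly (pderiv (smult (real j + 2 * l) (gegenbauer_poly l j) -
     smult (real (Suc j)) ([:0, 1:] * gegenbauer_poly l (Suc j)))) u"
    by (simp only: gegenbauer_poly_deriv_1_minus_square)
  moreover have "pderiv [:1, 0, -1:] = [:0, -2 :: real:]" "pderiv [:0, 1:] = [:1 :: real:]"
    by (simp_all add: pderiv_pCons)
  ultimately have 1: "(1 - u * u) * poly (pderiv (pderiv (gegenbauer_poly l (Suc j)))) u - 2 * u * ?D (Suc j)
     = (real j + 2 * l) * ?D j - real (Suc j) * (?P (Suc j) + u * ?D (Suc j))"
    unfolding pderiv_mult pderiv_diff pderiv_smult
    by (simp add: algebra_simps)
  have Dj: "?D j = u * ?D (Suc j) - real (Suc j) * ?P (Suc j)"
    using gegenbauer_poly_deriv_relations[of j l u] by auto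
  show ?thesis
    using 1 unfolding Dj unfolding Q_def Suc by (simp add: algebra_simps power2_eq_square)
qed

section \<open>Zonal coefficients and Cesaro numbers\<close>

definition zonal_coeff :: "real \<Rightarrow> nat \<Rightarrow> real \<Rightarrow> real" where
  "zonal_coeff l k u = (real k + l) / l * gegenbauer l k u"

text \<open>This is the Poisson kernel. The factor k is the operator \<open>X d/dX\<close>, and over
  the common factor of exponent \<open>l + 1\<close> the numerator becomes
  \<open>(1 - 2 u X + X^2) + 2 X (u - X) = 1 - X^2\<close>.\<close>

lemma zonal_coeff_fps:
  assumes "l > 0"
  shows "Abs_fps (\<lambda>k. zonal_coeff l k u) = (1 - fps_X ^ 2) * gegenbauer_fps (l + 1) u"
proof -
  let ?H = "gegenbauer_fps l u" and ?K = "gegenbauer_fps (l + 1) u"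
  have "quad_fps u * fps_deriv ?H = quad_fps u * (fps_const (2 * l) * (fps_const u - fps_X) * ?K)"
    unfolding gegenbauer_fps_ODE by (subst gegenbauer_fps_quad) (simp only: mult_ac)
  then have D: "fps_deriv ?H = fps_const (2 * l) * (fps_const u - fps_X) * ?K"
    using quad_fps_nonzero by (metis mult_left_cancel)
  have "Abs_fps (\<lambda>k. zonal_coeff l k u) = ?H + fps_const (1 / l) * (fps_X * fps_deriv ?H)"
  proof (rule fps_ext)
    fix k
    show "fps_nth (Abs_fps (\<lambda>k. zonal_coeff l k u)) k =
        fps_nth (?H + fps_const (1 / l) * (fps_X * fps_deriv ?H)) k"
      using assms by (cases k) (simp_all add: zonal_coeff_def gegenbauer_eq_nth field_simps)
  qed
  also have "\<dots> = (quad_fps u + (fps_const (1 / l) * fps_const (2 * l)) * fps_X * (fps_const u - fps_X)) * ?K"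
    unfolding D by (subst gegenbauer_fps_quad) (simp only: algebra_simps)
  also have "quad_fps u + (fps_const (1 / l) * fps_const (2 * l)) * fps_X * (fps_const u - fps_X)
     = 1 - fps_X ^ 2"
    using assms
    by (simp add: algebra_simps power2_eq_square numeral_fps_const flip: fps_const_mult)
  finally show ?thesis .
qed

text \<open>Multiplication by this series takes partial sums. Its power \<open>m + 1\<close> has the
  Cesaro numbers of order m as coefficients, so products with it are unnormalised Cesaro
  means.\<close>

definition geometric_fps :: "real fps" where
  "geometric_fps = Abs_fps (\<lambda>_. 1)"

lemma one_minus_X_geometric: "(1 - fps_X) * geometric_fps = 1"
proof (rule fps_ext)
  fix k
  show "fps_nth ((1 - fps_X) * geometric_fps) k = fps_nth 1 k"
    by (cases k) (simp_all add: geometric_fps_def algebra_simps)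
qed

lemma fps_nth_geometric_mult: "fps_nth (geometric_fps * A) k = (\<Sum>i\<le>k. fps_nth A i)"
  using fps_mult_nth[of A geometric_fps k]
  by (simp add: geometric_fps_def mult.commute atMost_atLeast0)

lemma fps_deriv_geometric: "fps_deriv geometric_fps = geometric_fps ^ 2"
proof -
  have "fps_deriv ((1 - fps_X) * geometric_fps) = 0"
    by (simp add: one_minus_X_geometric)
  then have "(1 - fps_X) * fps_deriv geometric_fps = geometric_fps"
    by simp
  also have "\<dots> = (1 - fps_X) * geometric_fps ^ 2"
    unfolding power2_eq_square mult.assoc[symmetric] one_minus_X_geometric by simp
  finally have "(1 - fps_X) * fps_deriv geometric_fps = (1 - fps_X) * geometric_fps ^ 2" .
  then have "geometric_fps * (1 - fps_X) * fps_deriv geometric_fps =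
      geometric_fps * (1 - fps_X) * geometric_fps ^ 2"
    by (simp only: mult.assoc)
  then show ?thesis
    using one_minus_X_geometric by (simp add: mult.commute[of geometric_fps])
qed

lemma fps_deriv_geometric_power:
  "fps_deriv (geometric_fps ^ m) = of_nat m * geometric_fps * geometric_fps ^ m"
proof (induction m)
  case (Suc m)
  have "fps_deriv (geometric_fps ^ Suc m) =
      geometric_fps * (of_nat m * geometric_fps * geometric_fps ^ m) +
      geometric_fps * geometric_fps * geometric_fps ^ m"
    unfolding power_Suc fps_deriv_mult Suc fps_deriv_geometric power2_eq_square ..
  also have "\<dots> = of_nat (Suc m) * geometric_fps * geometric_fps ^ Suc m"
    by (simp add: ring_distribs mult_ac)
  finally show ?case .
qed simp

text \<open>An equation \<open>A' = B A\<close> turns bounds and signs of the logarithmic derivative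
  B into those of A, since each coefficient of A is a combination of the earlier ones with weights
  from B.\<close>

lemma fps_log_deriv_nth:
  fixes A B :: "real fps"
  assumes "fps_deriv A = B * A"
  shows "real (Suc k) * fps_nth A (Suc k) = (\<Sum>i\<le>k. fps_nth B i * fps_nth A (k - i))"
proof -
  have "fps_nth (fps_deriv A) k = fps_nth (B * A) k" using assms by simp
  then show ?thesis by (simp add: fps_mult_nth atMost_atLeast0)
qed

lemma fps_log_deriv_nonneg:
  fixes A B :: "real fps"
  assumes "fps_deriv A = B * A" "\<And>i. fps_nth B i \<ge> 0" "fps_nth A 0 \<ge> 0"
  shows "fps_nth A k \<ge> 0"
proof (induction k rule: less_induct)
  case (less k)
  show ?case
  proof (cases k)
    case 0
    then show ?thesis using assms by simp
  next
    case (Suc j)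
    have "real (Suc j) * fps_nth A (Suc j) \<ge> 0"
      unfolding fps_log_deriv_nth[OF assms(1)] using less Suc assms(2)
      by (intro sum_nonneg mult_nonneg_nonneg) auto
    then show ?thesis using Suc by (simp add: zero_le_mult_iff)
  qed
qed

text \<open>The logarithmic derivative of \<open>(1 - 2 u X + X^2)^(-1)\<close> at
  \<open>u = cos \<theta>\<close>: the quadratic factors over \<open>exp (i \<theta>)\<close> and
  \<open>exp (- i \<theta>)\<close>, and the two geometric series add up to cosines.\<close>

definition cos_fps :: "real \<Rightarrow> real fps" where
  "cos_fps \<theta> = Abs_fps (\<lambda>j. 2 * cos (real (Suc j) * \<theta>))"

lemma quad_mult_cos_fps: "quad_fps (cos \<theta>) * cos_fps \<theta> = fps_const 2 * (fps_const (cos \<theta>) - fps_X)"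
proof (rule fps_ext)
  fix k :: nat
  have cc: "cos ((x + 2) * \<theta>) + cos (x * \<theta>) = 2 * cos \<theta> * cos ((x + 1) * \<theta>)" for x :: real
  proof -
    have "cos ((x + 1) * \<theta> + \<theta>) + cos ((x + 1) * \<theta> - \<theta>) = 2 * cos \<theta> * cos ((x + 1) * \<theta>)"
      by (simp add: cos_add cos_diff)
    then show ?thesis by (simp add: algebra_simps)
  qed
  consider "k = 0" | "k = 1" | j where "k = Suc (Suc j)"
    by (metis One_nat_def not0_implies_Suc)
  then show "fps_nth (quad_fps (cos \<theta>) * cos_fps \<theta>) k =
      fps_nth (fps_const 2 * (fps_const (cos \<theta>) - fps_X)) k"
  proof cases
    case 1
    then show ?thesis by (simp add: cos_fps_def)
  next
    case 2
    have "quad_fps (cos \<theta>) * cos_fps \<theta> = cos_fps \<theta> - fps_const (2 * cos \<theta>) * (fps_X * cos_fps \<theta>)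
      + fps_X * (fps_X * cos_fps \<theta>)"
      by (simp add: algebra_simps power2_eq_square)
    then show ?thesis using 2 cc[of 0] by (simp add: cos_fps_def algebra_simps)
  next
    case 3
    show ?thesis
      using cc[of "real j + 1"] unfolding 3 fps_nth_quad_mult
      by (simp add: cos_fps_def algebra_simps)
  qed
qed

lemma gegenbauer_fps_log_deriv:
  "fps_deriv (gegenbauer_fps l (cos \<theta>)) = fps_const l * cos_fps \<theta> * gegenbauer_fps l (cos \<theta>)"
proof -
  let ?u = "cos \<theta>"
  have "quad_fps ?u * fps_deriv (gegenbauer_fps l ?u) =
      fps_const l * (quad_fps ?u * cos_fps \<theta>) * gegenbauer_fps l ?u"
    unfolding gegenbauer_fps_ODE quad_mult_cos_fps
    by (simp add: algebra_simps flip: fps_const_mult)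
  also have "\<dots> = quad_fps ?u * (fps_const l * cos_fps \<theta> * gegenbauer_fps l ?u)"
    by (simp only: mult_ac)
  finally show ?thesis
    using quad_fps_nonzero by (metis mult_left_cancel)
qed

text \<open>The weights \<open>2 l cos\<close> are at most m in absolute value, so the recursion is
  majorised by the one for \<open>(1 - X)^(-m)\<close>. The coefficients of
  \<open>(1 - X)^(-(m + 1))\<close> serve as the bound: they are no smaller and contain no
  subtraction in the binomial.\<close>

lemma abs_gegenbauer_le:
  assumes "0 \<le> l" "2 * l \<le> real m" "\<bar>u\<bar> \<le> 1"
  shows "\<bar>gegenbauer l k u\<bar> \<le> real ((k + m) choose m)"
proof (induction k rule: less_induct)
  case (less k)
  show ?case
  proof (cases k)
    case 0
    then show ?thesis by simp
  next
    case (Suc j)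
    define \<theta> where "\<theta> = arccos u"
    have u: "cos \<theta> = u" using assms(3) by (simp add: \<theta>_def cos_arccos_abs)
    have "real (Suc j) * \<bar>gegenbauer l (Suc j) u\<bar> =
        \<bar>\<Sum>i\<le>j. (l * (2 * cos (real (Suc i) * \<theta>))) * gegenbauer l (j - i) u\<bar>"
    proof -
      have "real (Suc j) * \<bar>gegenbauer l (Suc j) u\<bar> = \<bar>real (Suc j) * gegenbauer l (Suc j) u\<bar>"
        by (simp add: abs_mult)
      also have "real (Suc j) * gegenbauer l (Suc j) u =
          (\<Sum>i\<le>j. (l * (2 * cos (real (Suc i) * \<theta>))) * gegenbauer l (j - i) u)"
        using fps_log_deriv_nth[OF gegenbauer_fps_log_deriv[of l \<theta>], of j]
        by (simp add: u gegenbauer_eq_nth cos_fps_def del: of_nat_Suc)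
      finally show ?thesis .
    qed
    also have "\<dots> \<le> (\<Sum>i\<le>j. real m * real ((j - i + m) choose m))"
    proof (rule order.trans[OF sum_abs], rule sum_mono)
      fix i assume "i \<in> {..j}"
      have "\<bar>l * (2 * cos (real (Suc i) * \<theta>))\<bar> \<le> 2 * l * 1"
        using assms(1) by (simp add: abs_mult mult_left_le)
      then have "\<bar>l * (2 * cos (real (Suc i) * \<theta>))\<bar> \<le> real m" using assms by linarith
      moreover have "\<bar>gegenbauer l (j - i) u\<bar> \<le> real ((j - i + m) choose m)"
        by (rule less) (simp add: Suc)
      ultimately show "\<bar>(l * (2 * cos (real (Suc i) * \<theta>))) * gegenbauer l (j - i) u\<bar> \<le>
          real m * real ((j - i + m) choose m)"
        unfolding abs_mult[of "l * _"] by (intro mult_mono) auto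
    qed
    also have "\<dots> = real m * real (\<Sum>i\<le>j. (i + m) choose m)"
      unfolding of_nat_sum sum_distrib_left
      by (rule sum.reindex_bij_witness[of _ "\<lambda>i. j - i" "\<lambda>i. j - i"]) auto
    \<comment> \<open>Hockey-stick summation; absorption then trades the factor \<open>m + 1\<close>
      for \<open>j + 1\<close>, which is divided out.\<close>
    also have "(\<Sum>i\<le>j. (i + m) choose m) = Suc (j + m) choose (Suc m)"
      using choose_rising_sum(1)[of m j] by (simp add: add.commute)
    also have "real m * real (Suc (j + m) choose Suc m) \<le> real (Suc j) * real (Suc (j + m) choose m)"
    proof -
      have "Suc m * (Suc (j + m) choose Suc m) = Suc j * (Suc (j + m) choose m)"
        using binomial_absorb_comp[of "Suc (j + m)" m] Suc_times_binomial_eq[of "j + m" m]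
        by (simp add: Suc_diff_le mult.commute del: binomial_Suc_Suc mult_Suc mult_Suc_right)
      then have "real (Suc m) * real (Suc (j + m) choose Suc m) = real (Suc j) * real (Suc (j + m) choose m)"
        by (metis of_nat_mult)
      moreover have "real m * real (Suc (j + m) choose Suc m) \<le> real (Suc m) * real (Suc (j + m) choose Suc m)"
        by (intro mult_right_mono) auto
      ultimately show ?thesis by linarith
    qed
    finally have "\<bar>gegenbauer l (Suc j) u\<bar> \<le> real (Suc (j + m) choose m)"
      by (simp only: mult_le_cancel_left_pos of_nat_0_less_iff zero_less_Suc)
    then show ?thesis using Suc by simp
  qed
qed

text \<open>The logarithmic derivative of \<open>(1 - X)\<^sup>-\<^sup>N (1 - 2 u X + X\<^sup>2)\<^sup>-\<^sup>L\<close> has the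
  coefficients \<open>N + 2 L cos (j \<theta>)\<close>, which are nonnegative once \<open>N \<ge> 2 L\<close>.\<close>

lemma geometric_power_gegenbauer_nonneg:
  assumes "0 \<le> l" "2 * l \<le> real m" "\<bar>u\<bar> \<le> 1"
  shows "fps_nth (geometric_fps ^ m * gegenbauer_fps l u) k \<ge> 0"
proof -
  define \<theta> where "\<theta> = arccos u"
  have u: "cos \<theta> = u" using assms(3) by (simp add: \<theta>_def cos_arccos_abs)
  let ?B = "of_nat m * geometric_fps + fps_const l * cos_fps \<theta>"
  note P = fps_deriv_geometric_power[of m]
  show ?thesis
  proof (rule fps_log_deriv_nonneg)
    show "fps_deriv (geometric_fps ^ m * gegenbauer_fps l u) =
        ?B * (geometric_fps ^ m * gegenbauer_fps l u)"
      using gegenbauer_fps_log_deriv[of l \<theta>] P by (simp add: u algebra_simps)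
    fix i
    have "2 * l * cos (real (Suc i) * \<theta>) \<ge> 2 * l * (-1)"
      using assms(1) by (intro mult_left_mono) auto
    moreover have "fps_nth ?B i = real m + 2 * l * cos (real (Suc i) * \<theta>)"
      by (simp add: geometric_fps_def cos_fps_def fps_of_nat[symmetric] del: fps_of_nat of_nat_Suc)
    ultimately show "fps_nth ?B i \<ge> 0"
      using assms(2) by linarith
  next
    show "fps_nth (geometric_fps ^ m * gegenbauer_fps l u) 0 \<ge> 0"
      by (simp add: geometric_fps_def gegenbauer_eq_nth[symmetric] fps_nth_power_0)
  qed
qed

text \<open>Of the numerator \<open>1 - X^2\<close> one factor cancels a geometric series, and
  \<open>1 + X\<close> has nonnegative coefficients. Hence m + 1 summations leave m geometric series
  against the exponent \<open>l + 1\<close>, and these suffice as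
  \<open>m \<ge> 2 (l + 1)\<close>.\<close>

lemma cesaro_zonal_nonneg:
  assumes "0 < l" "2 * (l + 1) \<le> real m" "\<bar>u\<bar> \<le> 1"
  shows "fps_nth (geometric_fps ^ Suc m * Abs_fps (\<lambda>k. zonal_coeff l k u)) k \<ge> 0"
proof -
  let ?E = "geometric_fps ^ m * gegenbauer_fps (l + 1) u"
  have "geometric_fps ^ Suc m * Abs_fps (\<lambda>k. zonal_coeff l k u) =
      ((1 - fps_X) * geometric_fps) * (1 + fps_X) * ?E"
    unfolding zonal_coeff_fps[OF assms(1)] by (simp add: algebra_simps power2_eq_square)
  also have "\<dots> = ?E + fps_X * ?E"
    unfolding one_minus_X_geometric by (simp add: algebra_simps)
  finally have eq: "geometric_fps ^ Suc m * Abs_fps (\<lambda>k. zonal_coeff l k u) = ?E + fps_X * ?E" .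
  have "fps_nth ?E j \<ge> 0" for j
    using assms by (intro geometric_power_gegenbauer_nonneg) auto
  from this[of k] this[of "k - 1"] show ?thesis
    unfolding eq fps_add_nth fps_X_mult_nth by auto
qed

lemma geometric_power_nth_Suc:
  "real (Suc k) * fps_nth (geometric_fps ^ m) (Suc k) = real (k + m) * fps_nth (geometric_fps ^ m) k"
proof -
  note P = fps_deriv_geometric_power[of m]
  have "(1 - fps_X) * fps_deriv (geometric_fps ^ m) = ((1 - fps_X) * geometric_fps) * (of_nat m * geometric_fps ^ m)"
    unfolding P by (simp only: mult_ac)
  then have "fps_nth ((1 - fps_X) * fps_deriv (geometric_fps ^ m)) k = fps_nth (of_nat m * geometric_fps ^ m) k"
    unfolding one_minus_X_geometric by simp
  then show ?thesis
    by (cases k) (simp_all add: algebra_simps fps_of_nat[symmetric] del: fps_of_nat)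
qed

lemma geometric_power_nth_pos: "m > 0 \<Longrightarrow> fps_nth (geometric_fps ^ m) k > 0"
proof (induction k)
  case 0
  then show ?case by (simp add: geometric_fps_def fps_nth_power_0)
next
  case (Suc k)
  then have "real (Suc k) * fps_nth (geometric_fps ^ m) (Suc k) > 0"
    unfolding geometric_power_nth_Suc by (intro mult_pos_pos) auto
  then show ?case by (simp add: zero_less_mult_iff)
qed

section \<open>Surface measure\<close>

lemma emeasure_lborel_translate:
  fixes c :: "'a::euclidean_space"
  assumes [measurable]: "B \<in> sets borel"
  shows "emeasure lborel {y. c + y \<in> B} = emeasure lborel B"
proof -
  have "emeasure lborel B = emeasure (distr lborel borel ((+) c)) B"
    by (simp add: lborel_distr_plus)
  also have "\<dots> = emeasure lborel {y. c + y \<in> B}"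
    by (subst emeasure_distr) (auto simp: vimage_def)
  finally show ?thesis ..
qed

text \<open>Uniqueness of Haar measure, in the case at hand: by Tonelli,
  \<open>|U| |f\<^sup>-\<^sup>1 B| = \<integral>\<integral> 1\<^sub>U x 1\<^sub>B (x + f y) dx dy = |B| |U|\<close> for the unit ball \<open>U\<close>.\<close>

lemma emeasure_lborel_isometry:
  fixes f :: "'a::euclidean_space \<Rightarrow> 'a"
  assumes lin: "linear f" and iso: "\<And>x. norm (f x) = norm x" and B[measurable]: "B \<in> sets borel"
  shows "emeasure lborel {y. f y \<in> B} = emeasure lborel B"
proof -
  have [measurable]: "f \<in> borel_measurable borel"
    using lin by (intro borel_measurable_continuous_onI linear_continuous_on)
      (simp add: linear_conv_bounded_linear)
  have "inj f"
    using lin iso by (metis linear_injective_0 norm_eq_zero)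
  then have "surj f"
    using lin by (simp add: linear_injective_imp_surjective)
  then obtain g where fg: "\<And>x. f (g x) = x"
    by (metis surjD)
  define A where "A = ball (0::'a) 1"
  have [measurable]: "A \<in> sets borel" by (simp add: A_def)
  let ?I = "\<lambda>S x. indicator S x :: ennreal"
  have *: "(\<integral>\<^sup>+y. ?I B (x + f y) \<partial>lborel) = emeasure lborel {y. f y \<in> B}" for x
  proof -
    have "(\<integral>\<^sup>+y. ?I B (x + f y) \<partial>lborel) = (\<integral>\<^sup>+y. ?I {y. x + f y \<in> B} y \<partial>lborel)"
      by (intro nn_integral_cong) (auto simp: indicator_def)
    also have "\<dots> = emeasure lborel {y. x + f y \<in> B}"
      by (subst nn_integral_indicator) measurable
    also have "{y. x + f y \<in> B} = {y. g x + y \<in> {y. f y \<in> B}}"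
      using fg lin by (simp add: linear_add)
    also have "emeasure lborel \<dots> = emeasure lborel {y. f y \<in> B}"
      by (rule emeasure_lborel_translate) measurable
    finally show ?thesis .
  qed
  have "emeasure lborel A * emeasure lborel {y. f y \<in> B} =
      (\<integral>\<^sup>+x. ?I A x * emeasure lborel {y. f y \<in> B} \<partial>lborel)"
    by (subst nn_integral_multc) (auto simp: nn_integral_indicator)
  also have "\<dots> = (\<integral>\<^sup>+x. \<integral>\<^sup>+y. ?I A x * ?I B (x + f y) \<partial>lborel \<partial>lborel)"
    by (subst nn_integral_cmult) (auto simp: *)
  also have "\<dots> = (\<integral>\<^sup>+y. \<integral>\<^sup>+x. ?I A x * ?I B (x + f y) \<partial>lborel \<partial>lborel)"
    by (rule lborel_pair.Fubini'[symmetric]) measurable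
  also have "\<dots> = (\<integral>\<^sup>+y. \<integral>\<^sup>+x. ?I A (x - f y) * ?I B x \<partial>lborel \<partial>lborel)"
  proof (rule nn_integral_cong)
    fix y
    have "(\<integral>\<^sup>+x. ?I A x * ?I B (x + f y) \<partial>lborel) =
        (\<integral>\<^sup>+x. ?I A x * ?I B (x + f y) \<partial>distr lborel borel ((+) (- f y)))"
      by (simp add: lborel_distr_plus)
    also have "\<dots> = (\<integral>\<^sup>+x. ?I A (x - f y) * ?I B x \<partial>lborel)"
      by (subst nn_integral_distr) (auto simp: algebra_simps)
    finally show "(\<integral>\<^sup>+x. ?I A x * ?I B (x + f y) \<partial>lborel) =
        (\<integral>\<^sup>+x. ?I A (x - f y) * ?I B x \<partial>lborel)" .
  qed
  also have "\<dots> = (\<integral>\<^sup>+x. \<integral>\<^sup>+y. ?I A (x - f y) * ?I B x \<partial>lborel \<partial>lborel)"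
    by (rule lborel_pair.Fubini') measurable
  also have "\<dots> = (\<integral>\<^sup>+x. emeasure lborel A * ?I B x \<partial>lborel)"
  proof (rule nn_integral_cong)
    fix x
    have "(\<integral>\<^sup>+y. ?I A (x - f y) * ?I B x \<partial>lborel) = (\<integral>\<^sup>+y. ?I A (x - f y) \<partial>lborel) * ?I B x"
      by (rule nn_integral_multc) measurable
    \<comment> \<open>Here the isometry enters: the points sent into the unit ball around x form the
      unit ball around the preimage \<open>g x\<close>, whose volume does not depend on x.\<close>
    also have "(\<integral>\<^sup>+y. ?I A (x - f y) \<partial>lborel) = (\<integral>\<^sup>+y. ?I (ball (g x) 1) y \<partial>lborel)"
    proof (intro nn_integral_cong)
      fix y
      have "norm (x - f y) = norm (g x - y)"
        using fg lin iso by (metis linear_diff)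
      then show "?I A (x - f y) = ?I (ball (g x) 1) y"
        by (simp add: indicator_def A_def dist_norm norm_minus_commute)
    qed
    also have "\<dots> = emeasure lborel (ball (g x) 1)"
      by (subst nn_integral_indicator) auto
    also have "\<dots> = emeasure lborel A"
      by (simp add: A_def emeasure_ball)
    finally show "(\<integral>\<^sup>+y. ?I A (x - f y) * ?I B x \<partial>lborel) = emeasure lborel A * ?I B x" .
  qed
  also have "\<dots> = emeasure lborel A * emeasure lborel B"
    by (subst nn_integral_cmult) (auto simp: nn_integral_indicator)
  finally have eq: "emeasure lborel A * emeasure lborel {y. f y \<in> B} = emeasure lborel A * emeasure lborel B" .
  have "emeasure lborel A \<noteq> 0" "emeasure lborel A \<noteq> top"
    using unit_ball_vol_pos[of "real DIM('a)"] by (simp_all add: A_def emeasure_ball less_imp_neq[symmetric])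
  with eq show ?thesis
    by (simp add: ennreal_mult_cancel_left)
qed

lemma emeasure_surface_space:
  "emeasure (surface_measure :: 'a::euclidean_space measure) (sphere 0 1) =
     ennreal (real DIM('a) * unit_ball_vol (real DIM('a)))"
proof -
  have "{x :: 'a. x \<noteq> 0 \<and> norm x \<le> 1 \<and> x /\<^sub>R norm x \<in> sphere 0 1} = cball 0 1 - {0}"
    by auto
  moreover have "emeasure lborel (cball (0::'a) 1 - {0}) = emeasure lborel (cball (0::'a) 1)"
    by (subst emeasure_Diff) auto
  ultimately show ?thesis
    by (subst emeasure_surface_measure) (auto simp: emeasure_cball ennreal_mult)
qed

interpretation surface: finite_measure "surface_measure :: 'a::euclidean_space measure"
  by standard (simp add: emeasure_surface_space)

definition sphere_area :: "'a::euclidean_space itself \<Rightarrow> real" where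
  "sphere_area _ = measure (surface_measure :: 'a measure) (sphere 0 1)"

lemma sphere_area_eq: "sphere_area TYPE('a::euclidean_space) = real DIM('a) * unit_ball_vol (real DIM('a))"
  by (simp add: sphere_area_def measure_def emeasure_surface_space)

lemma sphere_area_pos: "sphere_area TYPE('a::euclidean_space) > 0"
  by (simp add: sphere_area_eq unit_ball_vol_pos)

text \<open>A linear isometry commutes with the radial projection, so the cone over a preimage is
  the preimage of the cone, and the invariance of volume carries over.\<close>

lemma distr_surface_isometry:
  fixes f :: "'a::euclidean_space \<Rightarrow> 'a"
  assumes lin: "linear f" and iso: "\<And>x. norm (f x) = norm x"
  shows "distr surface_measure surface_measure f = surface_measure"
proof -
  have [measurable]: "f \<in> borel_measurable borel"
    using lin by (intro borel_measurable_continuous_onI linear_continuous_on)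
      (simp add: linear_conv_bounded_linear)
  have meas: "f \<in> surface_measure \<rightarrow>\<^sub>M surface_measure"
    unfolding measurable_cong_sets[OF sets_surface_measure sets_surface_measure]
    by (rule measurable_restrict_space3) (auto simp: iso)
  show ?thesis
  proof (rule measure_eqI)
    fix A :: "'a set" assume "A \<in> sets (distr surface_measure surface_measure f)"
    then have A: "A \<in> sets surface_measure" by simp
    then have A': "A \<in> sets borel" "A \<subseteq> sphere 0 1"
      by (auto simp: sets_restrict_space_iff)
    have *: "{x. x \<noteq> 0 \<and> norm x \<le> 1 \<and> x /\<^sub>R norm x \<in> f -` A \<inter> sphere 0 1} =
        {x. f x \<in> {x. x \<noteq> 0 \<and> norm x \<le> 1 \<and> x /\<^sub>R norm x \<in> A}}"
    proof -
      have "f (x /\<^sub>R norm x) = f x /\<^sub>R norm (f x)" for x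
        using lin iso by (simp add: linear_cmul)
      moreover have "f x = 0 \<longleftrightarrow> x = 0" for x using iso by (metis norm_eq_zero)
      ultimately show ?thesis using A'(2) iso by auto
    qed
    have [measurable]: "A \<in> sets borel" by fact
    have "{x. x \<noteq> 0 \<and> norm x \<le> 1 \<and> x /\<^sub>R norm x \<in> A} \<in> sets borel"
      by measurable
    then have "emeasure lborel {x. x \<noteq> 0 \<and> norm x \<le> 1 \<and> x /\<^sub>R norm x \<in> f -` A \<inter> sphere 0 1} =
      emeasure lborel {x. x \<noteq> 0 \<and> norm x \<le> 1 \<and> x /\<^sub>R norm x \<in> A}"
      unfolding * by (intro emeasure_lborel_isometry[OF lin iso])
    moreover have "f -` A \<inter> sphere 0 1 \<in> sets borel"
      using measurable_sets_borel[OF \<open>f \<in> borel_measurable borel\<close> A'(1)] by (intro sets.Int) auto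
    ultimately show "emeasure (distr surface_measure surface_measure f) A = emeasure surface_measure A"
      using A' by (subst emeasure_distr[OF meas A]) (simp add: emeasure_surface_measure)
  qed simp
qed

lemma integral_surface_isometry:
  fixes f :: "'a::euclidean_space \<Rightarrow> 'a" and g :: "'a \<Rightarrow> real"
  assumes lin: "linear f" and iso: "\<And>x. norm (f x) = norm x" and g: "g \<in> borel_measurable surface_measure"
  shows "(LINT y|surface_measure. g (f y)) = (LINT y|surface_measure. g y)"
proof -
  have [measurable]: "f \<in> borel_measurable borel"
    using lin by (intro borel_measurable_continuous_onI linear_continuous_on)
      (simp add: linear_conv_bounded_linear)
  have meas: "f \<in> surface_measure \<rightarrow>\<^sub>M surface_measure"
    unfolding measurable_cong_sets[OF sets_surface_measure sets_surface_measure]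
    by (rule measurable_restrict_space3) (auto simp: iso)
  have "(LINT y|surface_measure. g y) = (LINT y|distr surface_measure surface_measure f. g y)"
    by (simp add: distr_surface_isometry[OF lin iso])
  also have "\<dots> = (LINT y|surface_measure. g (f y))"
    by (rule integral_distr[OF meas g])
  finally show ?thesis ..
qed

section \<open>Integration by parts along rotations\<close>

lemma measurable_surface_continuous:
  fixes g :: "'a::euclidean_space \<Rightarrow> 'b::{second_countable_topology, real_normed_vector}"
  assumes "continuous_on (sphere 0 1) g"
  shows "g \<in> borel_measurable surface_measure"
  using borel_measurable_continuous_on_restrict[OF assms]
  by (simp cong: measurable_cong_sets)

lemma integrable_surface_continuous:
  fixes g :: "'a::euclidean_space \<Rightarrow> 'b::{second_countable_topology, banach}"
  assumes "continuous_on (sphere 0 1) g"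
  shows "integrable surface_measure g"
proof -
  have "bounded (g ` sphere 0 1)"
    by (intro compact_imp_bounded compact_continuous_image assms compact_sphere)
  then obtain C where "\<forall>y\<in>sphere 0 1. norm (g y) \<le> C"
    by (auto simp: bounded_iff)
  then show ?thesis
    by (intro surface.integrable_const_bound[of _ C] AE_I2 measurable_surface_continuous assms) auto
qed

text \<open>The integral of \<open>\<phi> (R t y)\<close> over y does not change with t, hence its
  derivative at 0 vanishes. The derivative is assumed along the whole flow because the mean value
  theorem writes each difference quotient as a value of \<open>\<psi>\<close> on the sphere, which
  supplies the dominating constant.\<close>

lemma integral_surface_flow_derivative:
  fixes R :: "real \<Rightarrow> 'a::euclidean_space \<Rightarrow> 'a" and \<phi> \<psi> :: "'a \<Rightarrow> real"
  assumes lin: "\<And>t. linear (R t)" and iso: "\<And>t x. norm (R t x) = norm x" and R0: "\<And>x. R 0 x = x"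
    and cont: "continuous_on (sphere 0 1) \<phi>" "continuous_on (sphere 0 1) \<psi>"
    and deriv: "\<And>t y. norm y = 1 \<Longrightarrow> ((\<lambda>t. \<phi> (R t y)) has_real_derivative \<psi> (R t y)) (at t)"
  shows "(LINT y|surface_measure. \<psi> y) = 0"
proof -
  have "bounded (\<psi> ` sphere 0 1)"
    by (intro compact_imp_bounded compact_continuous_image cont compact_sphere)
  then obtain C where C: "\<forall>y\<in>sphere 0 1. \<bar>\<psi> y\<bar> \<le> C"
    by (auto simp: bounded_iff)
  define h where "h n = inverse (real (Suc n))" for n
  have h0: "h \<longlonglongrightarrow> 0" unfolding h_def by (rule LIMSEQ_inverse_real_of_nat)
  have hpos: "h n > 0" for n by (simp add: h_def)
  define s where "s n y = (\<phi> (R (h n) y) - \<phi> y) / h n" for n y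
  have contR: "continuous_on (sphere 0 1) (\<lambda>y. \<phi> (R t y))" for t
  proof -
    have "continuous_on (sphere 0 1) (R t)"
      using lin by (intro linear_continuous_on) (simp add: linear_conv_bounded_linear)
    moreover have "R t ` sphere 0 1 \<subseteq> sphere 0 1" by (auto simp: iso)
    ultimately show ?thesis
      by (rule continuous_on_compose2[OF cont(1)])
  qed
  have s_int: "(LINT y|surface_measure. s n y) = 0" for n
  proof -
    have "(LINT y|surface_measure. s n y) =
        ((LINT y|surface_measure. \<phi> (R (h n) y)) - (LINT y|surface_measure. \<phi> y)) / h n"
      unfolding s_def using contR cont(1)
      by (subst integral_divide_zero, subst Bochner_Integration.integral_diff)
         (auto intro!: integrable_surface_continuous)
    also have "(LINT y|surface_measure. \<phi> (R (h n) y)) = (LINT y|surface_measure. \<phi> y)"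
      by (intro integral_surface_isometry lin iso measurable_surface_continuous cont)
    finally show ?thesis by simp
  qed
  have "(\<lambda>n. LINT y|surface_measure. s n y) \<longlonglongrightarrow> (LINT y|surface_measure. \<psi> y)"
  proof (rule integral_dominated_convergence[where w = "\<lambda>_. C"])
    show "\<psi> \<in> borel_measurable surface_measure"
      by (rule measurable_surface_continuous) fact
    show "s n \<in> borel_measurable surface_measure" for n
      unfolding s_def by (intro measurable_surface_continuous continuous_intros contR cont) (auto simp: h_def)
    show "integrable surface_measure (\<lambda>_::'a. C)" by simp
    show "AE y in surface_measure. (\<lambda>n. s n y) \<longlonglongrightarrow> \<psi> y"
    proof (rule AE_I2)
      fix y :: 'a assume "y \<in> space surface_measure"
      then have "((\<lambda>t. \<phi> (R t y)) has_real_derivative \<psi> (R 0 y)) (at 0)"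
        by (intro deriv) simp
      then have *: "((\<lambda>t. (\<phi> (R t y) - \<phi> y) / t) \<longlongrightarrow> \<psi> y) (at 0)"
        by (simp add: has_field_derivative_iff R0)
      show "(\<lambda>n. s n y) \<longlonglongrightarrow> \<psi> y"
        unfolding s_def
      proof (rule filterlim_compose[OF *])
        show "filterlim h (at 0) sequentially"
          using h0 hpos by (auto simp: filterlim_at less_imp_neq[symmetric])
      qed
    qed
    show "AE y in surface_measure. norm (s n y) \<le> C" for n
    proof (rule AE_I2)
      fix y :: 'a assume y: "y \<in> space surface_measure"
      then have ny: "norm y = 1" by simp
      obtain z where "\<phi> (R (h n) y) - \<phi> (R 0 y) = (h n - 0) * \<psi> (R z y)"
        using MVT2[of 0 "h n" "\<lambda>t. \<phi> (R t y)" "\<lambda>t. \<psi> (R t y)"] deriv[OF ny] hpos by blast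
      then have "s n y = \<psi> (R z y)"
        using hpos[of n] by (simp add: s_def R0)
      then show "norm (s n y) \<le> C"
        using C ny by (simp add: iso)
    qed
  qed
  then show ?thesis
    by (simp add: s_int LIMSEQ_const_iff)
qed

text \<open>For distinct basis vectors this rotates the plane of a and b by the angle t. Writing it
  as y plus a correction leaves the orthogonal complement fixed without having to name it.\<close>

definition plane_rotation :: "'a::euclidean_space \<Rightarrow> 'a \<Rightarrow> real \<Rightarrow> 'a \<Rightarrow> 'a" where
  "plane_rotation a b t y =
     y + ((cos t - 1) * (y \<bullet> a) - sin t * (y \<bullet> b)) *\<^sub>R a
       + ((cos t - 1) * (y \<bullet> b) + sin t * (y \<bullet> a)) *\<^sub>R b"

lemma plane_rotation_inner:
  "plane_rotation a b t y \<bullet> x =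
     y \<bullet> x + ((cos t - 1) * (y \<bullet> a) - sin t * (y \<bullet> b)) * (a \<bullet> x)
       + ((cos t - 1) * (y \<bullet> b) + sin t * (y \<bullet> a)) * (b \<bullet> x)"
  by (simp add: plane_rotation_def inner_left_distrib)

lemma linear_plane_rotation: "linear (plane_rotation a b t)"
  by (rule linearI) (simp_all add: plane_rotation_def algebra_simps inner_left_distrib scaleR_add_left scaleR_add_right)

lemma plane_rotation_inner_basis:
  assumes "a \<in> Basis" "b \<in> Basis" "a \<noteq> b"
  shows "plane_rotation a b t y \<bullet> a = cos t * (y \<bullet> a) - sin t * (y \<bullet> b)"
    and "plane_rotation a b t y \<bullet> b = cos t * (y \<bullet> b) + sin t * (y \<bullet> a)"
  using assms by (auto simp: plane_rotation_inner inner_Basis algebra_simps)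

lemma norm_plane_rotation:
  assumes ab: "a \<in> Basis" "b \<in> Basis" "a \<noteq> b"
  shows "norm (plane_rotation a b t y) = norm y"
proof -
  define A B where "A = y \<bullet> a" and "B = y \<bullet> b"
  define p where "p = (cos t - 1) * A - sin t * B"
  define q where "q = (cos t - 1) * B + sin t * A"
  have ortho: "a \<bullet> a = 1" "b \<bullet> b = 1" "a \<bullet> b = 0" "b \<bullet> a = 0" "a \<bullet> y = A" "b \<bullet> y = B"
    using ab by (auto simp: inner_Basis A_def B_def inner_commute)
  have "plane_rotation a b t y \<bullet> plane_rotation a b t y =
      (y + p *\<^sub>R a + q *\<^sub>R b) \<bullet> (y + p *\<^sub>R a + q *\<^sub>R b)"
    by (simp add: plane_rotation_def p_def q_def A_def B_def)
  also have "\<dots> = y \<bullet> y + 2 * p * A + 2 * q * B + p * p + q * q"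
    by (simp add: inner_left_distrib inner_right_distrib ortho A_def[symmetric] B_def[symmetric]
        algebra_simps)
  also have "2 * p * A + 2 * q * B + p * p + q * q =
      (cos t * cos t + sin t * sin t - 1) * (A * A + B * B)"
    unfolding p_def q_def by (simp only: algebra_simps)
  then have "y \<bullet> y + 2 * p * A + 2 * q * B + p * p + q * q = y \<bullet> y"
    using sin_cos_squared_add3[of t] by simp
  finally show ?thesis by (simp add: norm_eq_sqrt_inner)
qed

lemma has_derivative_plane_rotation_inner:
  assumes "a \<in> Basis" "b \<in> Basis" "a \<noteq> b"
  shows "((\<lambda>t. x \<bullet> plane_rotation a b t y) has_real_derivative
     (plane_rotation a b t y \<bullet> a) * (x \<bullet> b) - (plane_rotation a b t y \<bullet> b) * (x \<bullet> a)) (at t)"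
proof -
  have "a \<bullet> a = 1" "b \<bullet> b = 1" "a \<bullet> b = 0"
    using assms by (auto simp: inner_Basis)
  then show ?thesis
    unfolding plane_rotation_inner_basis[OF assms] inner_commute[of x] plane_rotation_inner
    by (auto intro!: derivative_eq_intros simp: algebra_simps inner_commute)
qed

text \<open>Lagrange's identity, doubled because ordered pairs are summed. On the sphere it provides
  the factor \<open>1 - u^2\<close> of the second derivative.\<close>

lemma sum_basis_skew_square:
  fixes x y :: "'a::euclidean_space"
  shows "(\<Sum>a\<in>Basis. \<Sum>b\<in>Basis. ((y \<bullet> a) * (x \<bullet> b) - (y \<bullet> b) * (x \<bullet> a))\<^sup>2)
     = 2 * ((x \<bullet> x) * (y \<bullet> y) - (x \<bullet> y)\<^sup>2)"
proof -
  have e: "u \<bullet> v = (\<Sum>a\<in>Basis. (u \<bullet> a) * (v \<bullet> a))" for u v :: 'a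
    by (rule euclidean_inner)
  have "(\<Sum>a\<in>Basis. \<Sum>b\<in>Basis. ((y \<bullet> a) * (x \<bullet> b) - (y \<bullet> b) * (x \<bullet> a))\<^sup>2) =
      (\<Sum>a\<in>Basis. \<Sum>b\<in>Basis. ((y \<bullet> a) * (y \<bullet> a)) * ((x \<bullet> b) * (x \<bullet> b))
        + ((x \<bullet> a) * (x \<bullet> a)) * ((y \<bullet> b) * (y \<bullet> b))
        - 2 * (((x \<bullet> a) * (y \<bullet> a)) * ((x \<bullet> b) * (y \<bullet> b))))"
    by (intro sum.cong refl) (simp add: power2_eq_square algebra_simps)
  also have "\<dots> = (y \<bullet> y) * (x \<bullet> x) + (x \<bullet> x) * (y \<bullet> y) - 2 * ((x \<bullet> y) * (x \<bullet> y))"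
    unfolding e[of x y] e[of x x] e[of y y]
    by (simp only: sum.distrib sum_subtractf sum_distrib_left[symmetric] sum_distrib_right[symmetric])
  finally show ?thesis by (simp add: power2_eq_square algebra_simps)
qed

text \<open>Each coordinate product occurs in \<open>2 (DIM - 1)\<close> ordered pairs of distinct
  indices. The diagonal has to be left out, since only distinct vectors span a plane of
  rotation.\<close>

lemma sum_basis_offdiag:
  fixes x y :: "'a::euclidean_space"
  shows "(\<Sum>a\<in>Basis. \<Sum>b\<in>Basis - {a}. (y \<bullet> a) * (x \<bullet> a) + (y \<bullet> b) * (x \<bullet> b))
     = 2 * (real DIM('a) - 1) * (x \<bullet> y)"
proof -
  have e: "x \<bullet> y = (\<Sum>a\<in>Basis. (y \<bullet> a) * (x \<bullet> a))"
    by (subst euclidean_inner) (simp add: mult.commute)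
  have "(\<Sum>b\<in>Basis - {a}. (y \<bullet> a) * (x \<bullet> a) + (y \<bullet> b) * (x \<bullet> b)) =
      (real DIM('a) - 2) * ((y \<bullet> a) * (x \<bullet> a)) + x \<bullet> y" if "a \<in> Basis" for a
    using that
    by (simp add: sum.distrib e sum_diff1 card_Diff_singleton of_nat_diff DIM_positive Suc_leI algebra_simps)
  then have "(\<Sum>a\<in>Basis. \<Sum>b\<in>Basis - {a}. (y \<bullet> a) * (x \<bullet> a) + (y \<bullet> b) * (x \<bullet> b)) =
      (\<Sum>a\<in>Basis. (real DIM('a) - 2) * ((y \<bullet> a) * (x \<bullet> a)) + x \<bullet> y)"
    by simp
  also have "\<dots> = (real DIM('a) - 2) * (x \<bullet> y) + real DIM('a) * (x \<bullet> y)"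
    by (simp add: sum.distrib flip: sum_distrib_left e)
  finally show ?thesis by (simp add: algebra_simps)
qed

text \<open>The Laplace-Beltrami operator is \<open>\<Sum>\<^sub>a\<^sub>b D\<^sub>a\<^sub>b\<^sup>2 / 2\<close> with the generators
  \<open>D\<^sub>a\<^sub>b = y\<^sub>a \<partial>\<^sub>b - y\<^sub>b \<partial>\<^sub>a\<close> of the rotations, and it maps \<open>F (x \<bullet> y)\<close> to
  \<open>(1 - u\<^sup>2) F'' u - (DIM - 1) u F' u\<close> at \<open>u = x \<bullet> y\<close>; this is Green's identity for it.\<close>

lemma zonal_green:
  fixes x z :: "'a::euclidean_space" and F F' F'' G G' G'' :: "real \<Rightarrow> real"
  assumes F: "\<And>u. (F has_real_derivative F' u) (at u)" "\<And>u. (F' has_real_derivative F'' u) (at u)"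
    and G: "\<And>u. (G has_real_derivative G' u) (at u)" "\<And>u. (G' has_real_derivative G'' u) (at u)"
    and cont: "continuous_on UNIV F''" "continuous_on UNIV G''"
    and x: "norm x = 1" and z: "norm z = 1"
  shows "(LINT y|surface_measure.
        ((1 - (x \<bullet> y)\<^sup>2) * F'' (x \<bullet> y) - (real DIM('a) - 1) * (x \<bullet> y) * F' (x \<bullet> y)) * G (z \<bullet> y)) =
     (LINT y|surface_measure.
        F (x \<bullet> y) * ((1 - (z \<bullet> y)\<^sup>2) * G'' (z \<bullet> y) - (real DIM('a) - 1) * (z \<bullet> y) * G' (z \<bullet> y)))"
proof -
  have cF: "continuous_on UNIV F" "continuous_on UNIV F'" and cG: "continuous_on UNIV G" "continuous_on UNIV G'"
    using F G by (auto intro!: continuous_at_imp_continuous_on DERIV_isCont)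
  have comp: "continuous_on S (\<lambda>y. H (x \<bullet> y))" if "continuous_on UNIV H" for H :: "real \<Rightarrow> real" and S and x :: 'a
    by (rule continuous_on_compose2[OF that]) (auto intro!: continuous_intros)
  note ci = comp[OF cF(1)] comp[OF cF(2)] comp[OF cG(1)] comp[OF cG(2)] comp[OF cont(1)] comp[OF cont(2)]
  \<comment> \<open>Along the rotation in the plane of a and b, \<open>w x a b\<close> is the
    derivative of \<open>x \<bullet> y\<close>, and \<open>- v x a b\<close> is that of
    \<open>w x a b\<close>.\<close>
  define w where "w x a b y = (y \<bullet> a) * (x \<bullet> b) - (y \<bullet> b) * (x \<bullet> a)" for x a b y :: 'a
  define v where "v x a b y = (y \<bullet> a) * (x \<bullet> a) + (y \<bullet> b) * (x \<bullet> b)" for x a b y :: 'a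
  \<comment> \<open>The derivative of the Wronskian \<open>F' w_x G - F G' w_z\<close> along the
    rotation. The mixed products \<open>F' G' w_x w_z\<close> cancel, so summing over the planes
    leaves twice the difference of the two sides of Green's identity.\<close>
  define \<psi> where "\<psi> a b y = F'' (x \<bullet> y) * (w x a b y)\<^sup>2 * G (z \<bullet> y) - F' (x \<bullet> y) * v x a b y * G (z \<bullet> y)
      - (F (x \<bullet> y) * G'' (z \<bullet> y) * (w z a b y)\<^sup>2 - F (x \<bullet> y) * G' (z \<bullet> y) * v z a b y)" for a b y
  have c\<psi>: "continuous_on S (\<psi> a b)" for a b S
    unfolding \<psi>_def w_def v_def by (intro continuous_intros ci)
  have zero: "(LINT y|surface_measure. \<psi> a b y) = 0" if ab: "a \<in> Basis" "b \<in> Basis" "a \<noteq> b" for a b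
  proof (rule integral_surface_flow_derivative[where R = "plane_rotation a b" and
      \<phi> = "\<lambda>y. F' (x \<bullet> y) * w x a b y * G (z \<bullet> y) - F (x \<bullet> y) * G' (z \<bullet> y) * w z a b y"])
    show "continuous_on (sphere 0 1) (\<psi> a b)" by (rule c\<psi>)
    show "continuous_on (sphere 0 1)
        (\<lambda>y. F' (x \<bullet> y) * w x a b y * G (z \<bullet> y) - F (x \<bullet> y) * G' (z \<bullet> y) * w z a b y)"
      unfolding w_def by (intro continuous_intros ci)
    show "plane_rotation a b 0 y = y" for y by (simp add: plane_rotation_def)
    show "linear (plane_rotation a b t)" for t by (rule linear_plane_rotation)
    show "norm (plane_rotation a b t y) = norm y" for t y by (rule norm_plane_rotation[OF ab])
    fix t y
    let ?R = "\<lambda>t. plane_rotation a b t y"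
    have dx: "((\<lambda>t. x \<bullet> ?R t) has_real_derivative w x a b (?R t)) (at t)" for x
      unfolding w_def by (rule has_derivative_plane_rotation_inner[OF ab])
    have d: "((\<lambda>t. H (x \<bullet> ?R t)) has_real_derivative H' (x \<bullet> ?R t) * w x a b (?R t)) (at t)"
      if "\<And>u. (H has_real_derivative H' u) (at u)" for H H' x
      using DERIV_chain2[OF that dx] .
    have da: "((\<lambda>t. ?R t \<bullet> a) has_real_derivative - (?R t \<bullet> b)) (at t)"
      "((\<lambda>t. ?R t \<bullet> b) has_real_derivative ?R t \<bullet> a) (at t)"
      using ab by (auto simp: plane_rotation_inner_basis intro!: derivative_eq_intros)
    have dw: "((\<lambda>t. w x a b (?R t)) has_real_derivative - v x a b (?R t)) (at t)" for x
      unfolding w_def v_def by (rule derivative_eq_intros da refl)+ (simp add: algebra_simps)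
    show "((\<lambda>t. F' (x \<bullet> ?R t) * w x a b (?R t) * G (z \<bullet> ?R t) - F (x \<bullet> ?R t) * G' (z \<bullet> ?R t) * w z a b (?R t))
        has_real_derivative \<psi> a b (?R t)) (at t)"
      unfolding \<psi>_def
      by (rule derivative_eq_intros d[OF F(1)] d[OF F(2)] d[OF G(1)] d[OF G(2)] dw refl)+
         (simp add: algebra_simps power2_eq_square)
  qed
  let ?L = "\<lambda>y. ((1 - (x \<bullet> y)\<^sup>2) * F'' (x \<bullet> y) - (real DIM('a) - 1) * (x \<bullet> y) * F' (x \<bullet> y)) * G (z \<bullet> y)"
  let ?M = "\<lambda>y. F (x \<bullet> y) * ((1 - (z \<bullet> y)\<^sup>2) * G'' (z \<bullet> y) - (real DIM('a) - 1) * (z \<bullet> y) * G' (z \<bullet> y))"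
  have sumw: "(\<Sum>a\<in>Basis. \<Sum>b\<in>Basis - {a}. (w x a b y)\<^sup>2) = 2 * (1 - (x \<bullet> y)\<^sup>2)"
    if "norm x = 1" "norm y = 1" for x y
  proof -
    have "(\<Sum>b\<in>Basis - {a}. (w x a b y)\<^sup>2) = (\<Sum>b\<in>Basis. (w x a b y)\<^sup>2)" for a
      by (rule sum.mono_neutral_left) (auto simp: w_def)
    then show ?thesis
      using sum_basis_skew_square[of y x] that by (simp add: w_def dot_square_norm)
  qed
  have sumv: "(\<Sum>a\<in>Basis. \<Sum>b\<in>Basis - {a}. v x a b y) = 2 * (real DIM('a) - 1) * (x \<bullet> y)" for x y
    unfolding v_def by (rule sum_basis_offdiag)
  have sum\<psi>: "(\<Sum>a\<in>Basis. \<Sum>b\<in>Basis - {a}. \<psi> a b y) = 2 * (?L y - ?M y)" if "norm y = 1" for y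
  proof -
    have "(\<Sum>a\<in>Basis. \<Sum>b\<in>Basis - {a}. \<psi> a b y) =
        F'' (x \<bullet> y) * (\<Sum>a\<in>Basis. \<Sum>b\<in>Basis - {a}. (w x a b y)\<^sup>2) * G (z \<bullet> y)
        - F' (x \<bullet> y) * (\<Sum>a\<in>Basis. \<Sum>b\<in>Basis - {a}. v x a b y) * G (z \<bullet> y)
        - (F (x \<bullet> y) * G'' (z \<bullet> y) * (\<Sum>a\<in>Basis. \<Sum>b\<in>Basis - {a}. (w z a b y)\<^sup>2)
           - F (x \<bullet> y) * G' (z \<bullet> y) * (\<Sum>a\<in>Basis. \<Sum>b\<in>Basis - {a}. v z a b y))"
      unfolding \<psi>_def by (simp only: sum_subtractf sum_distrib_left sum_distrib_right)
    also have "\<dots> = 2 * (?L y - ?M y)"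
      unfolding sumw[OF x that] sumw[OF z that] sumv by (simp add: algebra_simps)
    finally show ?thesis .
  qed
  have "2 * ((LINT y|surface_measure. ?L y) - (LINT y|surface_measure. ?M y)) =
      (LINT y|surface_measure. 2 * (?L y - ?M y))"
    by (subst integral_mult_right_zero, subst Bochner_Integration.integral_diff)
       (intro integrable_surface_continuous continuous_intros ci refl)+
  also have "\<dots> = (LINT y|surface_measure. (\<Sum>a\<in>Basis. \<Sum>b\<in>Basis - {a}. \<psi> a b y))"
    by (intro Bochner_Integration.integral_cong refl) (simp add: sum\<psi>)
  also have "\<dots> = (\<Sum>a\<in>Basis. \<Sum>b\<in>Basis - {a}. (LINT y|surface_measure. \<psi> a b y))"
    by (subst Bochner_Integration.integral_sum)
       (auto intro!: integrable_surface_continuous c\<psi> Bochner_Integration.integrable_sum sum.cong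
          Bochner_Integration.integral_sum)
  also have "\<dots> = 0"
    by (intro sum.neutral ballI) (auto intro!: zero)
  finally show ?thesis by simp
qed

section \<open>Differences of the symbol\<close>

definition fdiff :: "(nat \<Rightarrow> real) \<Rightarrow> nat \<Rightarrow> real" where
  "fdiff m k = m k - m (Suc k)"

text \<open>One difference shrinks the disc by \<open>1 + \<eta>\<close>: by 1 to contain the
  shifted point, by \<open>\<eta>\<close> to leave room for Cauchy's inequality at every point of
  the segment. The estimate of the derivative then gains the factor
  \<open>1 / \<eta>\<close>.\<close>

lemma holomorphic_difference_bound:
  fixes g :: "complex \<Rightarrow> complex" and x :: complex
  assumes hol: "g holomorphic_on ball x r" and bound: "\<And>z. z \<in> ball x r \<Longrightarrow> norm (g z) \<le> B"
    and \<eta>: "\<eta> > 0"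
  shows "(\<lambda>z. g z - g (z + 1)) holomorphic_on ball x (r - (1 + \<eta>))"
    and "z \<in> ball x (r - (1 + \<eta>)) \<Longrightarrow> norm (g z - g (z + 1)) \<le> B / \<eta>"
proof -
  have shift: "z + 1 \<in> ball x (r - \<eta>)" if "z \<in> ball x (r - (1 + \<eta>))" for z
  proof -
    have "dist x (z + 1) \<le> dist x z + dist z (z + 1)" by (rule dist_triangle)
    also have "dist z (z + 1) = 1" by (simp add: dist_norm)
    finally show ?thesis using that by simp
  qed
  show "(\<lambda>z. g z - g (z + 1)) holomorphic_on ball x (r - (1 + \<eta>))"
  proof (intro holomorphic_on_diff)
    show "g holomorphic_on ball x (r - (1 + \<eta>))"
      by (rule holomorphic_on_subset[OF hol]) (use \<eta> in auto)
    have "(g \<circ> (\<lambda>z. z + 1)) holomorphic_on ball x (r - (1 + \<eta>))"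
      by (rule holomorphic_on_compose_gen[OF _ hol]) (use shift \<eta> in \<open>force intro!: holomorphic_intros\<close>)+
    then show "(\<lambda>z. g (z + 1)) holomorphic_on ball x (r - (1 + \<eta>))" by (simp add: o_def)
  qed
  assume z: "z \<in> ball x (r - (1 + \<eta>))"
  have seg: "closed_segment z (z + 1) \<subseteq> ball x (r - \<eta>)"
    using shift[OF z] z \<eta> by (intro closed_segment_subset) auto
  have "norm (g (z + 1) - g z) \<le> B / \<eta> * norm (z + 1 - z)"
  proof (rule field_differentiable_bound[where S = "closed_segment z (z + 1)" and f' = "deriv g"])
    fix w assume "w \<in> closed_segment z (z + 1)"
    then have w: "dist x w < r - \<eta>" using seg by auto
    have sub: "cball w \<eta> \<subseteq> ball x r"
    proof
      fix u assume "u \<in> cball w \<eta>"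
      then show "u \<in> ball x r"
        using w dist_triangle[of x u w] by simp
    qed
    have "w \<in> ball x r" using w \<eta> by simp
    then have "(g has_field_derivative deriv g w) (at w)"
      by (intro holomorphic_derivI[OF hol open_ball])
    then show "(g has_field_derivative deriv g w) (at w within closed_segment z (z + 1))"
      by (rule has_field_derivative_at_within)
    have "norm ((deriv ^^ 1) g w) \<le> fact 1 * B / \<eta> ^ 1"
    proof (rule Cauchy_inequality)
      show "g holomorphic_on ball w \<eta>"
        by (rule holomorphic_on_subset[OF hol]) (use sub in auto)
      show "continuous_on (cball w \<eta>) g"
        by (rule holomorphic_on_imp_continuous_on[OF holomorphic_on_subset[OF hol sub]])
      fix u assume "norm (w - u) = \<eta>"
      then have "u \<in> cball w \<eta>" by (simp add: dist_norm)
      then show "norm (g u) \<le> B" using sub bound by blast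
    qed (rule \<eta>)
    then show "norm (deriv g w) \<le> B / \<eta>" by simp
  qed auto
  then show "norm (g z - g (z + 1)) \<le> B / \<eta>"
    by (simp add: norm_minus_commute)
qed

lemma holomorphic_iterated_difference_bound:
  fixes f :: "complex \<Rightarrow> complex" and x :: complex
  assumes hol: "f holomorphic_on ball x R" and bound: "\<And>z. z \<in> ball x R \<Longrightarrow> norm (f z) \<le> B"
    and \<eta>: "\<eta> > 0"
  defines "F \<equiv> \<lambda>j. ((\<lambda>g z. g z - g (z + 1)) ^^ j) f"
  shows "F j holomorphic_on ball x (R - real j * (1 + \<eta>)) \<and>
     (\<forall>z\<in>ball x (R - real j * (1 + \<eta>)). norm (F j z) \<le> B / \<eta> ^ j)"
proof (induction j)
  case 0
  then show ?case using hol bound by (simp add: F_def)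
next
  case (Suc j)
  let ?r = "R - real j * (1 + \<eta>)"
  have r: "R - real (Suc j) * (1 + \<eta>) = ?r - (1 + \<eta>)" by (simp add: algebra_simps)
  have FS: "F (Suc j) = (\<lambda>z. F j z - F j (z + 1))" by (simp add: F_def)
  have IH: "F j holomorphic_on ball x ?r" "\<And>z. z \<in> ball x ?r \<Longrightarrow> norm (F j z) \<le> B / \<eta> ^ j"
    using Suc by auto
  have "norm (F j z - F j (z + 1)) \<le> B / \<eta> ^ j / \<eta>" if "z \<in> ball x (?r - (1 + \<eta>))" for z
    by (rule holomorphic_difference_bound(2)[OF IH(1) _ \<eta> that]) (rule IH(2))
  moreover have "(\<lambda>z. F j z - F j (z + 1)) holomorphic_on ball x (?r - (1 + \<eta>))"
    by (rule holomorphic_difference_bound(1)[OF IH(1) _ \<eta>]) (rule IH(2))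
  ultimately show ?case unfolding r FS by (simp add: mult.commute)
qed

lemma iterated_fdiff_eq:
  assumes "\<And>i. i \<ge> k0 \<Longrightarrow> complex_of_real (m i) = f (of_nat i)" "i \<ge> k0"
  shows "complex_of_real ((fdiff ^^ j) m i) = ((\<lambda>g z. g z - g (z + 1)) ^^ j) f (of_nat i)"
  using assms(2)
proof (induction j arbitrary: i)
  case 0
  then show ?case using assms(1) by simp
next
  case (Suc j)
  then show ?case
    using Suc.IH[of i] Suc.IH[of "Suc i"] by (simp add: fdiff_def add.commute)
qed

text \<open>When R and \<open>\<eta>\<close> are proportional to k, this is the decay
  \<open>k^(-j)\<close>. The condition \<open>j * (1 + \<eta>) < R\<close> keeps the centre inside
  the disc that is left after j differences.\<close>

lemma iterated_fdiff_bound: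
  assumes eq: "\<And>i. i \<ge> k \<Longrightarrow> complex_of_real (m i) = f (of_nat i)"
    and hol: "f holomorphic_on ball (of_nat k) R"
    and bound: "\<And>z. z \<in> ball (of_nat k) R \<Longrightarrow> norm (f z) \<le> B"
    and \<eta>: "\<eta> > 0" "real j * (1 + \<eta>) < R"
  shows "\<bar>(fdiff ^^ j) m k\<bar> \<le> B / \<eta> ^ j"
proof -
  have "\<bar>(fdiff ^^ j) m k\<bar> = norm (complex_of_real ((fdiff ^^ j) m k))" by simp
  also have "\<dots> = norm (((\<lambda>g z. g z - g (z + 1)) ^^ j) f (of_nat k))"
    by (subst iterated_fdiff_eq[where f = f and ?k0.0 = k]) (auto intro: eq)
  also have "\<dots> \<le> B / \<eta> ^ j"
    using holomorphic_iterated_difference_bound[OF hol bound \<eta>(1), of j] \<eta>(2) by auto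
  finally show ?thesis .
qed

text \<open>Intended for the finitely many small indices, around which no disc of the required size
  is available.\<close>

lemma iterated_fdiff_trivial_bound:
  assumes "\<And>k. \<bar>m k\<bar> \<le> B"
  shows "\<bar>(fdiff ^^ j) m k\<bar> \<le> 2 ^ j * B"
proof (induction j arbitrary: k)
  case (Suc j)
  show ?case using Suc[of k] Suc[of "Suc k"] by (simp add: fdiff_def)
qed (use assms in simp)

section \<open>The symbol in a sector around the positive axis\<close>

lemma poly_of_real_map_poly:
  "poly (map_poly complex_of_real p) (of_real x) = of_real (poly p x)"
  by (simp add: poly_altdef coeff_map_poly degree_map_poly)

text \<open>On discs of radius \<open>\<epsilon> x\<close> around x the polynomial stays in a disc
  around its leading term that avoids the origin and the negative axis. A logarithm, and with it any
  real power, is therefore holomorphic on discs that grow in proportion to x.\<close>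

lemma poly_near_leading_term:
  fixes p :: "real poly"
  assumes a: "lead_coeff p > 0" and d: "degree p > 0"
  obtains \<epsilon> x0 where "\<epsilon> > 0" "x0 \<ge> 1"
    "\<And>x z. x \<ge> x0 \<Longrightarrow> norm (z - complex_of_real x) \<le> \<epsilon> * x \<Longrightarrow>
       norm (poly (map_poly complex_of_real p) z - of_real (lead_coeff p * x ^ degree p))
         \<le> lead_coeff p * x ^ degree p / 2"
proof -
  define n where "n = degree p"
  define l where "l = lead_coeff p"
  have "isCont (\<lambda>w :: complex. w ^ n) 1" by (intro continuous_intros)
  then obtain \<delta> where \<delta>: "\<delta> > 0" "\<And>w :: complex. norm (w - 1) < \<delta> \<Longrightarrow> norm (w ^ n - 1) < 1 / 4"
    unfolding continuous_at_eps_delta dist_norm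
    by (metis power_one zero_less_divide_1_iff zero_less_numeral)
  \<comment> \<open>The cap 1 gives \<open>norm w \<le> 2\<close> for \<open>w = z / x\<close>,
    whence the powers of 2 in S; half of \<open>\<delta>\<close> makes the strict bound near 1
    available on the closed disc.\<close>
  define \<epsilon> where "\<epsilon> = min (\<delta> / 2) 1"
  define S where "S = (\<Sum>i<n. \<bar>coeff p i\<bar> * 2 ^ i)"
  have S0: "S \<ge> 0" unfolding S_def by (intro sum_nonneg) auto
  \<comment> \<open>Beyond \<open>4 * S / l\<close> the lower terms amount to at most a quarter of
    the leading one; the other quarter is the error of \<open>w ^ n\<close>.\<close>
  define x0 where "x0 = max 1 (4 * S / l)"
  show thesis
  proof (rule that[of \<epsilon> x0])
    show "\<epsilon> > 0" "x0 \<ge> 1" using \<delta> by (auto simp: \<epsilon>_def x0_def)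
    fix x :: real and z :: complex
    assume x: "x \<ge> x0" and z: "norm (z - complex_of_real x) \<le> \<epsilon> * x"
    have x1: "x \<ge> 1" and xS: "4 * S / l \<le> x" using x by (auto simp: x0_def)
    have l0: "l > 0" using a by (simp add: l_def)
    have S4: "S \<le> l * x / 4" using xS l0 by (simp add: field_simps)
    define w where "w = z / complex_of_real x"
    have zw: "z = of_real x * w" using x1 by (simp add: w_def)
    have "z - of_real x = of_real x * (w - 1)" by (simp add: zw algebra_simps)
    then have "norm (z - of_real x) = x * norm (w - 1)"
      using x1 by (simp only: norm_mult norm_of_real)
    then have "norm (w - 1) \<le> \<epsilon>" using z x1 by (simp add: mult.commute)
    then have w1: "norm (w - 1) < \<delta>" "norm (w - 1) \<le> 1" using \<delta> by (auto simp: \<epsilon>_def min_def split: if_splits)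
    have "norm w \<le> norm (w - 1) + norm (1::complex)" by (metis diff_add_cancel norm_triangle_ineq)
    then have w2: "norm w \<le> 2" using w1 by simp
    have P: "poly (map_poly complex_of_real p) z = (\<Sum>i\<le>n. of_real (coeff p i) * z ^ i)"
      by (simp add: poly_altdef n_def coeff_map_poly degree_map_poly)
    have split: "(\<Sum>i\<le>n. of_real (coeff p i) * z ^ i) =
        (\<Sum>i<n. of_real (coeff p i) * z ^ i) + of_real l * z ^ n"
      by (simp add: lessThan_Suc_atMost[symmetric] l_def n_def)
    have "norm (\<Sum>i<n. of_real (coeff p i) * z ^ i) \<le> (\<Sum>i<n. (\<bar>coeff p i\<bar> * 2 ^ i) * x ^ (n - 1))"
    proof (rule sum_norm_le)
      fix i assume "i \<in> {..<n}"
      then have "x ^ i \<le> x ^ (n - 1)" using x1 by (intro power_increasing) auto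
      moreover have "norm w ^ i \<le> 2 ^ i" using w2 by (intro power_mono) auto
      ultimately have "norm w ^ i * x ^ i \<le> 2 ^ i * x ^ (n - 1)" using x1 by (intro mult_mono) auto
      then have "\<bar>coeff p i\<bar> * (norm w ^ i * x ^ i) \<le> \<bar>coeff p i\<bar> * (2 ^ i * x ^ (n - 1))"
        by (intro mult_left_mono) auto
      then show "norm (of_real (coeff p i) * z ^ i) \<le> (\<bar>coeff p i\<bar> * 2 ^ i) * x ^ (n - 1)"
        using x1 by (simp add: zw norm_mult norm_power power_mult_distrib mult_ac)
    qed
    also have "\<dots> = S * x ^ (n - 1)" by (simp add: S_def sum_distrib_right)
    also have "\<dots> \<le> (l * x / 4) * x ^ (n - 1)" using S4 x1 by (intro mult_right_mono) auto
    also have "\<dots> = l * x ^ n / 4" using d by (cases n) (auto simp: n_def)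
    finally have low: "norm (\<Sum>i<n. of_real (coeff p i) * z ^ i) \<le> l * x ^ n / 4" .
    have "of_real l * z ^ n - of_real (l * x ^ n) = of_real (l * x ^ n) * (w ^ n - 1)"
      by (simp add: zw power_mult_distrib algebra_simps)
    then have "norm (of_real l * z ^ n - of_real (l * x ^ n)) = l * x ^ n * norm (w ^ n - 1)"
      using l0 x1 by (simp add: norm_mult norm_power)
    also have "\<dots> \<le> l * x ^ n * (1 / 4)"
      using \<delta>(2)[OF w1(1)] l0 x1 by (intro mult_left_mono) auto
    finally have top: "norm (of_real l * z ^ n - of_real (l * x ^ n)) \<le> l * x ^ n / 4" by simp
    have "norm (poly (map_poly complex_of_real p) z - of_real (l * x ^ n)) \<le>
        norm (\<Sum>i<n. of_real (coeff p i) * z ^ i) + norm (of_real l * z ^ n - of_real (l * x ^ n))"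
      unfolding P split add_diff_eq[symmetric] by (rule norm_triangle_ineq)
    then show "norm (poly (map_poly complex_of_real p) z - of_real (lead_coeff p * x ^ degree p))
         \<le> lead_coeff p * x ^ degree p / 2"
      using low top by (simp add: l_def n_def)
  qed
qed

text \<open>The disc keeps the argument of v away from a right angle, and since
  \<open>g \<le> 1\<close> the power w has no larger argument: \<open>Re w \<ge> norm w / 3\<close>.
  The exponential therefore decays in \<open>\<tau>\<close>. The bound is given the shape
  \<open>\<tau> / (1 + \<tau>)^2\<close>, small at 0 and at infinity, so that it can be summed over
  all scales.\<close>

lemma exp_Ln_sector_bound:
  fixes v :: complex
  assumes v: "norm (v - of_real A) \<le> A / 2" and A: "A > 0" and g: "0 < g" "g \<le> 1" and t: "t > 0"
  defines "w \<equiv> exp (of_real g * Ln v)" and "\<tau> \<equiv> t * A powr g"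
  shows "norm (of_real t * w * exp (- (of_real t * w))) \<le> 288 * \<tau> / (1 + \<tau>)\<^sup>2"
proof -
  have re: "Re v \<ge> A / 2"
    using v abs_Re_le_cmod[of "v - of_real A"] by simp
  have "norm v \<le> norm (v - of_real A) + norm (complex_of_real A)"
    by (metis diff_add_cancel norm_triangle_ineq)
  then have up: "norm v \<le> 3 / 2 * A" using v A by simp
  have lo: "norm v \<ge> A / 2" using re complex_Re_le_cmod[of v] by linarith
  have v0: "v \<noteq> 0" using lo A by auto
  define \<theta> where "\<theta> = Im (Ln v)"
  have \<theta>: "\<bar>\<theta>\<bar> < pi / 2"
    using Re_Ln_pos_lt[OF v0] re A by (simp add: \<theta>_def)
  define \<rho> where "\<rho> = norm v powr g"
  have nw: "norm w = \<rho>" and Rew: "Re w = \<rho> * cos (g * \<theta>)"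
    using v0 by (simp_all add: w_def \<rho>_def norm_exp_eq_Re Re_exp \<theta>_def powr_def)
  have "Re v = norm v * cos \<theta>"
    using Re_exp[of "Ln v"] v0 by (simp add: \<theta>_def norm_exp_eq_Re[symmetric])
  \<comment> \<open>Comparing \<open>Re v \<ge> A / 2\<close> with
    \<open>norm v \<le> 3 / 2 * A\<close> gives the cosine bound 1 / 3.\<close>
  then have "3 / 2 * A * cos \<theta> \<ge> A / 2"
  proof -
    assume *: "Re v = norm v * cos \<theta>"
    have "cos \<theta> \<ge> 0" using \<theta> by (intro cos_ge_zero) auto
    then have "norm v * cos \<theta> \<le> 3 / 2 * A * cos \<theta>" using up by (intro mult_right_mono) auto
    then show ?thesis using * re by linarith
  qed
  then have cos3: "cos \<theta> \<ge> 1 / 3" using A by (simp add: field_simps)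
  have "cos (g * \<theta>) = cos \<bar>g * \<theta>\<bar>" by simp
  also have "\<dots> \<ge> cos \<bar>\<theta>\<bar>"
    using \<theta> g by (intro cos_monotone_0_pi_le) (auto simp: abs_mult mult_left_le_one_le)
  finally have "cos (g * \<theta>) \<ge> 1 / 3" using cos3 by simp
  moreover have \<rho>0: "\<rho> \<ge> 0" by (simp add: \<rho>_def)
  ultimately have Rew': "Re w \<ge> \<rho> / 3"
    unfolding Rew using mult_left_mono[of "1 / 3" "cos (g * \<theta>)" \<rho>] by simp
  have Ag: "A powr g > 0" using A by simp
  have "\<rho> \<le> (3 / 2 * A) powr g" unfolding \<rho>_def using up g by (intro powr_mono2) auto
  also have "\<dots> = (3 / 2) powr g * A powr g" using A by (subst powr_mult) auto
  also have "\<dots> \<le> 2 * A powr g"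
  proof (intro mult_right_mono)
    have "(3 / 2 :: real) powr g \<le> (3 / 2) powr 1" using g by (intro powr_mono) auto
    then show "(3 / 2 :: real) powr g \<le> 2" by simp
  qed (use Ag in simp)
  finally have \<rho>up: "\<rho> \<le> 2 * A powr g" .
  have "1 / 2 * A powr g \<le> (1 / 2) powr g * A powr g"
  proof (intro mult_right_mono)
    have "(1 / 2 :: real) powr 1 \<le> (1 / 2) powr g" using g by (intro powr_mono') auto
    then show "(1 / 2 :: real) \<le> (1 / 2) powr g" by simp
  qed (use Ag in simp)
  also have "\<dots> = (A / 2) powr g" using A by (subst powr_mult[symmetric]) auto
  also have "\<dots> \<le> \<rho>" unfolding \<rho>_def using lo A g by (intro powr_mono2) auto
  finally have \<rho>lo: "A powr g / 2 \<le> \<rho>" by simp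
  have \<tau>0: "\<tau> > 0" using t Ag by (simp add: \<tau>_def)
  have "norm (of_real t * w * exp (- (of_real t * w))) = t * \<rho> * exp (- (t * Re w))"
    using t by (simp add: norm_mult nw norm_exp_eq_Re)
  also have "\<dots> \<le> (2 * \<tau>) * exp (- (\<tau> / 6))"
  proof (rule mult_mono)
    have "t * \<rho> \<le> t * (2 * A powr g)" using \<rho>up t by (intro mult_left_mono) auto
    then show "t * \<rho> \<le> 2 * \<tau>" by (simp add: \<tau>_def)
    have "t * (A powr g / 2 / 3) \<le> t * Re w" using Rew' \<rho>lo t by (intro mult_left_mono) auto
    then show "exp (- (t * Re w)) \<le> exp (- (\<tau> / 6))" by (simp add: \<tau>_def)
  qed (use \<tau>0 in auto)
  \<comment> \<open>The rate 1 / 6 is the half from \<open>A powr g / 2 \<le> \<rho>\<close> times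
    the third from the angle. It is split between two factors
    \<open>1 + \<tau> \<le> 12 * exp (\<tau> / 12)\<close>, hence 144 and, with the factor 2 in
    front, 288.\<close>
  also have "exp (- (\<tau> / 6)) \<le> 144 / (1 + \<tau>)\<^sup>2"
  proof -
    have "1 + \<tau> \<le> 12 * exp (\<tau> / 12)" using exp_ge_add_one_self[of "\<tau> / 12"] \<tau>0 by linarith
    then have "(1 + \<tau>)\<^sup>2 \<le> (12 * exp (\<tau> / 12))\<^sup>2" using \<tau>0 by (intro power_mono) auto
    also have "\<dots> = 144 * exp (\<tau> / 6)"
      by (simp add: power_mult_distrib exp_double[symmetric])
    finally have "(1 + \<tau>)\<^sup>2 \<le> 144 * exp (\<tau> / 6)" .
    then show ?thesis using \<tau>0 by (simp add: field_simps exp_minus)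
  qed
  finally show ?thesis using \<tau>0 by (simp add: mult_left_mono)
qed

text \<open>Each term is comparable to a difference of the decreasing function
  \<open>1 / (1 + s x powr b)\<close>, so the sum telescopes.\<close>

lemma sum_log_scale_bound:
  fixes s b :: real
  assumes s: "s > 0" and b: "b > 0"
  defines "\<tau> \<equiv> \<lambda>x. s * x powr b"
  shows "(\<Sum>k=1..<K. \<tau> (real k) / (1 + \<tau> (real k))\<^sup>2 / real k) \<le> 2 * 4 powr b / b"
proof -
  define h where "h x = 1 / (1 + \<tau> x)" for x
  have \<tau>0: "\<tau> x \<ge> 0" for x using s by (simp add: \<tau>_def)
  have step: "\<tau> (real k) / (1 + \<tau> (real k))\<^sup>2 / real k \<le> 2 * 4 powr b / b * (h (real k) - h (real (Suc k)))"
    if "k \<ge> 1" for k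
  proof -
    have dh: "(h has_real_derivative (- (b * (\<tau> x / (1 + \<tau> x)\<^sup>2 / x)))) (at x)" if "x > 0" for x
    proof -
      have nz: "1 + \<tau> x \<noteq> 0" using \<tau>0[of x] by simp
      have "(\<tau> has_real_derivative s * (b * x powr (b - 1))) (at x)"
        unfolding \<tau>_def by (intro DERIV_cmult has_real_derivative_powr that)
      also have "s * (b * x powr (b - 1)) = b * (\<tau> x / x)"
        using that by (simp add: \<tau>_def powr_diff)
      finally have "((\<lambda>x. 1 + \<tau> x) has_real_derivative b * (\<tau> x / x)) (at x)"
        using DERIV_add[OF DERIV_const, of \<tau> _ x UNIV 1] by simp
      from DERIV_inverse'[OF this nz]
      have "(h has_real_derivative - (inverse (1 + \<tau> x) * (b * (\<tau> x / x)) * inverse (1 + \<tau> x))) (at x)"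
        by (simp add: h_def[abs_def] inverse_eq_divide)
      moreover have "- (inverse (1 + \<tau> x) * (b * (\<tau> x / x)) * inverse (1 + \<tau> x)) =
          - (b * (\<tau> x / (1 + \<tau> x)\<^sup>2 / x))"
        by (simp add: divide_inverse power2_eq_square mult_ac)
      ultimately show ?thesis by (simp only:)
    qed
    have "\<exists>\<xi>>real k. \<xi> < real (Suc k) \<and>
      h (real (Suc k)) - h (real k) = (real (Suc k) - real k) * (- (b * (\<tau> \<xi> / (1 + \<tau> \<xi>)\<^sup>2 / \<xi>)))"
    proof (rule MVT2[where f' = "\<lambda>x. - (b * (\<tau> x / (1 + \<tau> x)\<^sup>2 / x))"])
      fix x assume "real k \<le> x"
      then show "(h has_real_derivative - (b * (\<tau> x / (1 + \<tau> x)\<^sup>2 / x))) (at x)"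
        using that by (intro dh) linarith
    qed simp
    then obtain \<xi> where \<xi>: "real k < \<xi>" "\<xi> < real (Suc k)"
      "h (real (Suc k)) - h (real k) = (real (Suc k) - real k) * (- (b * (\<tau> \<xi> / (1 + \<tau> \<xi>)\<^sup>2 / \<xi>)))"
      by blast
    have k0: "real k > 0" using that by simp
    \<comment> \<open>From k to k + 1 the argument at most doubles, so \<open>\<tau>\<close>, the
      square in the denominator and \<open>1 / \<xi>\<close> are comparable to their values at k;
      \<open>2 * 4 powr b\<close> collects the losses.\<close>
    have "\<xi> \<le> 2 * real k" using \<xi> that by simp
    have t1: "\<tau> (real k) \<le> \<tau> \<xi>" unfolding \<tau>_def using \<xi> s b k0 by (intro mult_left_mono powr_mono2) auto
    have "\<xi> powr b \<le> (2 * real k) powr b" using \<open>\<xi> \<le> 2 * real k\<close> \<xi> k0 b by (intro powr_mono2) auto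
    also have "\<dots> = 2 powr b * real k powr b" by (simp add: powr_mult)
    finally have t2: "\<tau> \<xi> \<le> 2 powr b * \<tau> (real k)"
      unfolding \<tau>_def using s by (simp add: mult_left_mono mult.left_commute)
    have b2: "2 powr b \<ge> (1::real)" using b by (intro ge_one_powr_ge_zero) auto
    have "1 + \<tau> \<xi> \<le> 2 powr b * (1 + \<tau> (real k))" using t2 b2 by (simp add: distrib_left)
    then have "(1 + \<tau> \<xi>)\<^sup>2 \<le> (2 powr b * (1 + \<tau> (real k)))\<^sup>2" using \<tau>0[of \<xi>] by (intro power_mono) auto
    also have "\<dots> = 4 powr b * (1 + \<tau> (real k))\<^sup>2"
      using powr_mult[of 2 2 b] by (simp add: power_mult_distrib power2_eq_square)
    finally have t3: "(1 + \<tau> \<xi>)\<^sup>2 \<le> 4 powr b * (1 + \<tau> (real k))\<^sup>2" .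
    have "(1 + \<tau> \<xi>)\<^sup>2 * \<xi> \<le> (4 powr b * (1 + \<tau> (real k))\<^sup>2) * (2 * real k)"
      using t3 \<open>\<xi> \<le> 2 * real k\<close> \<xi> k0 by (intro mult_mono) auto
    then have "\<tau> (real k) / ((4 powr b * (1 + \<tau> (real k))\<^sup>2) * (2 * real k)) \<le> \<tau> \<xi> / ((1 + \<tau> \<xi>)\<^sup>2 * \<xi>)"
      using t1 \<tau>0[of "real k"] \<tau>0[of \<xi>] \<xi> k0 by (intro frac_le mult_pos_pos) auto
    from mult_left_mono[OF this, of b]
    have "(b / (2 * 4 powr b)) * (\<tau> (real k) / (1 + \<tau> (real k))\<^sup>2 / real k) \<le> b * (\<tau> \<xi> / (1 + \<tau> \<xi>)\<^sup>2 / \<xi>)"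
      using b by (simp add: mult_ac)
    also have "\<dots> = h (real k) - h (real (Suc k))" using \<xi>(3) by simp
    finally have le: "(2 * 4 powr b / b) * ((b / (2 * 4 powr b)) * (\<tau> (real k) / (1 + \<tau> (real k))\<^sup>2 / real k)) \<le>
        (2 * 4 powr b / b) * (h (real k) - h (real (Suc k)))"
      using b by (intro mult_left_mono) auto
    have e: "(2 * 4 powr b / b) * ((b / (2 * 4 powr b)) * y) = y" for y
      using b by simp
    show ?thesis using le unfolding e .
  qed
  have "(\<Sum>k=1..<K. \<tau> (real k) / (1 + \<tau> (real k))\<^sup>2 / real k) \<le>
      (\<Sum>k=1..<K. 2 * 4 powr b / b * (h (real k) - h (real (Suc k))))"
    by (intro sum_mono step) auto
  also have "\<dots> = 2 * 4 powr b / b * (\<Sum>k=1..<K. h (real k) - h (real (Suc k)))"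
    by (simp add: sum_distrib_left)
  also have "(\<Sum>k=1..<K. h (real k) - h (real (Suc k))) \<le> 1"
  proof -
    have h1: "h x \<le> 1" "h x \<ge> 0" for x using \<tau>0[of x] by (auto simp: h_def)
    have "(\<Sum>k=1..<K. h (real k) - h (real (Suc k))) = (if K \<le> 1 then 0 else h 1 - h (real K))"
    proof (cases "K \<le> 1")
      case False
      then show ?thesis
        using sum_Suc_diff'[of 1 K "\<lambda>k. - h (real k)"] by simp
    qed simp
    then show ?thesis using h1[of 1] h1[of "real K"] by auto
  qed
  finally show ?thesis using b by (simp add: mult_left_mono divide_right_mono)
qed

text \<open>Let \<open>\<tau>\<close> be t times the power g of the leading term at k. The
  difference of order \<open>N + 1\<close> is bounded by a multiple of
  \<open>k^(-N - 1) \<tau> / (1 + \<tau>)^2\<close>. The weight leaves one factor 1 / k, and the sum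
  resembles the integral of \<open>1 / (1 + \<tau>)^2\<close> over \<open>\<tau>\<close>, in which t
  has disappeared.\<close>

lemma exp_symbol_difference_bound:
  fixes p :: "real poly" and g :: real
  assumes a: "lead_coeff p > 0" and d: "degree p > 0" and g: "0 < g" "g \<le> 1"
    and pos: "\<And>k::nat. poly p (real k) \<ge> 0"
  defines "\<phi> \<equiv> \<lambda>k::nat. poly p (real k) powr g"
  shows "\<exists>C. \<forall>t>0. \<forall>K. (\<Sum>k<K. (real k + 1) ^ N *
     \<bar>(fdiff ^^ Suc N) (\<lambda>k. t * \<phi> k * exp (- (t * \<phi> k))) k\<bar>) \<le> C"
proof -
  obtain \<epsilon> x0 where \<epsilon>: "\<epsilon> > 0" and x0: "x0 \<ge> 1" and near:
    "\<And>x z. x \<ge> x0 \<Longrightarrow> norm (z - complex_of_real x) \<le> \<epsilon> * x \<Longrightarrow>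
       norm (poly (map_poly complex_of_real p) z - of_real (lead_coeff p * x ^ degree p))
         \<le> lead_coeff p * x ^ degree p / 2"
    using poly_near_leading_term[OF a d] by blast
  define l n J where "l = lead_coeff p" and "n = degree p" and "J = Suc N"
  let ?P = "poly (map_poly complex_of_real p)"
  have l0: "l > 0" using a by (simp add: l_def)
  define b where "b = real n * g"
  have b0: "b > 0" using d g by (simp add: b_def n_def)
  \<comment> \<open>From \<open>x0\<close> on the leading-term estimate holds, and beyond
    \<open>2 * J / \<epsilon>\<close> half of the radius \<open>\<epsilon> k\<close> exceeds the J
    unit shifts.\<close>
  define k0 where "k0 = nat \<lceil>max x0 (2 * real J / \<epsilon> + 1)\<rceil>"
  have k0: "real k \<ge> x0" "real k > 2 * real J / \<epsilon>" if "k \<ge> k0" for k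
  proof -
    have "real k \<ge> max x0 (2 * real J / \<epsilon> + 1)" using that unfolding k0_def by linarith
    then show "real k \<ge> x0" "real k > 2 * real J / \<epsilon>" by auto
  qed
  have Pre: "Re (?P z) > 0" if "x \<ge> x0" "norm (z - complex_of_real x) \<le> \<epsilon> * x" for x z
  proof -
    have "l * x ^ n > 0" using l0 x0 that by simp
    moreover have "norm (?P z - of_real (l * x ^ n)) \<le> l * x ^ n / 2"
      using near[OF that] by (simp add: l_def n_def)
    then have "\<bar>Re (?P z) - l * x ^ n\<bar> \<le> l * x ^ n / 2"
      using abs_Re_le_cmod[of "?P z - of_real (l * x ^ n)"] by simp
    ultimately show ?thesis by linarith
  qed
  have pk: "poly p (real k) > 0" and Pk: "?P (of_nat k) = of_real (poly p (real k))" if "k \<ge> k0" for k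
  proof -
    show "?P (of_nat k) = of_real (poly p (real k))"
      using poly_of_real_map_poly[of p "real k"] by simp
    then show "poly p (real k) > 0"
      using Pre[of "real k" "of_nat k"] k0[OF that] \<epsilon> x0 by simp
  qed
  define C1 where "C1 = 288 * (2 * real J / \<epsilon>) ^ J"
  have main: "\<bar>(fdiff ^^ J) (\<lambda>k. t * \<phi> k * exp (- (t * \<phi> k))) k\<bar> \<le>
      C1 / real k ^ J * (\<tau> / (1 + \<tau>)\<^sup>2)"
    if t: "t > 0" and k: "k \<ge> k0" and \<tau>: "\<tau> = t * l powr g * real k powr b" for t k \<tau>
  proof -
    define f where "f z = of_real t * exp (of_real g * Ln (?P z)) *
       exp (- (of_real t * exp (of_real g * Ln (?P z))))" for z
    define x where "x = real k"
    have xx: "x \<ge> x0" "x > 2 * real J / \<epsilon>" "x > 0" using k0[OF k] x0 by (auto simp: x_def)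
    \<comment> \<open>Half of the radius \<open>\<epsilon> x\<close> is reserved for the J shifts,
      the other half for J Cauchy discs of this radius; \<open>C1\<close> collects
      \<open>\<eta>^(-J)\<close> and the constant of the sector bound.\<close>
    define \<eta> where "\<eta> = \<epsilon> * x / (2 * real J)"
    have \<eta>: "\<eta> > 0" using \<epsilon> xx by (simp add: \<eta>_def J_def)
    have "real J < \<epsilon> * x / 2" using xx(2) \<epsilon> by (simp add: field_simps)
    moreover have "real J > 0" by (simp add: J_def)
    then have "real J * \<eta> = \<epsilon> * x / 2" by (simp add: \<eta>_def)
    ultimately have J\<eta>: "real J * (1 + \<eta>) < \<epsilon> * x" by (simp add: distrib_left)
    have \<tau>': "\<tau> = t * (l * x ^ n) powr g"
      using l0 xx unfolding \<tau> x_def[symmetric] b_def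
      by (simp add: powr_mult powr_powr[symmetric] powr_realpow)
    have inball: "norm (z - complex_of_real x) \<le> \<epsilon> * x" if "z \<in> ball (of_nat k) (\<epsilon> * x)" for z
      using that by (simp add: x_def dist_norm norm_minus_commute)
    have "\<bar>(fdiff ^^ J) (\<lambda>k. t * \<phi> k * exp (- (t * \<phi> k))) k\<bar> \<le> (288 * \<tau> / (1 + \<tau>)\<^sup>2) / \<eta> ^ J"
    proof (rule iterated_fdiff_bound[where f = f and R = "\<epsilon> * x"])
      show "\<eta> > 0" "real J * (1 + \<eta>) < \<epsilon> * x" by fact+
      fix i assume "i \<ge> k"
      then have "i \<ge> k0" using k by simp
      then have e: "exp (of_real g * Ln (?P (of_nat i))) = complex_of_real (\<phi> i)"
        using pk[of i] by (simp add: Pk \<phi>_def powr_def Ln_of_real exp_of_real flip: of_real_mult)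
      have "exp (- (of_real t * of_real (\<phi> i))) = complex_of_real (exp (- (t * \<phi> i)))"
        by (metis exp_of_real of_real_minus of_real_mult)
      then show "complex_of_real (t * \<phi> i * exp (- (t * \<phi> i))) = f (of_nat i)"
        unfolding f_def e by simp
    next
      have "?P z \<notin> \<real>\<^sub>\<le>\<^sub>0" if "z \<in> ball (of_nat k) (\<epsilon> * x)" for z :: complex
        using Pre[OF xx(1) inball[OF that]] complex_nonpos_Reals_iff by auto
      then show "f holomorphic_on ball (of_nat k) (\<epsilon> * x)"
        unfolding f_def by (intro holomorphic_intros) auto
      fix z :: complex assume "z \<in> ball (of_nat k) (\<epsilon> * x)"
      then have "norm (?P z - of_real (l * x ^ n)) \<le> l * x ^ n / 2"
        using near[OF xx(1) inball] by (simp add: l_def n_def)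
      then show "norm (f z) \<le> 288 * \<tau> / (1 + \<tau>)\<^sup>2"
        unfolding f_def \<tau>' using l0 xx g t by (intro exp_Ln_sector_bound) auto
    qed
    also have "(288 * \<tau> / (1 + \<tau>)\<^sup>2) / \<eta> ^ J = C1 / real k ^ J * (\<tau> / (1 + \<tau>)\<^sup>2)"
      using \<epsilon> xx by (simp add: \<eta>_def C1_def x_def power_divide power_mult_distrib field_simps)
    finally show ?thesis .
  qed
  \<comment> \<open>The factor \<open>2 ^ N\<close> comes from \<open>k + 1 \<le> 2 * k\<close> in
    the weight.\<close>
  define C2 where "C2 = 2 ^ N * C1"
  have C10: "C1 \<ge> 0" using \<epsilon> by (simp add: C1_def)
  define C where "C = real k0 * ((real k0 + 1) ^ N * 2 ^ J) + C2 * (2 * 4 powr b / b)"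
  show ?thesis
  proof (intro exI[of _ C] allI impI)
    fix t :: real and K :: nat
    assume t: "t > 0"
    define m where "m k = t * \<phi> k * exp (- (t * \<phi> k))" for k
    define T where "T k = (real k + 1) ^ N * \<bar>(fdiff ^^ J) m k\<bar>" for k
    define \<tau> where "\<tau> x = (t * l powr g) * x powr b" for x
    have T0: "T k \<ge> 0" for k by (simp add: T_def)
    \<comment> \<open>\<open>y * exp (- y) \<le> 1\<close> whatever t is, so even without
      cancellation the indices below \<open>k0\<close> contribute a bound independent of t.\<close>
    have m1: "\<bar>m k\<bar> \<le> 1" for k
    proof -
      define y where "y = t * \<phi> k"
      have "y \<ge> 0" using t by (simp add: y_def \<phi>_def)
      moreover have "y \<le> exp y" using exp_ge_add_one_self[of y] by linarith
      ultimately show ?thesis unfolding m_def y_def[symmetric] by (simp add: exp_minus field_simps)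
    qed
    have small: "T k \<le> (real k0 + 1) ^ N * 2 ^ J" if "k < k0" for k
      unfolding T_def using iterated_fdiff_trivial_bound[of m 1 J k] m1 that
      by (intro mult_mono power_mono) auto
    have large: "T k \<le> C2 * (\<tau> (real k) / (1 + \<tau> (real k))\<^sup>2 / real k)" if "k \<ge> k0" for k
    proof -
      have k1: "real k \<ge> 1" using k0(1)[OF that] x0 by simp
      have "T k \<le> (2 * real k) ^ N * (C1 / real k ^ J * (\<tau> (real k) / (1 + \<tau> (real k))\<^sup>2))"
        unfolding T_def m_def using k1
        by (intro mult_mono power_mono main[OF t that]) (auto simp: \<tau>_def)
      also have "\<dots> = C2 * (\<tau> (real k) / (1 + \<tau> (real k))\<^sup>2 / real k)"
        using k1 by (simp add: C2_def J_def power_mult_distrib field_simps)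
      finally show ?thesis .
    qed
    have "(\<Sum>k<K. T k) \<le> (\<Sum>k<k0. T k) + (\<Sum>k=k0..<max k0 K. T k)"
    proof -
      have "(\<Sum>k<K. T k) \<le> (\<Sum>k\<in>{..<k0} \<union> {k0..<max k0 K}. T k)"
        using T0 by (intro sum_mono2) auto
      also have "\<dots> = (\<Sum>k<k0. T k) + (\<Sum>k=k0..<max k0 K. T k)"
        by (intro sum.union_disjoint) auto
      finally show ?thesis .
    qed
    also have "(\<Sum>k<k0. T k) \<le> real k0 * ((real k0 + 1) ^ N * 2 ^ J)"
      using sum_bounded_above[of "{..<k0}" T "(real k0 + 1) ^ N * 2 ^ J"] small by simp
    also have "(\<Sum>k=k0..<max k0 K. T k) \<le> (\<Sum>k=k0..<max k0 K. C2 * (\<tau> (real k) / (1 + \<tau> (real k))\<^sup>2 / real k))"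
      by (intro sum_mono large) auto
    also have "\<dots> \<le> (\<Sum>k=1..<max k0 K. C2 * (\<tau> (real k) / (1 + \<tau> (real k))\<^sup>2 / real k))"
    proof (rule sum_mono2)
      have "real k0 \<ge> 1" using k0(1)[of k0] x0 by simp
      then show "{k0..<max k0 K} \<subseteq> {1..<max k0 K}" by auto
    qed (use C10 t in \<open>auto simp: C2_def \<tau>_def\<close>)
    also have "\<dots> = C2 * (\<Sum>k=1..<max k0 K. \<tau> (real k) / (1 + \<tau> (real k))\<^sup>2 / real k)"
      by (simp add: sum_distrib_left)
    also have "\<dots> \<le> C2 * (2 * 4 powr b / b)"
      unfolding \<tau>_def using t l0 b0 C10
      by (intro mult_left_mono sum_log_scale_bound) (auto simp: C2_def)
    finally show "(\<Sum>k<K. (real k + 1) ^ N * \<bar>(fdiff ^^ Suc N) (\<lambda>k. t * \<phi> k * exp (- (t * \<phi> k))) k\<bar>) \<le> C"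
      by (simp add: T_def C_def m_def[abs_def] J_def)
  qed
qed

section \<open>Polynomial growth and rapid decay\<close>

definition poly_growth :: "(nat \<Rightarrow> real) \<Rightarrow> bool" where
  "poly_growth a \<longleftrightarrow> (\<exists>C M. \<forall>k. \<bar>a k\<bar> \<le> C * (real k + 1) ^ M)"

text \<open>In the applications the constants may depend on t: rapid decay justifies convergence and
  termwise operations, and no bound uniform in t rests on it.\<close>

definition rapid :: "(nat \<Rightarrow> real) \<Rightarrow> bool" where
  "rapid a \<longleftrightarrow> (\<forall>M. \<exists>C. \<forall>k. \<bar>a k\<bar> * (real k + 1) ^ M \<le> C)"

text \<open>The leading-term estimate at the real point k gives at least linear growth of p, so the
  exponent dominates a multiple of \<open>k powr g\<close>, and the exponential beats all
  powers.\<close>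

lemma exp_symbol_rapid:
  fixes p :: "real poly" and g :: real
  assumes a: "lead_coeff p > 0" and d: "degree p > 0" and g: "0 < g" and t: "t > 0"
    and pos: "\<And>k::nat. poly p (real k) \<ge> 0"
  shows "rapid (\<lambda>k. exp (- (poly p (real k) powr g) * t))"
  unfolding rapid_def
proof
  fix M
  obtain \<epsilon> x0 where \<epsilon>: "\<epsilon> > 0" and x0: "x0 \<ge> 1" and near:
    "\<And>x z. x \<ge> x0 \<Longrightarrow> norm (z - complex_of_real x) \<le> \<epsilon> * x \<Longrightarrow>
       norm (poly (map_poly complex_of_real p) z - of_real (lead_coeff p * x ^ degree p))
         \<le> lead_coeff p * x ^ degree p / 2"
    using poly_near_leading_term[OF a d] by blast
  define c where "c = (lead_coeff p / 2) powr g * t"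
  have c: "c > 0" unfolding c_def by (intro mult_pos_pos) (use a t in auto)
  have lower: "poly p (real k) powr g * t \<ge> c * real k powr g" if "real k \<ge> x0" for k
  proof -
    have "norm (poly (map_poly complex_of_real p) (of_nat k) - of_real (lead_coeff p * real k ^ degree p))
        \<le> lead_coeff p * real k ^ degree p / 2"
      using near[of "real k" "of_nat k"] that \<epsilon> x0 by simp
    moreover have "poly (map_poly complex_of_real p) (of_nat k) = of_real (poly p (real k))"
      using poly_of_real_map_poly[of p "real k"] by simp
    ultimately have "\<bar>poly p (real k) - lead_coeff p * real k ^ degree p\<bar> \<le> lead_coeff p * real k ^ degree p / 2"
      by (metis norm_of_real of_real_diff)
    then have "poly p (real k) \<ge> lead_coeff p / 2 * real k ^ degree p"
      unfolding abs_le_iff by linarith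
    moreover have "real k ^ degree p \<ge> real k ^ 1"
      using d that x0 by (intro power_increasing) auto
    then have "lead_coeff p / 2 * real k ^ degree p \<ge> lead_coeff p / 2 * real k"
      using a by (intro mult_left_mono) auto
    ultimately have "poly p (real k) \<ge> lead_coeff p / 2 * real k" by linarith
    then have "poly p (real k) powr g \<ge> (lead_coeff p / 2 * real k) powr g"
      using a g by (intro powr_mono2) auto
    also have "(lead_coeff p / 2 * real k) powr g = (lead_coeff p / 2) powr g * real k powr g"
      using a by (subst powr_mult) auto
    finally show ?thesis using t by (simp add: c_def mult_ac mult_left_mono)
  qed
  have "(\<lambda>k. exp (- c * real k powr g) * (real k + 1) ^ M) \<longlonglongrightarrow> 0"
    using c g by real_asymp
  then have "Bseq (\<lambda>k. exp (- c * real k powr g) * (real k + 1) ^ M)"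
    by (intro convergent_imp_Bseq convergentI)
  then obtain B where B: "\<And>k. exp (- c * real k powr g) * (real k + 1) ^ M \<le> B"
    unfolding Bseq_def by (force simp: abs_le_iff)
  show "\<exists>C. \<forall>k. \<bar>exp (- (poly p (real k) powr g) * t)\<bar> * (real k + 1) ^ M \<le> C"
  proof (intro exI[of _ "max B ((x0 + 1) ^ M)"] allI)
    fix k :: nat
    show "\<bar>exp (- (poly p (real k) powr g) * t)\<bar> * (real k + 1) ^ M \<le> max B ((x0 + 1) ^ M)"
    proof (cases "real k \<ge> x0")
      case True
      have "exp (- (poly p (real k) powr g) * t) * (real k + 1) ^ M \<le> exp (- c * real k powr g) * (real k + 1) ^ M"
        using lower[OF True] by (intro mult_right_mono) auto
      also note B[of k]
      finally show ?thesis by (simp add: le_max_iff_disj)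
    next
      case False
      have "exp (- (poly p (real k) powr g) * t) * (real k + 1) ^ M \<le> 1 * (x0 + 1) ^ M"
        using False t by (intro mult_mono power_mono) auto
      then show ?thesis by simp
    qed
  qed
qed

section \<open>Function spaces on the sphere\<close>

definition valid_space :: "fspace \<Rightarrow> bool" where
  "valid_space X \<longleftrightarrow> X = Cont \<or> (\<exists>q\<ge>1. X = Lq q)"

lemma valid_space_cases:
  assumes "valid_space X"
  obtains (Cont) "X = Cont" | (Lq) q where "q \<ge> 1" "X = Lq q"
  using assms by (auto simp: valid_space_def)

lemma measurable_ident_surface [measurable]: "(\<lambda>x. x) \<in> borel_measurable surface_measure"
  by (rule measurable_surface_continuous) (rule continuous_on_id)

lemma powr_add_le_two:
  fixes a b q :: real
  assumes "a \<ge> 0" "b \<ge> 0" "q \<ge> 0"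
  shows "(a + b) powr q \<le> 2 powr q * (a powr q + b powr q)"
proof -
  have "(a + b) powr q \<le> (2 * max a b) powr q"
    using assms by (intro powr_mono2) auto
  also have "\<dots> = 2 powr q * max a b powr q" using assms by (subst powr_mult) auto
  also have "max a b powr q \<le> a powr q + b powr q"
    by (auto simp: max_def)
  finally show ?thesis by (simp add: mult_left_mono)
qed

lemma Lq_add_integrable:
  fixes f g :: "'a \<Rightarrow> complex"
  assumes f: "f \<in> borel_measurable M" "integrable M (\<lambda>x. norm (f x) powr q)"
    and g: "g \<in> borel_measurable M" "integrable M (\<lambda>x. norm (g x) powr q)" and q: "q \<ge> 0"
  shows "integrable M (\<lambda>x. norm (f x + g x) powr q)"
    and "(LINT x|M. norm (f x + g x) powr q) \<le>
      2 powr q * ((LINT x|M. norm (f x) powr q) + (LINT x|M. norm (g x) powr q))"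
proof -
  have le: "norm (f x + g x) powr q \<le> 2 powr q * (norm (f x) powr q + norm (g x) powr q)" for x
  proof -
    have "norm (f x + g x) powr q \<le> (norm (f x) + norm (g x)) powr q"
      using q norm_triangle_ineq by (intro powr_mono2) auto
    also have "\<dots> \<le> 2 powr q * (norm (f x) powr q + norm (g x) powr q)"
      using q by (intro powr_add_le_two) auto
    finally show ?thesis .
  qed
  have int: "integrable M (\<lambda>x. 2 powr q * (norm (f x) powr q + norm (g x) powr q))"
    using f g by simp
  show 1: "integrable M (\<lambda>x. norm (f x + g x) powr q)"
    by (rule Bochner_Integration.integrable_bound[OF int])
       (use f g le in \<open>auto intro!: AE_I2\<close>)
  have "(LINT x|M. norm (f x + g x) powr q) \<le> (LINT x|M. 2 powr q * (norm (f x) powr q + norm (g x) powr q))"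
    by (intro integral_mono 1 int le)
  also have "\<dots> = 2 powr q * ((LINT x|M. norm (f x) powr q) + (LINT x|M. norm (g x) powr q))"
    using f g by simp
  finally show "(LINT x|M. norm (f x + g x) powr q) \<le>
      2 powr q * ((LINT x|M. norm (f x) powr q) + (LINT x|M. norm (g x) powr q))" .
qed

lemma exists_unit: "\<exists>x :: 'a::euclidean_space. norm x = 1"
  using SOME_Basis norm_Basis by blast

lemma sphere_nonempty: "sphere (0::'a::euclidean_space) 1 \<noteq> {}"
  using exists_unit[where 'a='a] by auto

lemma bdd_above_sphere:
  fixes f :: "'a::euclidean_space \<Rightarrow> complex"
  assumes "continuous_on (sphere 0 1) f"
  shows "bdd_above ((\<lambda>x. norm (f x)) ` sphere 0 1)"
proof -
  have "continuous_on (sphere 0 1) (\<lambda>x. norm (f x))" using assms by (intro continuous_intros)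
  then show ?thesis
    by (intro bounded_imp_bdd_above compact_imp_bounded compact_continuous_image compact_sphere)
qed

lemma Cont_norm_upper:
  fixes f :: "'a::euclidean_space \<Rightarrow> complex"
  assumes "continuous_on (sphere 0 1) f" "norm x = 1"
  shows "norm (f x) \<le> fs_norm Cont f"
  using assms bdd_above_sphere[OF assms(1)] by (auto intro!: cSUP_upper)

lemma Cont_norm_least:
  fixes f :: "'a::euclidean_space \<Rightarrow> complex"
  assumes "\<And>x. norm x = 1 \<Longrightarrow> norm (f x) \<le> B"
  shows "fs_norm Cont f \<le> B"
  using assms sphere_nonempty by (auto intro!: cSUP_least)

lemma carrier_continuous:
  fixes f :: "'a::euclidean_space \<Rightarrow> complex"
  assumes X: "valid_space X" and f: "continuous_on (sphere 0 1) f"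
  shows "f \<in> fs_carrier X"
  using X
proof (cases rule: valid_space_cases)
  case (Lq q)
  have "continuous_on (sphere 0 1) (\<lambda>x. norm (f x) powr q)"
    using Lq f by (intro continuous_on_powr' continuous_intros) auto
  then show ?thesis
    using Lq f by (auto intro: measurable_surface_continuous integrable_surface_continuous)
qed (use f in simp)

lemma carrier_measurable:
  fixes f :: "'a::euclidean_space \<Rightarrow> complex"
  shows "f \<in> fs_carrier X \<Longrightarrow> f \<in> borel_measurable surface_measure"
  by (cases X) (auto intro: measurable_surface_continuous)

lemma carrier_integrable:
  fixes f :: "'a::euclidean_space \<Rightarrow> complex"
  assumes X: "valid_space X" and f: "f \<in> fs_carrier X"
  shows "integrable surface_measure f"
  using X
proof (cases rule: valid_space_cases)
  case Cont
  then show ?thesis using f by (auto intro: integrable_surface_continuous)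
next
  case (Lq q)
  have le: "norm (f x) \<le> 1 + norm (f x) powr q" for x
  proof (cases "norm (f x) \<le> 1")
    case False
    then have "norm (f x) powr 1 \<le> norm (f x) powr q" using Lq by (intro powr_mono) auto
    then show ?thesis using False by simp
  qed (use powr_ge_zero[of "norm (f x)" q] in linarith)
  have "integrable surface_measure (\<lambda>x. 1 + norm (f x) powr q)"
    using Lq f by simp
  then show ?thesis
    by (rule Bochner_Integration.integrable_bound)
       (use Lq f le powr_ge_zero in \<open>auto intro!: AE_I2 simp: abs_of_nonneg add_nonneg_nonneg\<close>)
qed

lemma carrier_add:
  fixes f g :: "'a::euclidean_space \<Rightarrow> complex"
  assumes X: "valid_space X" and f: "f \<in> fs_carrier X" "g \<in> fs_carrier X"
  shows "(\<lambda>x. f x + g x) \<in> fs_carrier X"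
  using X
  by (cases rule: valid_space_cases) (use f Lq_add_integrable(1)[of f _ _ g] in \<open>auto intro: continuous_intros\<close>)

lemma carrier_mult:
  fixes f :: "'a::euclidean_space \<Rightarrow> complex"
  assumes f: "f \<in> fs_carrier X"
  shows "(\<lambda>x. c * f x) \<in> fs_carrier X"
  using f by (cases X) (auto intro: continuous_intros simp: norm_mult powr_mult)

lemma carrier_diff:
  fixes f g :: "'a::euclidean_space \<Rightarrow> complex"
  assumes X: "valid_space X" and f: "f \<in> fs_carrier X" "g \<in> fs_carrier X"
  shows "(\<lambda>x. f x - g x) \<in> fs_carrier X"
  using carrier_add[OF X f(1) carrier_mult[OF f(2), of "-1"]] by simp

lemma carrier_scaleR:
  fixes f :: "'a::euclidean_space \<Rightarrow> complex"
  shows "f \<in> fs_carrier X \<Longrightarrow> (\<lambda>x. c *\<^sub>R f x) \<in> fs_carrier X"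
  using carrier_mult[of f X "of_real c"] by (simp add: scaleR_conv_of_real)

lemma carrier_zero:
  assumes X: "valid_space X"
  shows "(\<lambda>x. 0 :: complex) \<in> fs_carrier X"
  by (intro carrier_continuous X) (rule continuous_on_const)

lemma fs_norm_nonneg:
  fixes f :: "'a::euclidean_space \<Rightarrow> complex"
  assumes "f \<in> fs_carrier X"
  shows "fs_norm X f \<ge> 0"
proof (cases X)
  case Cont
  obtain x :: 'a where "norm x = 1" using exists_unit by blast
  then show ?thesis
    using Cont_norm_upper[of f x] assms Cont order.trans[OF norm_ge_zero[of "f x"]]
    by (auto simp del: fs_norm.simps)
qed simp

lemma fs_norm_cong_abs:
  fixes f g :: "'a::euclidean_space \<Rightarrow> complex"
  assumes "\<And>x. norm (f x) = norm (g x)"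
  shows "fs_norm X f = fs_norm X g"
  using assms by (cases X) simp_all

lemma fs_norm_minus_commute:
  fixes f g :: "'a::euclidean_space \<Rightarrow> complex"
  shows "fs_norm X (\<lambda>x. f x - g x) = fs_norm X (\<lambda>x. g x - f x)"
  by (rule fs_norm_cong_abs) (rule norm_minus_commute)

lemma fs_norm_zero:
  assumes "valid_space X"
  shows "fs_norm X (\<lambda>x::'a::euclidean_space. 0) = 0"
  using assms
  by (cases rule: valid_space_cases) (simp_all add: sphere_nonempty)

text \<open>The factor 4 is 2, the q-th root of \<open>2 powr q\<close>, times
  \<open>2 \<ge> 2 powr (1 / q)\<close>. Sums of functions occur in limits and approximations, where
  a fixed constant is harmless; contractivity comes from Jensen's inequality, without splitting the
  function.\<close>

lemma fs_norm_add:
  fixes f g :: "'a::euclidean_space \<Rightarrow> complex"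
  assumes X: "valid_space X" and f: "f \<in> fs_carrier X" and g: "g \<in> fs_carrier X"
  shows "fs_norm X (\<lambda>x. f x + g x) \<le> 4 * (fs_norm X f + fs_norm X g)"
  using X
proof (cases rule: valid_space_cases)
  case Cont
  have "fs_norm Cont (\<lambda>x. f x + g x) \<le> fs_norm Cont f + fs_norm Cont g"
  proof (rule Cont_norm_least)
    fix x :: 'a assume "norm x = 1"
    then show "norm (f x + g x) \<le> fs_norm Cont f + fs_norm Cont g"
      using Cont_norm_upper[of f x] Cont_norm_upper[of g x] f g Cont norm_triangle_ineq[of "f x" "g x"]
      by (auto simp del: fs_norm.simps)
  qed
  then show ?thesis
    using Cont fs_norm_nonneg[OF f] fs_norm_nonneg[OF g] by simp
next
  case (Lq q)
  define I where "I h = (LINT x|surface_measure. norm (h x) powr q)" for h :: "'a \<Rightarrow> complex"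
  have I0: "I h \<ge> 0" for h by (simp add: I_def)
  have "I (\<lambda>x. f x + g x) \<le> 2 powr q * (I f + I g)"
    unfolding I_def using Lq f g by (intro Lq_add_integrable) auto
  then have "I (\<lambda>x. f x + g x) powr (1 / q) \<le> (2 powr q * (I f + I g)) powr (1 / q)"
    using I0 Lq by (intro powr_mono2) auto
  also have "\<dots> = 2 * (I f + I g) powr (1 / q)"
    using I0 Lq by (simp add: powr_mult powr_powr)
  also have "(I f + I g) powr (1 / q) \<le> 2 powr (1 / q) * (I f powr (1 / q) + I g powr (1 / q))"
    using I0 Lq by (intro powr_add_le_two) auto
  also have "\<dots> \<le> 2 powr 1 * (I f powr (1 / q) + I g powr (1 / q))"
    using Lq by (intro mult_right_mono powr_mono) auto
  finally show ?thesis using Lq by (simp add: I_def)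
qed

lemma fs_norm_mult:
  fixes f :: "'a::euclidean_space \<Rightarrow> complex"
  assumes X: "valid_space X" and f: "f \<in> fs_carrier X"
  shows "fs_norm X (\<lambda>x. c * f x) = norm c * fs_norm X f"
  using X
proof (cases rule: valid_space_cases)
  case Cont
  have le: "fs_norm Cont (\<lambda>x. c * h x) \<le> norm c * fs_norm Cont h"
    if "continuous_on (sphere 0 1) h" for c and h :: "'a \<Rightarrow> complex"
    by (rule Cont_norm_least)
       (use that in \<open>auto simp: norm_mult simp del: fs_norm.simps intro!: mult_left_mono Cont_norm_upper\<close>)
  have cf: "continuous_on (sphere 0 1) f" using f Cont by simp
  show ?thesis
  proof (cases "c = 0")
    case True
    then show ?thesis using fs_norm_zero[OF X] by simp
  next
    case False
    have "continuous_on (sphere 0 1) (\<lambda>x. c * f x)" using cf by (intro continuous_intros)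
    \<comment> \<open>The reverse inequality is the same estimate for the function
      \<open>c * f\<close> and the factor \<open>inverse c\<close>.\<close>
    from le[OF this, of "inverse c"] have "fs_norm Cont f \<le> norm (inverse c) * fs_norm Cont (\<lambda>x. c * f x)"
      using False by (simp del: fs_norm.simps add: mult.assoc[symmetric])
    then have "norm c * fs_norm Cont f \<le> fs_norm Cont (\<lambda>x. c * f x)"
      using False by (simp add: norm_divide field_simps del: fs_norm.simps)
    then show ?thesis using le[OF cf, of c] Cont by (simp del: fs_norm.simps)
  qed
next
  case (Lq q)
  then show ?thesis by (simp add: norm_mult powr_mult powr_powr)
qed

section \<open>Equality and limits in the space\<close>

definition fs_same :: "fspace \<Rightarrow> ('a::euclidean_space \<Rightarrow> complex) \<Rightarrow> ('a \<Rightarrow> complex) \<Rightarrow> bool" where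
  "fs_same X f g \<longleftrightarrow> (if X = Cont then \<forall>x\<in>sphere 0 1. f x = g x else AE x in surface_measure. f x = g x)"

lemma fs_same_AE: "fs_same X f g \<Longrightarrow> AE x in surface_measure. f x = g x"
  by (auto simp: fs_same_def intro!: AE_I2 split: if_splits)

lemma fs_same_sym: "fs_same X f g \<Longrightarrow> fs_same X g f"
  by (auto simp: fs_same_def split: if_splits)

lemma fs_same_refl: "fs_same X f f"
  by (simp add: fs_same_def)

text \<open>Stability under arbitrary pointwise operations is the advantage over
  \<open>fs_eq\<close>, which refers to a norm; equality is carried along as \<open>fs_same\<close>
  and converted only in the final statements.\<close>

lemma fs_same_comb:
  "fs_same X f f' \<Longrightarrow> fs_same X g g' \<Longrightarrow> fs_same X (\<lambda>x. F (f x) (g x)) (\<lambda>x. F (f' x) (g' x))"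
  by (auto simp: fs_same_def split: if_splits)

lemma fs_same_trans: "fs_same X f g \<Longrightarrow> fs_same X g h \<Longrightarrow> fs_same X f h"
  by (auto simp: fs_same_def split: if_splits)

lemma fs_norm_same:
  fixes f g :: "'a::euclidean_space \<Rightarrow> complex"
  assumes "fs_same X f g" "f \<in> fs_carrier X" "g \<in> fs_carrier X"
  shows "fs_norm X f = fs_norm X g"
proof (cases X)
  case Cont
  then show ?thesis using assms by (simp add: fs_same_def)
next
  case (Lq q)
  have [measurable]: "f \<in> borel_measurable surface_measure" "g \<in> borel_measurable surface_measure"
    using assms by (auto intro: carrier_measurable)
  have "(LINT x|surface_measure. norm (f x) powr q) = (LINT x|surface_measure. norm (g x) powr q)"
    using fs_same_AE[OF assms(1)] by (intro integral_cong_AE) auto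
  then show ?thesis using Lq by simp
qed

lemma fs_norm_zero_imp_same:
  fixes f :: "'a::euclidean_space \<Rightarrow> complex"
  assumes X: "valid_space X" and f: "f \<in> fs_carrier X" and 0: "fs_norm X f = 0"
  shows "fs_same X f (\<lambda>x. 0)"
  using X
proof (cases rule: valid_space_cases)
  case Cont
  show ?thesis
    using Cont_norm_upper[of f] f 0 Cont by (auto simp: fs_same_def simp del: fs_norm.simps)
next
  case (Lq q)
  have "(LINT x|surface_measure. norm (f x) powr q) = 0"
    using 0 Lq by simp
  then have "AE x in surface_measure. norm (f x) powr q = 0"
    using f Lq by (subst (asm) integral_nonneg_eq_0_iff_AE) auto
  then show ?thesis using Lq by (simp add: fs_same_def)
qed

lemma fs_eq_iff_same:
  fixes f g :: "'a::euclidean_space \<Rightarrow> complex"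
  assumes X: "valid_space X" and f: "f \<in> fs_carrier X" "g \<in> fs_carrier X"
  shows "fs_eq X f g \<longleftrightarrow> fs_same X f g"
proof
  assume "fs_eq X f g"
  then have "fs_same X (\<lambda>x. f x - g x) (\<lambda>x. 0)"
    unfolding fs_eq_def by (intro fs_norm_zero_imp_same X carrier_diff f)
  from fs_same_comb[OF this fs_same_refl[of X g], of "(+)"] show "fs_same X f g" by simp
next
  assume "fs_same X f g"
  from fs_same_comb[OF this fs_same_refl[of X g], of "(-)"]
  have "fs_same X (\<lambda>x. f x - g x) (\<lambda>x. 0)" by simp
  then have "fs_norm X (\<lambda>x. f x - g x) = fs_norm X (\<lambda>x :: 'a. 0 :: complex)"
    by (rule fs_norm_same) (intro carrier_diff carrier_zero X f)+
  then show "fs_eq X f g" by (simp add: fs_eq_def fs_norm_zero[OF X])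
qed

lemma fs_tendsto_unique:
  fixes u :: "'i \<Rightarrow> 'a::euclidean_space \<Rightarrow> complex"
  assumes X: "valid_space X" and F: "F \<noteq> bot" and g: "fs_tendsto X u g F" and h: "fs_tendsto X u h F"
  shows "fs_same X g h"
proof -
  have cg: "g \<in> fs_carrier X" and ch: "h \<in> fs_carrier X" using g h by (auto simp: fs_tendsto_def)
  have "fs_norm X (\<lambda>x. g x - h x) \<le> 0"
  proof (rule tendsto_lowerbound[OF _ _ F])
    have "((\<lambda>i. 4 * (fs_norm X (\<lambda>x. u i x - g x) + fs_norm X (\<lambda>x. u i x - h x))) \<longlongrightarrow> 4 * (0 + 0)) F"
      using g h unfolding fs_tendsto_def by (intro tendsto_intros) auto
    then show "((\<lambda>i. 4 * (fs_norm X (\<lambda>x. u i x - g x) + fs_norm X (\<lambda>x. u i x - h x))) \<longlongrightarrow> 0) F"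
      by simp
    have "\<forall>\<^sub>F i in F. u i \<in> fs_carrier X" using g by (simp add: fs_tendsto_def)
    then show "\<forall>\<^sub>F i in F. fs_norm X (\<lambda>x. g x - h x) \<le>
        4 * (fs_norm X (\<lambda>x. u i x - g x) + fs_norm X (\<lambda>x. u i x - h x))"
    proof eventually_elim
      case (elim i)
      have "fs_norm X (\<lambda>x. (g x - u i x) + (u i x - h x)) \<le>
          4 * (fs_norm X (\<lambda>x. g x - u i x) + fs_norm X (\<lambda>x. u i x - h x))"
        by (intro fs_norm_add X carrier_diff cg ch elim)
      then show ?case by (simp add: fs_norm_minus_commute[of X g])
    qed
  qed
  then have "fs_eq X g h"
    using fs_norm_nonneg[OF carrier_diff[OF X cg ch]] by (simp add: fs_eq_def)
  then show ?thesis using fs_eq_iff_same[OF X cg ch] by simp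
qed

text \<open>Once one limit is exhibited, the choice made by \<open>fs_lim\<close> is harmless: it
  can differ from the exhibited limit only by \<open>fs_same\<close>. In this way abstract limits
  are replaced by explicit convolutions.\<close>

lemma fs_lim_same:
  fixes u :: "'i \<Rightarrow> 'a::euclidean_space \<Rightarrow> complex"
  assumes X: "valid_space X" and F: "F \<noteq> bot" and g: "fs_tendsto X u g F"
  shows "fs_lim X F u \<in> fs_carrier X" and "fs_same X (fs_lim X F u) g"
proof -
  have *: "fs_tendsto X u (fs_lim X F u) F"
    unfolding fs_lim_def using g by (rule someI[where P = "\<lambda>g. fs_tendsto X u g F"])
  then show "fs_lim X F u \<in> fs_carrier X" by (simp add: fs_tendsto_def)
  show "fs_same X (fs_lim X F u) g" by (rule fs_tendsto_unique[OF X F * g])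
qed

text \<open>One constant for all spaces: the q-th root of the area is at most
  \<open>1 + area\<close> whatever \<open>q \<ge> 1\<close> is, and 1 covers the maximum norm.
  Uniform estimates thereby become estimates in X.\<close>

lemma fs_norm_le_sup:
  fixes f :: "'a::euclidean_space \<Rightarrow> complex"
  assumes X: "valid_space X" and f: "continuous_on (sphere 0 1) f"
    and B: "\<And>x. norm x = 1 \<Longrightarrow> norm (f x) \<le> B"
  shows "fs_norm X f \<le> (1 + sphere_area TYPE('a)) * B"
proof -
  obtain x :: 'a where "norm x = 1" using exists_unit by blast
  then have B0: "B \<ge> 0" using B[of x] norm_ge_zero[of "f x"] by linarith
  have a0: "sphere_area TYPE('a) > 0" by (rule sphere_area_pos)
  show ?thesis using X
  proof (cases rule: valid_space_cases)
    case Cont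
    have "fs_norm X f \<le> 1 * B" unfolding Cont using Cont_norm_least[of f B] B by simp
    also have "\<dots> \<le> (1 + sphere_area TYPE('a)) * B" using a0 B0 by (intro mult_right_mono) auto
    finally show ?thesis .
  next
    case (Lq q)
    have "f \<in> fs_carrier (Lq q)" using carrier_continuous[OF X f] Lq by simp
    then have "(LINT x|surface_measure. norm (f x) powr q) \<le> (LINT x|(surface_measure :: 'a measure). B powr q)"
      using B Lq by (intro integral_mono) (auto intro!: powr_mono2)
    also have "\<dots> = sphere_area TYPE('a) * B powr q"
      by (simp add: sphere_area_def)
    finally have "(LINT x|surface_measure. norm (f x) powr q) powr (1 / q) \<le>
        (sphere_area TYPE('a) * B powr q) powr (1 / q)"
      using Lq by (intro powr_mono2) auto
    also have "\<dots> = sphere_area TYPE('a) powr (1 / q) * B"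
      using Lq B0 a0 by (simp add: powr_mult powr_powr)
    also have "\<dots> \<le> (1 + sphere_area TYPE('a)) * B"
    proof (intro mult_right_mono B0)
      have "sphere_area TYPE('a) powr (1 / q) \<le> (1 + sphere_area TYPE('a)) powr (1 / q)"
        using Lq a0 by (intro powr_mono2) auto
      also have "\<dots> \<le> (1 + sphere_area TYPE('a)) powr 1"
        using Lq a0 by (intro powr_mono) auto
      finally show "sphere_area TYPE('a) powr (1 / q) \<le> 1 + sphere_area TYPE('a)"
        using a0 by simp
    qed
    finally show ?thesis using Lq by simp
  qed
qed

text \<open>The kernel is a general bounded one, because the composition of two operators applies
  this to the product \<open>K (x \<bullet> y) * K' (y \<bullet> w)\<close> with x fixed.\<close>

lemma surface_fubini:
  fixes k :: "'a::euclidean_space \<Rightarrow> 'a \<Rightarrow> real" and f :: "'a \<Rightarrow> 'b::{banach, second_countable_topology}"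
  assumes k[measurable]: "(\<lambda>(x, y). k x y) \<in> borel_measurable (surface_measure \<Otimes>\<^sub>M surface_measure)"
    and B: "\<And>x y. norm x = 1 \<Longrightarrow> norm y = 1 \<Longrightarrow> \<bar>k x y\<bar> \<le> B" and f: "integrable surface_measure f"
  shows "integrable surface_measure (\<lambda>x. LINT y|surface_measure. k x y *\<^sub>R f y)"
    and "(LINT x|surface_measure. LINT y|surface_measure. k x y *\<^sub>R f y) =
       (LINT y|surface_measure. (LINT x|surface_measure. k x y) *\<^sub>R f y)"
proof -
  have [measurable]: "f \<in> borel_measurable surface_measure" using f by auto
  interpret P: pair_sigma_finite "surface_measure :: 'a measure" "surface_measure :: 'a measure" ..
  have intk: "integrable surface_measure (\<lambda>y. k x y *\<^sub>R f y)" if x: "norm x = 1" for x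
  proof (rule Bochner_Integration.integrable_bound[of _ "\<lambda>y. B * norm (f y)"])
    show "integrable surface_measure (\<lambda>y. B * norm (f y))" using f by simp
    have [measurable]: "x \<in> space surface_measure" using x by simp
    show "(\<lambda>y. k x y *\<^sub>R f y) \<in> borel_measurable surface_measure" by measurable
    have "\<bar>k x y\<bar> * norm (f y) \<le> \<bar>B * norm (f y)\<bar>" if "norm y = 1" for y
      using mult_right_mono[OF B[OF x that] norm_ge_zero[of "f y"]] by linarith
    then show "AE y in surface_measure. norm (k x y *\<^sub>R f y) \<le> norm (B * norm (f y))"
      by (intro AE_I2) simp
  qed
  have int: "integrable (surface_measure \<Otimes>\<^sub>M surface_measure) (\<lambda>(x, y). k x y *\<^sub>R f y)"
  proof (rule P.Fubini_integrable)
    show "(\<lambda>(x, y). k x y *\<^sub>R f y) \<in> borel_measurable (surface_measure \<Otimes>\<^sub>M surface_measure)"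
      by measurable
    show "AE x in surface_measure. integrable surface_measure (\<lambda>y. case (x, y) of (x, y) \<Rightarrow> k x y *\<^sub>R f y)"
      using intk by (intro AE_I2) simp
    show "integrable surface_measure (\<lambda>x. LINT y|surface_measure. norm (case (x, y) of (x, y) \<Rightarrow> k x y *\<^sub>R f y))"
    proof (rule surface.integrable_const_bound[of _ "LINT y|surface_measure. B * norm (f y)"])
      show "(\<lambda>x. LINT y|surface_measure. norm (case (x, y) of (x, y) \<Rightarrow> k x y *\<^sub>R f y)) \<in> borel_measurable surface_measure"
        by measurable
      have "(LINT y|surface_measure. norm (k x y *\<^sub>R f y)) \<le> (LINT y|surface_measure. B * norm (f y))"
        if x: "norm x = 1" for x
        using B[OF x] f intk[OF x] by (intro integral_mono integrable_norm) (auto intro!: mult_right_mono)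
      then show "AE x in surface_measure. norm (LINT y|surface_measure. norm (case (x, y) of (x, y) \<Rightarrow> k x y *\<^sub>R f y))
          \<le> (LINT y|surface_measure. B * norm (f y))"
        by (intro AE_I2) simp
    qed
  qed
  show "integrable surface_measure (\<lambda>x. LINT y|surface_measure. k x y *\<^sub>R f y)"
    using P.integrable_fst'[OF int] by simp
  have "(LINT x|surface_measure. LINT y|surface_measure. k x y *\<^sub>R f y) =
      (LINT y|surface_measure. LINT x|surface_measure. k x y *\<^sub>R f y)"
    using P.Fubini_integral[OF int] by simp
  also have "\<dots> = (LINT y|surface_measure. (LINT x|surface_measure. k x y) *\<^sub>R f y)"
  proof (intro Bochner_Integration.integral_cong refl)
    fix y :: 'a assume y: "y \<in> space surface_measure"
    have "integrable surface_measure (\<lambda>x. k x y)"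
      using y B[of _ y] by (intro surface.integrable_const_bound[of _ B] AE_I2) auto
    then show "(LINT x|surface_measure. k x y *\<^sub>R f y) = (LINT x|surface_measure. k x y) *\<^sub>R f y"
      by simp
  qed
  finally show "(LINT x|surface_measure. LINT y|surface_measure. k x y *\<^sub>R f y) =
       (LINT y|surface_measure. (LINT x|surface_measure. k x y) *\<^sub>R f y)" .
qed

section \<open>Convolution with zonal kernels\<close>

definition zonal_conv :: "(real \<Rightarrow> real) \<Rightarrow> ('a::euclidean_space \<Rightarrow> complex) \<Rightarrow> 'a \<Rightarrow> complex" where
  "zonal_conv K f x = (LINT y|surface_measure. K (x \<bullet> y) *\<^sub>R f y)"

lemma zonal_kernel_bounded:
  fixes K :: "real \<Rightarrow> real"
  assumes "continuous_on UNIV K"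
  obtains B where "B \<ge> 0" "\<And>x y :: 'a::euclidean_space. norm x = 1 \<Longrightarrow> norm y = 1 \<Longrightarrow> \<bar>K (x \<bullet> y)\<bar> \<le> B"
proof -
  have "bounded (K ` {-1..1})"
    by (intro compact_imp_bounded compact_continuous_image compact_Icc continuous_on_subset[OF assms]) auto
  then obtain B where B: "\<forall>u\<in>{-1..1}. \<bar>K u\<bar> \<le> B" by (auto simp: bounded_iff)
  have "\<bar>K (x \<bullet> y)\<bar> \<le> B" if "norm x = 1" "norm y = 1" for x y :: 'a
    using Cauchy_Schwarz_ineq2[of x y] that by (intro bspec[OF B]) auto
  moreover have "B \<ge> 0" using bspec[OF B, of 0] by simp
  ultimately show thesis using that by blast
qed

lemma zonal_kernel_measurable:
  fixes K :: "real \<Rightarrow> real"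
  assumes "continuous_on UNIV K"
  shows "(\<lambda>(x, y). K (x \<bullet> y)) \<in> borel_measurable
    ((surface_measure :: 'a::euclidean_space measure) \<Otimes>\<^sub>M surface_measure)"
proof -
  have [measurable]: "K \<in> borel_measurable borel"
    by (rule borel_measurable_continuous_onI[OF assms])
  show ?thesis by measurable
qed

lemma zonal_integrable:
  fixes f :: "'a::euclidean_space \<Rightarrow> 'b::{banach, second_countable_topology}"
  assumes K: "continuous_on UNIV K" and f: "integrable surface_measure f" and x: "norm x = 1"
  shows "integrable surface_measure (\<lambda>y. K (x \<bullet> y) *\<^sub>R f y)"
proof -
  obtain B where B: "\<And>x y :: 'a. norm x = 1 \<Longrightarrow> norm y = 1 \<Longrightarrow> \<bar>K (x \<bullet> y)\<bar> \<le> B"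
    using zonal_kernel_bounded[OF K] by metis
  have [measurable]: "K \<in> borel_measurable borel" "f \<in> borel_measurable surface_measure"
    using f by (auto intro: borel_measurable_continuous_onI K)
  show ?thesis
  proof (rule Bochner_Integration.integrable_bound[of _ "\<lambda>y. B * norm (f y)"])
    show "integrable surface_measure (\<lambda>y. B * norm (f y))" using f by simp
    show "(\<lambda>y. K (x \<bullet> y) *\<^sub>R f y) \<in> borel_measurable surface_measure" by measurable
    have "\<bar>K (x \<bullet> y)\<bar> * norm (f y) \<le> \<bar>B * norm (f y)\<bar>" if "norm y = 1" for y
      using mult_right_mono[OF B[OF x that] norm_ge_zero[of "f y"]] by linarith
    then show "AE y in surface_measure. norm (K (x \<bullet> y) *\<^sub>R f y) \<le> norm (B * norm (f y))"
      by (intro AE_I2) simp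
  qed
qed

lemma zonal_kernel_integrable:
  fixes K :: "real \<Rightarrow> real"
  assumes K: "continuous_on UNIV K"
  shows "integrable (surface_measure :: 'a::euclidean_space measure) (\<lambda>y. K (x \<bullet> y))"
  by (intro integrable_surface_continuous continuous_on_compose2[OF K]) (auto intro!: continuous_intros)

text \<open>A continuous kernel turns integrable functions into continuous ones, so one argument
  puts the result into each of the spaces and gives its values at points a meaning.\<close>

lemma zonal_conv_continuous:
  fixes f :: "'a::euclidean_space \<Rightarrow> complex"
  assumes K: "continuous_on UNIV K" and f: "integrable surface_measure f"
  shows "continuous_on (sphere 0 1) (zonal_conv K f)"
proof (rule continuous_on_sequentiallyI)
  fix u :: "nat \<Rightarrow> 'a" and a assume u: "\<forall>n. u n \<in> sphere 0 1" and a: "a \<in> sphere 0 1" and lim: "u \<longlonglongrightarrow> a"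
  obtain B where B: "\<And>x y :: 'a. norm x = 1 \<Longrightarrow> norm y = 1 \<Longrightarrow> \<bar>K (x \<bullet> y)\<bar> \<le> B"
    using zonal_kernel_bounded[OF K] by metis
  have [measurable]: "K \<in> borel_measurable borel" "f \<in> borel_measurable surface_measure"
    using f by (auto intro: borel_measurable_continuous_onI K)
  show "(\<lambda>n. zonal_conv K f (u n)) \<longlonglongrightarrow> zonal_conv K f a"
    unfolding zonal_conv_def
  proof (rule integral_dominated_convergence[where w = "\<lambda>y. B * norm (f y)"])
    show "integrable surface_measure (\<lambda>y. B * norm (f y))" using f by simp
    show "AE y in surface_measure. (\<lambda>n. K (u n \<bullet> y) *\<^sub>R f y) \<longlonglongrightarrow> K (a \<bullet> y) *\<^sub>R f y"
    proof (rule AE_I2)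
      fix y
      have "isCont K (a \<bullet> y)" using K by (simp add: continuous_on_eq_continuous_at)
      moreover have "(\<lambda>n. u n \<bullet> y) \<longlonglongrightarrow> a \<bullet> y" using lim by (intro tendsto_intros)
      ultimately have "(\<lambda>n. K (u n \<bullet> y)) \<longlonglongrightarrow> K (a \<bullet> y)"
        by (rule isCont_tendsto_compose)
      then show "(\<lambda>n. K (u n \<bullet> y) *\<^sub>R f y) \<longlonglongrightarrow> K (a \<bullet> y) *\<^sub>R f y"
        by (intro tendsto_scaleR tendsto_const)
    qed
    show "AE y in surface_measure. norm (K (u n \<bullet> y) *\<^sub>R f y) \<le> B * norm (f y)" for n
      using u B[of "u n"] by (intro AE_I2) (auto intro!: mult_right_mono)
  qed measurable
qed

lemma zonal_conv_carrier:
  fixes f :: "'a::euclidean_space \<Rightarrow> complex"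
  assumes X: "valid_space X" and K: "continuous_on UNIV K" and f: "f \<in> fs_carrier X"
  shows "zonal_conv K f \<in> fs_carrier X"
  by (intro carrier_continuous X zonal_conv_continuous K carrier_integrable[OF X f])

text \<open>The integral ignores null sets: equality of the arguments almost everywhere becomes
  equality of the values at every point.\<close>

lemma zonal_conv_same:
  fixes f g :: "'a::euclidean_space \<Rightarrow> complex"
  assumes K: "continuous_on UNIV K" and "f \<in> fs_carrier X" "g \<in> fs_carrier X" "fs_same X f g"
  shows "zonal_conv K f x = zonal_conv K g x"
proof -
  have [measurable]: "K \<in> borel_measurable borel" "f \<in> borel_measurable surface_measure"
    "g \<in> borel_measurable surface_measure"
    using assms by (auto intro: borel_measurable_continuous_onI carrier_measurable)
  show ?thesis unfolding zonal_conv_def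
    using fs_same_AE[OF assms(4)] by (intro integral_cong_AE) auto
qed

text \<open>By scaling, c = 1. For \<open>r = v / c > 0\<close> the bound
  \<open>1 + x \<le> exp x\<close> at \<open>x = (q - 1) ln r\<close>, together with
  \<open>ln r \<ge> 1 - 1 / r\<close>, bounds \<open>r powr (q - 1)\<close> from below; multiplying
  by r gives the tangent at 1.\<close>

lemma powr_tangent:
  fixes v c q :: real
  assumes "v \<ge> 0" "c > 0" "q \<ge> 1"
  shows "v powr q \<ge> c powr q + q * c powr (q - 1) * (v - c)"
proof -
  have "(v / c) powr q \<ge> 1 + q * (v / c - 1)"
  proof (cases "v = 0")
    case True
    then show ?thesis using assms by simp
  next
    case False
    define r where "r = v / c"
    have r: "r > 0" using False assms by (simp add: r_def)
    have "ln r \<ge> 1 - 1 / r" using ln_le_minus_one[of "1 / r"] r by (simp add: ln_div)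
    then have "(q - 1) * ln r \<ge> (q - 1) * (1 - 1 / r)" using assms by (intro mult_left_mono) auto
    moreover have "r powr (q - 1) \<ge> 1 + (q - 1) * ln r"
      using exp_ge_add_one_self[of "(q - 1) * ln r"] r by (simp add: powr_def)
    ultimately have "r powr (q - 1) \<ge> 1 + (q - 1) * (1 - 1 / r)" by linarith
    then have "r * r powr (q - 1) \<ge> r * (1 + (q - 1) * (1 - 1 / r))" using r by (intro mult_left_mono) auto
    moreover have "r * r powr (q - 1) = r powr q" using r by (simp add: powr_diff)
    moreover have "r * (1 + (q - 1) * (1 - 1 / r)) = 1 + q * (r - 1)" using r by (simp add: field_simps)
    ultimately show ?thesis by (simp add: r_def)
  qed
  then have "c powr q * (v / c) powr q \<ge> c powr q * (1 + q * (v / c - 1))"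
    by (intro mult_left_mono) auto
  moreover have "c powr q * (v / c) powr q = v powr q"
    using assms by (simp add: powr_divide)
  moreover have "c powr q = c * c powr (q - 1)" using assms by (simp add: powr_diff)
  then have "c powr q * (1 + q * (v / c - 1)) = c powr q + q * c powr (q - 1) * (v - c)"
    using assms by (simp add: field_simps)
  ultimately show ?thesis by simp
qed

text \<open>Jensen's inequality, from the tangent to \<open>v powr q\<close> at the mean value.\<close>

lemma weighted_power_mean:
  fixes k v :: "'b \<Rightarrow> real"
  assumes k: "integrable M k" "\<And>y. y \<in> space M \<Longrightarrow> k y \<ge> 0" "(LINT y|M. k y) \<le> C"
    and v: "\<And>y. v y \<ge> 0" "integrable M (\<lambda>y. k y * v y)" "integrable M (\<lambda>y. k y * v y powr q)"
    and q: "q \<ge> 1" and C: "C > 0"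
  shows "(LINT y|M. k y * v y) powr q \<le> C powr (q - 1) * (LINT y|M. k y * v y powr q)"
proof (cases "(LINT y|M. k y * v y) = 0")
  case True
  have "(LINT y|M. k y * v y powr q) \<ge> 0" using k by (intro integral_nonneg_AE AE_I2) auto
  then show ?thesis using True q by simp
next
  case False
  define m where "m = (LINT y|M. k y * v y)"
  have m: "m > 0" using False k v unfolding m_def
    by (intro order_neq_le_trans[OF not_sym] integral_nonneg_AE AE_I2) auto
  define c where "c = m / C"
  have c: "c > 0" using m C by (simp add: c_def)
  have int: "integrable M (\<lambda>y. k y * (c powr q * (1 - q)) + q * c powr (q - 1) * (k y * v y))"
    using k v by simp
  have cq: "c powr q = c * c powr (q - 1)" using c by (simp add: powr_diff)
  \<comment> \<open>The mass of k is only known to be at most C; as \<open>1 - q \<le> 0\<close>,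
    putting C in its place can only decrease the expression.\<close>
  have "C * (c powr q * (1 - q)) + q * c powr (q - 1) * m \<le>
      (LINT y|M. k y) * (c powr q * (1 - q)) + q * c powr (q - 1) * m"
    using k(3) q by (intro add_right_mono mult_right_mono_neg) (auto simp: mult_nonneg_nonpos)
  also have "\<dots> = (LINT y|M. k y * (c powr q * (1 - q)) + q * c powr (q - 1) * (k y * v y))"
    using k v by (simp add: m_def)
  also have "\<dots> \<le> (LINT y|M. k y * v y powr q)"
  proof (intro integral_mono int v(3))
    fix y assume y: "y \<in> space M"
    have "k y * (c powr q + q * c powr (q - 1) * (v y - c)) \<le> k y * v y powr q"
      using k y powr_tangent[OF v(1) c q] by (intro mult_left_mono) auto
    then show "k y * (c powr q * (1 - q)) + q * c powr (q - 1) * (k y * v y) \<le> k y * v y powr q"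
      by (simp add: cq algebra_simps)
  qed
  also have "C * (c powr q * (1 - q)) + q * c powr (q - 1) * m = C * c powr q"
  proof -
    have "m = c * C" using C by (simp add: c_def)
    then show ?thesis by (simp add: cq algebra_simps)
  qed
  finally have le: "C * c powr q \<le> (LINT y|M. k y * v y powr q)" .
  have "C * c powr q = m powr q * C / C powr q"
    using C m by (simp add: c_def powr_divide)
  then have "m powr q = C powr (q - 1) * (C * c powr q)"
    using C by (simp add: powr_diff)
  also have "\<dots> \<le> C powr (q - 1) * (LINT y|M. k y * v y powr q)"
    using le by (intro mult_left_mono) auto
  finally show ?thesis by (simp add: m_def)
qed

text \<open>Young's inequality. Jensen's inequality at each x costs \<open>C powr (q - 1)\<close>,
  and integrating over x by Fubini's theorem costs another C, together
  \<open>C powr q\<close>.\<close>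

lemma zonal_conv_norm_pos:
  fixes f :: "'a::euclidean_space \<Rightarrow> complex"
  assumes X: "valid_space X" and K: "continuous_on UNIV K" and f: "f \<in> fs_carrier X"
    and C: "\<And>x :: 'a. norm x = 1 \<Longrightarrow> (LINT y|surface_measure. \<bar>K (x \<bullet> y)\<bar>) \<le> C" and C0: "C > 0"
  shows "fs_norm X (zonal_conv K f) \<le> C * fs_norm X f"
proof -
  have Ka: "continuous_on UNIV (\<lambda>u. \<bar>K u\<bar>)" using K by (intro continuous_intros)
  have fi: "integrable surface_measure f" by (rule carrier_integrable[OF X f])
  have fn: "integrable surface_measure (\<lambda>y. norm (f y))" using fi by simp
  have pt: "norm (zonal_conv K f x) \<le> (LINT y|surface_measure. \<bar>K (x \<bullet> y)\<bar> * norm (f y))" for x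
    unfolding zonal_conv_def
    using integral_norm_bound[of surface_measure "\<lambda>y. K (x \<bullet> y) *\<^sub>R f y"] by simp
  show ?thesis using X
  proof (cases rule: valid_space_cases)
    case Cont
    have cf: "continuous_on (sphere 0 1) f" using f Cont by simp
    have "fs_norm Cont (zonal_conv K f) \<le> C * fs_norm Cont f"
    proof (rule Cont_norm_least)
      fix x :: 'a assume x: "norm x = 1"
      note pt[of x]
      also have "(LINT y|surface_measure. \<bar>K (x \<bullet> y)\<bar> * norm (f y)) \<le>
          (LINT y|surface_measure. \<bar>K (x \<bullet> y)\<bar> * fs_norm Cont f)"
        using zonal_integrable[OF Ka fn x] zonal_kernel_integrable[OF Ka] Cont_norm_upper[OF cf]
        by (intro integral_mono) (auto intro!: mult_left_mono simp del: fs_norm.simps)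
      also have "\<dots> = (LINT y|surface_measure. \<bar>K (x \<bullet> y)\<bar>) * fs_norm Cont f"
        by simp
      also have "\<dots> \<le> C * fs_norm Cont f"
        using C[OF x] f Cont by (intro mult_right_mono fs_norm_nonneg) auto
      finally show "norm (zonal_conv K f x) \<le> C * fs_norm Cont f" .
    qed
    then show ?thesis using Cont by simp
  next
    case (Lq q)
    define w where "w y = norm (f y) powr q" for y
    have wi: "integrable surface_measure w" using f Lq by (simp add: w_def[abs_def])
    obtain B where B: "\<And>x y :: 'a. norm x = 1 \<Longrightarrow> norm y = 1 \<Longrightarrow> \<bar>K (x \<bullet> y)\<bar> \<le> B"
      using zonal_kernel_bounded[OF K] by metis
    have "\<And>x y :: 'a. norm x = 1 \<Longrightarrow> norm y = 1 \<Longrightarrow> \<bar>\<bar>K (x \<bullet> y)\<bar>\<bar> \<le> B" using B by simp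
    note fub = surface_fubini[OF zonal_kernel_measurable[OF Ka] this wi, unfolded real_scaleR_def]
    have pq: "norm (zonal_conv K f x) powr q \<le> C powr (q - 1) * (LINT y|surface_measure. \<bar>K (x \<bullet> y)\<bar> * w y)"
      if x: "norm x = 1" for x
    proof -
      have "norm (zonal_conv K f x) powr q \<le> (LINT y|surface_measure. \<bar>K (x \<bullet> y)\<bar> * norm (f y)) powr q"
        using pt[of x] Lq by (intro powr_mono2) auto
      also have "\<dots> \<le> C powr (q - 1) * (LINT y|surface_measure. \<bar>K (x \<bullet> y)\<bar> * norm (f y) powr q)"
      proof (rule weighted_power_mean[OF zonal_kernel_integrable[OF Ka] _ C[OF x]])
        show "integrable surface_measure (\<lambda>y. \<bar>K (x \<bullet> y)\<bar> * norm (f y))"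
          using zonal_integrable[OF Ka fn x] by simp
        show "integrable surface_measure (\<lambda>y. \<bar>K (x \<bullet> y)\<bar> * norm (f y) powr q)"
          using zonal_integrable[OF Ka wi x] by (simp add: w_def)
      qed (use Lq C0 in simp_all)
      finally show ?thesis by (simp add: w_def)
    qed
    have "zonal_conv K f \<in> fs_carrier (Lq q)" using zonal_conv_carrier[OF X K f] Lq by simp
    have "(LINT x|surface_measure. norm (zonal_conv K f x) powr q) \<le>
        (LINT x|surface_measure. C powr (q - 1) * (LINT y|surface_measure. \<bar>K (x \<bullet> y)\<bar> * w y))"
    proof (intro integral_mono)
      show "integrable surface_measure (\<lambda>x. norm (zonal_conv K f x) powr q)"
        using \<open>zonal_conv K f \<in> fs_carrier (Lq q)\<close> by simp
      show "integrable surface_measure (\<lambda>x. C powr (q - 1) * (LINT y|surface_measure. \<bar>K (x \<bullet> y)\<bar> * w y))"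
        by (intro integrable_mult_right fub(1))
      fix x :: 'a assume "x \<in> space surface_measure"
      then show "norm (zonal_conv K f x) powr q \<le> C powr (q - 1) * (LINT y|surface_measure. \<bar>K (x \<bullet> y)\<bar> * w y)"
        by (intro pq) simp
    qed
    also have "\<dots> = C powr (q - 1) * (LINT y|surface_measure. (LINT x|surface_measure. \<bar>K (x \<bullet> y)\<bar>) * w y)"
      unfolding integral_mult_right_zero by (rule arg_cong[OF fub(2)])
    also have "\<dots> \<le> C powr (q - 1) * (LINT y|surface_measure. C * w y)"
    proof (intro mult_left_mono)
      \<comment> \<open>The kernel depends on \<open>x \<bullet> y\<close> only, so the bound for
        the mass in y is also one for the mass in x.\<close>
      have K': "(LINT x|surface_measure. \<bar>K (x \<bullet> y)\<bar>) \<le> C" if "norm y = 1" for y :: 'a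
        using C[OF that] by (simp add: inner_commute)
      have "integrable surface_measure (\<lambda>y. C * w y)" using wi by simp
      then show "(LINT y|surface_measure. (LINT x|surface_measure. \<bar>K (x \<bullet> y)\<bar>) * w y) \<le> (LINT y|surface_measure. C * w y)"
      proof (rule integral_mono')
        fix y :: 'a assume "y \<in> space surface_measure"
        then show "(LINT x|surface_measure. \<bar>K (x \<bullet> y)\<bar>) * w y \<le> C * w y"
          using K' by (intro mult_right_mono) (auto simp: w_def)
        show "0 \<le> C * w y" using C0 by (simp add: w_def)
      qed
    qed simp
    also have "\<dots> = C powr q * (LINT y|surface_measure. w y)"
      using C0 by (simp add: powr_diff)
    finally have "(LINT x|surface_measure. norm (zonal_conv K f x) powr q) powr (1 / q) \<le>
        (C powr q * (LINT y|surface_measure. w y)) powr (1 / q)"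
      using Lq by (intro powr_mono2) auto
    also have "\<dots> = C * (LINT y|surface_measure. w y) powr (1 / q)"
    proof -
      have "(LINT y|surface_measure. w y) \<ge> 0" by (simp add: w_def)
      then show ?thesis using C0 Lq by (simp add: powr_mult powr_powr)
    qed
    finally show ?thesis using Lq by (simp add: w_def)
  qed
qed

text \<open>Jensen's inequality divides by C. The case C = 0 is reached by applying the positive
  case to \<open>C + d\<close> and letting d shrink.\<close>

lemma zonal_conv_norm:
  fixes f :: "'a::euclidean_space \<Rightarrow> complex"
  assumes X: "valid_space X" and K: "continuous_on UNIV K" and f: "f \<in> fs_carrier X"
    and C: "\<And>x :: 'a. norm x = 1 \<Longrightarrow> (LINT y|surface_measure. \<bar>K (x \<bullet> y)\<bar>) \<le> C"
  shows "fs_norm X (zonal_conv K f) \<le> C * fs_norm X f"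
proof (rule field_le_epsilon)
  fix e :: real assume e: "e > 0"
  obtain x :: 'a where x: "norm x = 1" using exists_unit by blast
  have "(LINT y|surface_measure. \<bar>K (x \<bullet> y)\<bar>) \<ge> 0" by simp
  then have C0: "C \<ge> 0" using C[OF x] by linarith
  have n0: "fs_norm X f \<ge> 0" by (rule fs_norm_nonneg[OF f])
  define d where "d = e / (fs_norm X f + 1)"
  have d: "d > 0" using e n0 by (simp add: d_def)
  have "fs_norm X (zonal_conv K f) \<le> (C + d) * fs_norm X f"
  proof (rule zonal_conv_norm_pos[OF X K f])
    fix x :: 'a assume "norm x = 1"
    then show "(LINT y|surface_measure. \<bar>K (x \<bullet> y)\<bar>) \<le> C + d" using C[of x] d by linarith
  qed (use C0 d in simp)
  moreover have "d * fs_norm X f \<le> d * (fs_norm X f + 1)" using d by (intro mult_left_mono) auto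
  then have "d * fs_norm X f \<le> e" using n0 by (simp add: d_def)
  ultimately show "fs_norm X (zonal_conv K f) \<le> C * fs_norm X f + e"
    by (simp add: distrib_right)
qed

section \<open>Density of the continuous functions\<close>

lemma finite_integral_indicator_compact_approx:
  fixes K :: "'a::euclidean_space set"
  assumes K: "compact K" and e: "e > 0"
  shows "\<exists>g :: 'a \<Rightarrow> real. continuous_on UNIV g \<and> (LINT x|surface_measure. \<bar>indicator K x - g x\<bar>) < e"
proof (cases "K = {}")
  case True
  then show ?thesis using e by (intro exI[of _ "\<lambda>_. 0"]) simp
next
  case False
  \<comment> \<open>Tent functions, 1 on K and 0 from the distance 1 / n on. They converge to the
    indicator because a point outside the closed set K has positive distance from it.\<close>
  define g where "g n x = max 0 (1 - real n * infdist x K)" for n and x :: 'a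
  have gc: "continuous_on UNIV (g n)" for n
    unfolding g_def by (intro continuous_intros)
  have [measurable]: "K \<in> sets borel" using K by (simp add: borel_compact)
  have [measurable]: "g n \<in> borel_measurable borel" for n
    by (intro borel_measurable_continuous_onI gc)
  have "(\<lambda>n. LINT x|(surface_measure :: 'a measure). \<bar>indicator K x - g n x\<bar>) \<longlonglongrightarrow>
      (LINT x|(surface_measure :: 'a measure). 0)"
  proof (rule integral_dominated_convergence[where w = "\<lambda>_. 1"])
    show "AE x in surface_measure. (\<lambda>n. \<bar>indicator K x - g n x\<bar>) \<longlonglongrightarrow> 0"
    proof (rule AE_I2)
      fix x :: 'a
      show "(\<lambda>n. \<bar>indicator K x - g n x\<bar>) \<longlonglongrightarrow> 0"
      proof (cases "x \<in> K")
        case True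
        then show ?thesis by (simp add: g_def)
      next
        case nx: False
        have d: "infdist x K > 0"
          using nx False K by (metis compact_imp_closed in_closed_iff_infdist_zero infdist_nonneg less_eq_real_def)
        obtain N :: nat where N: "1 / infdist x K < real N" using reals_Archimedean2 by blast
        have "\<bar>indicator K x - g n x\<bar> = 0" if "n \<ge> N" for n
        proof -
          have "1 < real N * infdist x K" using N d by (simp add: field_simps)
          also have "\<dots> \<le> real n * infdist x K" using that d by (intro mult_right_mono) auto
          finally show ?thesis using nx by (simp add: g_def)
        qed
        then show ?thesis
          by (intro tendsto_eventually eventually_sequentiallyI[of N]) auto
      qed
    qed
    show "AE x in surface_measure. norm \<bar>indicator K x - g n x\<bar> \<le> 1" for n
    proof (rule AE_I2)
      fix x :: 'a
      have "0 \<le> g n x" "g n x \<le> 1" using infdist_nonneg[of x K] by (auto simp: g_def)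
      then show "norm \<bar>indicator K x - g n x\<bar> \<le> 1" by (auto simp: indicator_def)
    qed
  qed auto
  then have "\<forall>\<^sub>F n in sequentially. (LINT x|(surface_measure :: 'a measure). \<bar>indicator K x - g n x\<bar>) < e"
    using e by (intro order_tendstoD) auto
  then obtain n where "(LINT x|(surface_measure :: 'a measure). \<bar>indicator K x - g n x\<bar>) < e"
    by (auto simp: eventually_sequentially)
  then show ?thesis using gc by blast
qed

lemma surface_indicator_approx:
  fixes A :: "'a::euclidean_space set"
  assumes A: "A \<in> sets surface_measure" and e: "e > 0"
  shows "\<exists>g :: 'a \<Rightarrow> real. continuous_on UNIV g \<and> (LINT x|surface_measure. \<bar>indicator A x - g x\<bar>) < e"
proof -
  \<comment> \<open>Transported to the Borel sets of the whole space, the measure is inner regular: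
    compact subsets exhaust A in measure.\<close>
  define M where "M = distr (surface_measure :: 'a measure) borel (\<lambda>x. x)"
  have Ab: "A \<in> sets borel" "A \<subseteq> sphere 0 1" using A by (auto simp: sets_restrict_space_iff)
  have M: "emeasure M B = emeasure surface_measure (B \<inter> sphere 0 1)" if "B \<in> sets borel" for B
    unfolding M_def using that by (subst emeasure_distr) auto
  have "emeasure M A = (SUP K\<in>{K. K \<subseteq> A \<and> compact K}. emeasure M K)"
    using Ab by (intro inner_regular) (auto simp: M_def emeasure_distr)
  moreover have "emeasure M A \<noteq> \<infinity>" by (simp add: M Ab)
  ultimately have "\<exists>K\<in>{K. K \<subseteq> A \<and> compact K}. emeasure M A < emeasure M K + ennreal (e / 2)"
    using e by (intro SUP_approx_ennreal) auto
  then obtain K where K: "K \<subseteq> A" "compact K" and lt: "emeasure M A < emeasure M K + ennreal (e / 2)"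
    by auto
  have Kb: "K \<in> sets borel" "K \<subseteq> sphere 0 1" using K Ab by (auto simp: borel_compact)
  have Ks: "K \<in> sets surface_measure" using Kb by (auto simp: sets_restrict_space_iff)
  have mA: "emeasure M A = ennreal (measure surface_measure A)" "emeasure M K = ennreal (measure surface_measure K)"
    using Ab Kb by (simp_all add: M surface.emeasure_eq_measure Int_absorb2)
  have "measure surface_measure A < measure surface_measure K + e / 2"
    using lt e unfolding mA by (simp add: ennreal_plus[symmetric] ennreal_less_iff del: ennreal_plus)
  then have AK: "measure surface_measure (A - K) < e / 2"
    using A Ks K by (subst surface.finite_measure_Diff) auto
  obtain g :: "'a \<Rightarrow> real" where g: "continuous_on UNIV g" "(LINT x|surface_measure. \<bar>indicator K x - g x\<bar>) < e / 2"
    using finite_integral_indicator_compact_approx[OF K(2), of "e / 2"] e by auto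
  have gi: "integrable surface_measure g"
    by (intro integrable_surface_continuous continuous_on_subset[OF g(1)]) auto
  have iA: "integrable surface_measure (indicator A :: 'a \<Rightarrow> real)"
    and iK: "integrable surface_measure (indicator K :: 'a \<Rightarrow> real)"
    and iAK: "integrable surface_measure (indicator (A - K) :: 'a \<Rightarrow> real)"
    using A Ks by (simp_all add: integrable_real_indicator surface.emeasure_eq_measure sets.Diff
        del: sets_surface_measure)
  have "(LINT x|surface_measure. \<bar>indicator A x - g x\<bar>) \<le>
      (LINT x|surface_measure. indicator (A - K) x + \<bar>indicator K x - g x\<bar>)"
    using K(1)
    by (intro integral_mono Bochner_Integration.integrable_add integrable_abs Bochner_Integration.integrable_diff
        iA iK iAK gi) (auto simp: indicator_def)
  also have "\<dots> = measure surface_measure (A - K) + (LINT x|surface_measure. \<bar>indicator K x - g x\<bar>)"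
  proof -
    have "(A - K) \<inter> sphere 0 1 = A - K" using Ab by auto
    then show ?thesis using iAK iK gi by (subst Bochner_Integration.integral_add) auto
  qed
  also have "\<dots> < e" using AK g(2) by simp
  finally show ?thesis using g(1) by blast
qed

lemma surface_L1_approx:
  fixes f :: "'a::euclidean_space \<Rightarrow> complex"
  assumes "integrable surface_measure f"
  shows "\<forall>e>0. \<exists>g. continuous_on UNIV g \<and> (LINT x|surface_measure. norm (f x - g x)) < e"
  using assms
proof (induction rule: integrable_induct)
  case (base A c)
  show ?case
  proof (intro allI impI)
    fix e :: real assume e: "e > 0"
    obtain g :: "'a \<Rightarrow> real" where g: "continuous_on UNIV g"
        "(LINT x|surface_measure. \<bar>indicator A x - g x\<bar>) < e / (norm c + 1)"
      using surface_indicator_approx[OF base(1), of "e / (norm c + 1)"] e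
      by (metis divide_pos_pos norm_ge_zero add_nonneg_pos zero_less_one)
    have "norm (indicator A x *\<^sub>R c - g x *\<^sub>R c) = norm c * \<bar>indicator A x - g x\<bar>" for x
      by (simp add: scaleR_diff_left[symmetric] mult.commute)
    then have "(LINT x|surface_measure. norm (indicator A x *\<^sub>R c - g x *\<^sub>R c)) =
        norm c * (LINT x|surface_measure. \<bar>indicator A x - g x\<bar>)" by simp
    also have "\<dots> \<le> norm c * (e / (norm c + 1))" using g(2) by (intro mult_left_mono) auto
    also have "\<dots> = norm c / (norm c + 1) * e" by simp
    also have "\<dots> < 1 * e"
      using e by (intro mult_strict_right_mono) (auto simp: divide_less_eq add_nonneg_pos)
    also have "\<dots> = e" by simp
    finally have "(LINT x|surface_measure. norm (indicator A x *\<^sub>R c - g x *\<^sub>R c)) < e" .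
    moreover have "continuous_on UNIV (\<lambda>x. g x *\<^sub>R c)" using g(1) by (intro continuous_intros)
    ultimately show "\<exists>h. continuous_on UNIV h \<and> (LINT x|surface_measure. norm (indicator A x *\<^sub>R c - h x)) < e"
      by (intro exI[of _ "\<lambda>x. g x *\<^sub>R c"]) simp
  qed
next
  case (add u v)
  show ?case
  proof (intro allI impI)
    fix e :: real assume e: "e > 0"
    obtain g where g: "continuous_on UNIV g" "(LINT x|surface_measure. norm (u x - g x)) < e / 2"
      using add.IH(1) e by (meson half_gt_zero)
    obtain h where h: "continuous_on UNIV h" "(LINT x|surface_measure. norm (v x - h x)) < e / 2"
      using add.IH(2) e by (meson half_gt_zero)
    have gi: "integrable surface_measure g" and hi: "integrable surface_measure h"
      using continuous_on_subset[OF g(1)] continuous_on_subset[OF h(1)]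
      by (auto intro!: integrable_surface_continuous)
    have i1: "integrable surface_measure (\<lambda>x. norm (u x - g x))" "integrable surface_measure (\<lambda>x. norm (v x - h x))"
      using add.hyps gi hi by (auto intro!: integrable_norm Bochner_Integration.integrable_diff)
    have "(LINT x|surface_measure. norm (u x + v x - (g x + h x))) \<le>
        (LINT x|surface_measure. norm (u x - g x) + norm (v x - h x))"
    proof (rule integral_mono)
      show "integrable surface_measure (\<lambda>x. norm (u x + v x - (g x + h x)))"
        using add.hyps gi hi by (intro integrable_norm Bochner_Integration.integrable_diff Bochner_Integration.integrable_add)
      show "integrable surface_measure (\<lambda>x. norm (u x - g x) + norm (v x - h x))"
        using i1 by (rule Bochner_Integration.integrable_add)
      fix x
      show "norm (u x + v x - (g x + h x)) \<le> norm (u x - g x) + norm (v x - h x)"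
        using norm_triangle_ineq[of "u x - g x" "v x - h x"] by (simp add: algebra_simps)
    qed
    also have "\<dots> < e" using g(2) h(2) i1 by simp
    finally have "(LINT x|surface_measure. norm (u x + v x - (g x + h x))) < e" .
    moreover have "continuous_on UNIV (\<lambda>x. g x + h x)" using g(1) h(1) by (intro continuous_intros)
    ultimately show "\<exists>k. continuous_on UNIV k \<and> (LINT x|surface_measure. norm (u x + v x - k x)) < e"
      by (intro exI[of _ "\<lambda>x. g x + h x"]) simp
  qed
next
  case (lim u s)
  show ?case
  proof (intro allI impI)
    fix e :: real assume e: "e > 0"
    have [measurable]: "u \<in> borel_measurable surface_measure" "s n \<in> borel_measurable surface_measure" for n
      using lim.hyps by auto
    have "(\<lambda>n. LINT x|surface_measure. norm (u x - s n x)) \<longlonglongrightarrow> (LINT x|(surface_measure :: 'a measure). 0)"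
    proof (rule integral_dominated_convergence[where w = "\<lambda>x. 3 * norm (u x)"])
      show "integrable surface_measure (\<lambda>x. 3 * norm (u x))" using lim.hyps by simp
      show "AE x in surface_measure. (\<lambda>n. norm (u x - s n x)) \<longlonglongrightarrow> 0"
      proof (rule AE_I2)
        fix x :: 'a assume "x \<in> space surface_measure"
        then have "(\<lambda>n. norm (u x - s n x)) \<longlonglongrightarrow> norm (u x - u x)"
          using lim.hyps(2) by (intro tendsto_intros) auto
        then show "(\<lambda>n. norm (u x - s n x)) \<longlonglongrightarrow> 0" by simp
      qed
      show "AE x in surface_measure. norm (norm (u x - s n x)) \<le> 3 * norm (u x)" for n
      proof (rule AE_I2)
        fix x :: 'a assume "x \<in> space surface_measure"
        then have "norm (s n x) \<le> 2 * norm (u x)" using lim.hyps(3) by blast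
        then show "norm (norm (u x - s n x)) \<le> 3 * norm (u x)"
          using norm_triangle_ineq4[of "u x" "s n x"] by simp
      qed
    qed auto
    then have "\<forall>\<^sub>F n in sequentially. (LINT x|surface_measure. norm (u x - s n x)) < e / 2"
      using e by (intro order_tendstoD) auto
    then obtain n where n: "(LINT x|surface_measure. norm (u x - s n x)) < e / 2"
      by (auto simp: eventually_sequentially)
    obtain g where g: "continuous_on UNIV g" "(LINT x|surface_measure. norm (s n x - g x)) < e / 2"
      using lim.IH e by (meson half_gt_zero)
    have gi: "integrable surface_measure g"
      using continuous_on_subset[OF g(1)] by (auto intro!: integrable_surface_continuous)
    have i1: "integrable surface_measure (\<lambda>x. norm (u x - s n x))" "integrable surface_measure (\<lambda>x. norm (s n x - g x))"
      using lim.hyps gi by (auto intro!: integrable_norm Bochner_Integration.integrable_diff)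
    have "(LINT x|surface_measure. norm (u x - g x)) \<le>
        (LINT x|surface_measure. norm (u x - s n x) + norm (s n x - g x))"
    proof (rule integral_mono)
      show "integrable surface_measure (\<lambda>x. norm (u x - g x))"
        using lim.hyps gi by (intro integrable_norm Bochner_Integration.integrable_diff)
      show "integrable surface_measure (\<lambda>x. norm (u x - s n x) + norm (s n x - g x))"
        using i1 by (rule Bochner_Integration.integrable_add)
      fix x
      show "norm (u x - g x) \<le> norm (u x - s n x) + norm (s n x - g x)"
        using norm_triangle_ineq[of "u x - s n x" "s n x - g x"] by simp
    qed
    also have "\<dots> < e" using g(2) n i1 by simp
    finally show "\<exists>k. continuous_on UNIV k \<and> (LINT x|surface_measure. norm (u x - k x)) < e"
      using g(1) by blast
  qed
qed

text \<open>An approximation g in \<open>L^1\<close> is composed with the nearest-point projection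
  onto the ball of radius B. This fixes the values of f and does not increase distances, so the
  error stays below \<open>2 B\<close> and its q-th power is at most
  \<open>(2 B) powr (q - 1)\<close> times the error of g.\<close>

lemma surface_Lq_approx_bounded:
  fixes f :: "'a::euclidean_space \<Rightarrow> complex"
  assumes f: "f \<in> borel_measurable surface_measure" "\<And>x. norm (f x) \<le> B" and B: "B > 0"
    and q: "q \<ge> 1" and e: "e > 0"
  shows "\<exists>g. continuous_on UNIV g \<and> (LINT x|surface_measure. norm (f x - g x) powr q) < e"
proof -
  have fi: "integrable surface_measure f"
    using f by (intro surface.integrable_const_bound[of _ B] AE_I2) auto
  define C where "C = (2 * B) powr (q - 1)"
  have C: "C > 0" using B by (simp add: C_def)
  have "e / C > 0" using e C by simp
  then obtain g where g: "continuous_on UNIV g" "(LINT x|surface_measure. norm (f x - g x)) < e / C"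
    using surface_L1_approx[OF fi] by blast
  define P where "P = closest_point (cball (0::complex) B)"
  have cb: "convex (cball (0::complex) B)" "closed (cball (0::complex) B)" "cball (0::complex) B \<noteq> {}"
    using B by auto
  define h where "h x = P (g x)" for x
  have hc: "continuous_on UNIV h"
    unfolding h_def P_def
    by (rule continuous_on_compose2[OF continuous_on_closest_point[OF cb] g(1)]) auto
  have hB: "norm (h x) \<le> B" for x
    using closest_point_in_set[OF cb(2,3), of "g x"] by (simp add: h_def P_def)
  have fh: "norm (f x - h x) \<le> norm (f x - g x)" for x
  proof -
    have "P (f x) = f x" using f(2)[of x] by (simp add: P_def closest_point_self)
    then show ?thesis
      using closest_point_lipschitz[OF cb, of "f x" "g x"] by (simp add: h_def P_def dist_norm)
  qed
  have gi: "integrable surface_measure g" and hi: "integrable surface_measure h"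
    using continuous_on_subset[OF g(1)] continuous_on_subset[OF hc] by (auto intro!: integrable_surface_continuous)
  have le: "norm (f x - h x) powr q \<le> C * norm (f x - g x)" for x
  proof -
    have b: "norm (f x - h x) \<le> 2 * B"
      using norm_triangle_ineq4[of "f x" "h x"] f(2)[of x] hB[of x] by linarith
    have "norm (f x - h x) powr q = norm (f x - h x) powr (q - 1) * norm (f x - h x)"
      by (cases "norm (f x - h x) = 0") (simp_all add: powr_diff)
    also have "\<dots> \<le> C * norm (f x - g x)"
      unfolding C_def using q b fh[of x] by (intro mult_mono powr_mono2) auto
    finally show ?thesis .
  qed
  have "(LINT x|surface_measure. norm (f x - h x) powr q) \<le> (LINT x|surface_measure. C * norm (f x - g x))"
  proof (rule integral_mono)
    show i: "integrable surface_measure (\<lambda>x. C * norm (f x - g x))" using fi gi by simp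
    show "integrable surface_measure (\<lambda>x. norm (f x - h x) powr q)"
      by (rule Bochner_Integration.integrable_bound[OF i])
         (use f hi le C in \<open>auto intro!: AE_I2 simp: abs_mult\<close>)
  qed (rule le)
  also have "\<dots> = C * (LINT x|surface_measure. norm (f x - g x))" by simp
  also have "\<dots> < C * (e / C)" using g(2) C by (intro mult_strict_left_mono)
  also have "\<dots> = e" using C by simp
  finally show ?thesis using hc by blast
qed

lemma carrier_continuous_dense:
  fixes f :: "'a::euclidean_space \<Rightarrow> complex"
  assumes X: "valid_space X" and f: "f \<in> fs_carrier X" and e: "e > 0"
  shows "\<exists>g. continuous_on (sphere 0 1) g \<and> fs_norm X (\<lambda>x. f x - g x) < e"
  using X
proof (cases rule: valid_space_cases)
  case Cont
  then show ?thesis using f e fs_norm_zero[OF X, where 'a = 'a] by (intro exI[of _ f]) (simp del: fs_norm.simps)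
next
  case (Lq q)
  have [measurable]: "f \<in> borel_measurable surface_measure"
    and fq: "integrable surface_measure (\<lambda>x. norm (f x) powr q)"
    using f Lq by auto
  \<comment> \<open>Two errors below d, multiplied by the \<open>2 powr q\<close> of
    \<open>Lq_add_integrable\<close>, add up to less than \<open>e powr q\<close>.\<close>
  define d where "d = e powr q / (2 powr q * 2)"
  have d: "d > 0" using e by (simp add: d_def)
  define t where "t n x = (if norm (f x) \<le> real n then f x else 0)" for n :: nat and x
  have [measurable]: "t n \<in> borel_measurable surface_measure" for n
    unfolding t_def by measurable
  have "(\<lambda>n. LINT x|surface_measure. norm (f x - t n x) powr q) \<longlonglongrightarrow> (LINT x|(surface_measure :: 'a measure). 0)"
  proof (rule integral_dominated_convergence[where w = "\<lambda>x. norm (f x) powr q"])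
    show "AE x in surface_measure. (\<lambda>n. norm (f x - t n x) powr q) \<longlonglongrightarrow> 0"
    proof (rule AE_I2)
      fix x :: 'a
      obtain N :: nat where "norm (f x) \<le> real N" using real_arch_simple by blast
      then have "norm (f x - t n x) powr q = 0" if "n \<ge> N" for n
        using that by (simp add: t_def)
      then show "(\<lambda>n. norm (f x - t n x) powr q) \<longlonglongrightarrow> 0"
        by (intro tendsto_eventually eventually_sequentiallyI[of N]) auto
    qed
    show "AE x in surface_measure. norm (norm (f x - t n x) powr q) \<le> norm (f x) powr q" for n
      by (intro AE_I2) (auto simp: t_def)
  qed (use fq in auto)
  then have "\<forall>\<^sub>F n in sequentially. (LINT x|surface_measure. norm (f x - t n x) powr q) < d"
    using d by (intro order_tendstoD) auto
  then obtain n where n: "(LINT x|surface_measure. norm (f x - t n x) powr q) < d"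
    by (auto simp: eventually_sequentially)
  \<comment> \<open>The summand 1 keeps the bound positive for n = 0, as the approximation of
    bounded functions requires.\<close>
  have "norm (t n x) \<le> real n + 1" for x by (simp add: t_def)
  then obtain g where g: "continuous_on UNIV g" "(LINT x|surface_measure. norm (t n x - g x) powr q) < d"
    using surface_Lq_approx_bounded[of "t n" "real n + 1" q d] Lq d by auto
  have gS: "continuous_on (sphere 0 1) g" using g(1) by (rule continuous_on_subset) simp
  have gc: "g \<in> fs_carrier (Lq q)" using carrier_continuous[OF X gS] Lq by simp
  have tc: "t n \<in> fs_carrier (Lq q)"
  proof -
    have "integrable surface_measure (\<lambda>x. norm (t n x) powr q)"
      by (rule Bochner_Integration.integrable_bound[OF fq]) (auto simp: t_def intro!: AE_I2)
    then show ?thesis by simp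
  qed
  have v: "valid_space (Lq q)" and fc: "f \<in> fs_carrier (Lq q)" using X f Lq by auto
  have c1: "(\<lambda>x. f x - t n x) \<in> fs_carrier (Lq q)" and c2: "(\<lambda>x. t n x - g x) \<in> fs_carrier (Lq q)"
    by (intro carrier_diff v fc tc gc)+
  have "(LINT x|surface_measure. norm ((f x - t n x) + (t n x - g x)) powr q) \<le>
      2 powr q * ((LINT x|surface_measure. norm (f x - t n x) powr q) + (LINT x|surface_measure. norm (t n x - g x) powr q))"
    using c1 c2 Lq by (intro Lq_add_integrable(2)) auto
  also have "\<dots> < 2 powr q * (d + d)" using n g(2) by (intro mult_strict_left_mono) auto
  also have "\<dots> = e powr q" by (simp add: d_def)
  finally have "(LINT x|surface_measure. norm (f x - g x) powr q) < e powr q" by simp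
  then have "(LINT x|surface_measure. norm (f x - g x) powr q) powr (1 / q) < (e powr q) powr (1 / q)"
    using Lq by (intro powr_less_mono2) auto
  also have "\<dots> = e" using e Lq by (simp add: powr_powr)
  finally show ?thesis using gS Lq by (intro exI[of _ g]) simp
qed

section \<open>Zonal multiplier operators\<close>

lemma rapid_poly_growth_bounded:
  assumes "rapid m" "poly_growth a"
  obtains C where "\<And>k. \<bar>m k * a k\<bar> * (real k + 1) ^ M \<le> C"
proof -
  obtain B L where B: "\<And>k. \<bar>a k\<bar> \<le> B * (real k + 1) ^ L"
    using assms(2) by (auto simp: poly_growth_def)
  obtain D where D: "\<And>k. \<bar>m k\<bar> * (real k + 1) ^ (L + M) \<le> D"
    using assms(1) by (auto simp: rapid_def)
  have "B \<ge> 0" using order.trans[OF abs_ge_zero B[of 0]] by simp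
  have "\<bar>m k * a k\<bar> * (real k + 1) ^ M \<le> D * B" for k
  proof -
    have "\<bar>m k * a k\<bar> * (real k + 1) ^ M \<le> \<bar>m k\<bar> * (B * (real k + 1) ^ L) * (real k + 1) ^ M"
      unfolding abs_mult by (intro mult_right_mono mult_left_mono B) auto
    also have "\<dots> = (\<bar>m k\<bar> * (real k + 1) ^ (L + M)) * B" by (simp add: power_add)
    also have "\<dots> \<le> D * B" by (intro mult_right_mono D \<open>B \<ge> 0\<close>)
    finally show ?thesis .
  qed
  then show thesis by (rule that)
qed

lemma rapid_mult_poly_growth:
  assumes "rapid m" "poly_growth a"
  shows "rapid (\<lambda>k. m k * a k)"
  unfolding rapid_def using rapid_poly_growth_bounded[OF assms] by metis

lemma rapid_summable:
  assumes "rapid m" "poly_growth a"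
  shows "summable (\<lambda>k. \<bar>m k * a k\<bar>)"
proof -
  obtain C where C: "\<And>k. \<bar>m k * a k\<bar> * (real k + 1) ^ 2 \<le> C"
    using rapid_poly_growth_bounded[OF assms] by metis
  have "summable (\<lambda>n. inverse (real (Suc n) ^ 2))"
    using inverse_power_summable[of 2, where 'a = real] by (subst summable_Suc_iff) simp
  then have s: "summable (\<lambda>k. C * inverse (real (Suc k) ^ 2))" by (rule summable_mult)
  show ?thesis
  proof (rule summable_comparison_test'[OF s])
    fix k :: nat
    show "norm \<bar>m k * a k\<bar> \<le> C * inverse (real (Suc k) ^ 2)"
      using C[of k] by (simp add: field_simps)
  qed
qed

lemma rapid_fdiff:
  assumes "rapid m"
  shows "rapid (fdiff m)"
  unfolding rapid_def
proof
  fix M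
  obtain C where C: "\<And>k. \<bar>m k\<bar> * (real k + 1) ^ M \<le> C" using assms by (auto simp: rapid_def)
  have "\<bar>fdiff m k\<bar> * (real k + 1) ^ M \<le> C + C" for k
  proof -
    have "\<bar>fdiff m k\<bar> * (real k + 1) ^ M \<le> (\<bar>m k\<bar> + \<bar>m (Suc k)\<bar>) * (real k + 1) ^ M"
      unfolding fdiff_def by (intro mult_right_mono) auto
    also have "\<dots> \<le> \<bar>m k\<bar> * (real k + 1) ^ M + \<bar>m (Suc k)\<bar> * (real (Suc k) + 1) ^ M"
      unfolding distrib_right by (intro add_left_mono mult_left_mono power_mono) auto
    also have "\<dots> \<le> C + C" by (intro add_mono C)
    finally show ?thesis .
  qed
  then show "\<exists>C. \<forall>k. \<bar>fdiff m k\<bar> * (real k + 1) ^ M \<le> C" by blast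
qed

lemma rapid_iterated_fdiff: "rapid m \<Longrightarrow> rapid ((fdiff ^^ j) m)"
  by (induction j) (simp_all add: rapid_fdiff)

lemma poly_growth_mult:
  assumes "poly_growth a" "poly_growth b"
  shows "poly_growth (\<lambda>k. a k * b k)"
proof -
  obtain B L where B: "\<And>k. \<bar>a k\<bar> \<le> B * (real k + 1) ^ L"
    using assms(1) by (auto simp: poly_growth_def)
  obtain D M where D: "\<And>k. \<bar>b k\<bar> \<le> D * (real k + 1) ^ M"
    using assms(2) by (auto simp: poly_growth_def)
  have "\<bar>a k * b k\<bar> \<le> (B * D) * (real k + 1) ^ (L + M)" for k
  proof -
    have "\<bar>a k * b k\<bar> \<le> (B * (real k + 1) ^ L) * (D * (real k + 1) ^ M)"
      unfolding abs_mult using order.trans[OF abs_ge_zero B] by (intro mult_mono B D) auto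
    then show ?thesis by (simp add: power_add mult_ac)
  qed
  then show ?thesis unfolding poly_growth_def by blast
qed

lemma poly_growth_mono:
  assumes "poly_growth b" "\<And>k. \<bar>a k\<bar> \<le> b k"
  shows "poly_growth a"
  using assms unfolding poly_growth_def by (meson abs_ge_self order_trans)

lemma poly_growth_geometric_mult:
  assumes "poly_growth (fps_nth A)"
  shows "poly_growth (fps_nth (geometric_fps * A))"
proof -
  obtain B L where B: "\<And>k. \<bar>fps_nth A k\<bar> \<le> B * (real k + 1) ^ L"
    using assms by (auto simp: poly_growth_def)
  have B0: "B \<ge> 0" using order.trans[OF abs_ge_zero B[of 0]] by simp
  have "\<bar>fps_nth (geometric_fps * A) k\<bar> \<le> B * (real k + 1) ^ Suc L" for k
  proof -
    have "\<bar>fps_nth (geometric_fps * A) k\<bar> \<le> (\<Sum>i\<le>k. \<bar>fps_nth A i\<bar>)"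
      unfolding fps_nth_geometric_mult by (rule sum_abs)
    also have "\<dots> \<le> (\<Sum>i\<le>k. B * (real k + 1) ^ L)"
      using B0 by (intro sum_mono order.trans[OF B] mult_left_mono power_mono) auto
    also have "\<dots> = B * (real k + 1) ^ Suc L" by (simp add: algebra_simps)
    finally show ?thesis .
  qed
  then show ?thesis unfolding poly_growth_def by blast
qed

lemma poly_growth_geometric_power_mult:
  "poly_growth (fps_nth A) \<Longrightarrow> poly_growth (fps_nth (geometric_fps ^ j * A))"
  by (induction j) (simp_all add: poly_growth_geometric_mult mult.assoc)

text \<open>Abel summation: partial sums are multiplication by \<open>geometric_fps\<close>, and the
  sign chosen in \<open>fdiff\<close> keeps alternating signs away. The boundary term
  \<open>m (Suc K) * s K\<close> tends to 0, by rapid decay against polynomial growth.\<close>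

lemma summation_by_parts_step:
  assumes m: "rapid m" and A: "poly_growth (fps_nth A)"
  shows "(\<Sum>k. m k * fps_nth A k) = (\<Sum>k. fdiff m k * fps_nth (geometric_fps * A) k)"
proof -
  define s where "s = fps_nth (geometric_fps * A)"
  have s: "poly_growth s" unfolding s_def by (rule poly_growth_geometric_mult[OF A])
  have sSuc: "s (Suc k) = s k + fps_nth A (Suc k)" for k by (simp add: s_def fps_nth_geometric_mult)
  have partial: "(\<Sum>k<Suc K. m k * fps_nth A k) = (\<Sum>k<Suc K. fdiff m k * s k) + m (Suc K) * s K" for K
  proof (induction K)
    case 0
    then show ?case by (simp add: fps_nth_geometric_mult fdiff_def algebra_simps geometric_fps_def s_def)
  next
    case (Suc K)
    have "(\<Sum>k<Suc (Suc K). m k * fps_nth A k) =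
        (\<Sum>k<Suc K. fdiff m k * s k) + m (Suc K) * s K + m (Suc K) * fps_nth A (Suc K)"
      using Suc by simp
    also have "\<dots> = (\<Sum>k<Suc (Suc K). fdiff m k * s k) + m (Suc (Suc K)) * s (Suc K)"
      by (simp add: sSuc fdiff_def algebra_simps)
    finally show ?case .
  qed
  have s1: "summable (\<lambda>k. m k * fps_nth A k)" and s2: "summable (\<lambda>k. fdiff m k * s k)"
    using rapid_summable[OF m A] rapid_summable[OF rapid_fdiff[OF m] s] by (auto intro: summable_rabs_cancel)
  have "(\<lambda>K. m (Suc K) * s K) \<longlonglongrightarrow> 0"
  proof -
    have "rapid (\<lambda>k. m (Suc k))"
      unfolding rapid_def
    proof
      fix M
      obtain C where C: "\<And>k. \<bar>m k\<bar> * (real k + 1) ^ M \<le> C" using m by (auto simp: rapid_def)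
      have "\<bar>m (Suc k)\<bar> * (real k + 1) ^ M \<le> C" for k
      proof -
        have "\<bar>m (Suc k)\<bar> * (real k + 1) ^ M \<le> \<bar>m (Suc k)\<bar> * (real (Suc k) + 1) ^ M"
          by (intro mult_left_mono power_mono) auto
        then show ?thesis using C[of "Suc k"] by linarith
      qed
      then show "\<exists>C. \<forall>k. \<bar>m (Suc k)\<bar> * (real k + 1) ^ M \<le> C" by blast
    qed
    from rapid_summable[OF this s] show ?thesis
      by (rule summable_LIMSEQ_zero[OF summable_rabs_cancel])
  qed
  then have 1: "(\<lambda>K. (\<Sum>k<Suc K. fdiff m k * s k) + m (Suc K) * s K) \<longlonglongrightarrow> (\<Sum>k. fdiff m k * s k) + 0"
    by (intro tendsto_add LIMSEQ_Suc summable_LIMSEQ s2)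
  have 2: "(\<lambda>K. \<Sum>k<Suc K. m k * fps_nth A k) \<longlonglongrightarrow> (\<Sum>k. m k * fps_nth A k)"
    by (intro LIMSEQ_Suc[of "\<lambda>K. \<Sum>k<K. m k * fps_nth A k"] summable_LIMSEQ s1)
  show ?thesis
    using LIMSEQ_unique[OF 2 1[folded partial]] by (simp add: s_def)
qed

lemma summation_by_parts:
  assumes m: "rapid m" and A: "poly_growth (fps_nth A)"
  shows "(\<Sum>k. m k * fps_nth A k) = (\<Sum>k. (fdiff ^^ j) m k * fps_nth (geometric_fps ^ j * A) k)"
proof (induction j)
  case (Suc j)
  have "(\<Sum>k. (fdiff ^^ j) m k * fps_nth (geometric_fps ^ j * A) k) =
      (\<Sum>k. fdiff ((fdiff ^^ j) m) k * fps_nth (geometric_fps * (geometric_fps ^ j * A)) k)"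
    by (intro summation_by_parts_step rapid_iterated_fdiff m poly_growth_geometric_power_mult A)
  with Suc show ?case by (simp add: mult.assoc)
qed simp

text \<open>Consecutive Cesaro numbers have the ratio \<open>1 + N / (k + 1)\<close>, which
  Bernoulli's inequality bounds by \<open>((k + 2) / (k + 1)) ^ N\<close>, the ratio of the claimed
  bounds.\<close>

lemma geometric_power_nth_le: "fps_nth (geometric_fps ^ Suc N) k \<le> (real k + 1) ^ N"
proof (induction k)
  case 0
  then show ?case by (simp add: geometric_fps_def fps_nth_power_0)
next
  case (Suc k)
  have "1 + real N * (1 / (real k + 1)) \<le> (1 + 1 / (real k + 1)) ^ N"
    by (rule Bernoulli_inequality, rule order.trans[of _ 0]) auto
  then have "(1 + real N * (1 / (real k + 1))) * (real k + 1) ^ N \<le> (1 + 1 / (real k + 1)) ^ N * (real k + 1) ^ N"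
    by (intro mult_right_mono) auto
  also have "\<dots> = (real (Suc k) + 1) ^ N"
    by (simp add: power_mult_distrib[symmetric] field_simps)
  finally have B: "(1 + real N * (1 / (real k + 1))) * (real k + 1) ^ N \<le> (real (Suc k) + 1) ^ N" .
  have "real (Suc k) * fps_nth (geometric_fps ^ Suc N) (Suc k) = real (k + Suc N) * fps_nth (geometric_fps ^ Suc N) k"
    by (rule geometric_power_nth_Suc)
  also have "\<dots> \<le> real (k + Suc N) * (real k + 1) ^ N"
    using Suc by (intro mult_left_mono) auto
  also have "\<dots> = real (Suc k) * ((1 + real N * (1 / (real k + 1))) * (real k + 1) ^ N)"
    by (simp add: field_simps)
  also have "\<dots> \<le> real (Suc k) * (real (Suc k) + 1) ^ N"
    using B by (intro mult_left_mono) auto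
  finally show ?case
    by (simp only: mult_le_cancel_left_pos of_nat_0_less_iff zero_less_Suc)
qed

text \<open>These quotients are the multipliers of the Cesaro means. For a fixed degree j they are
  products of j ratios of consecutive Cesaro numbers, each tending to 1; shifting by j first keeps
  the subtraction \<open>i - j\<close> honest.\<close>

lemma geometric_power_ratio_tendsto:
  fixes N j :: nat
  defines "A \<equiv> fps_nth (geometric_fps ^ Suc N)"
  shows "(\<lambda>i. if j \<le> i then A (i - j) / A i else 0) \<longlonglongrightarrow> 1"
proof -
  have A0: "A k > 0" for k unfolding A_def by (rule geometric_power_nth_pos) simp
  have "(\<lambda>i. A i / A (i + j)) \<longlonglongrightarrow> 1"
  proof (induction j)
    case 0
    then show ?case using A0 by (simp add: less_imp_neq[symmetric])
  next
    case (Suc j)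
    have step: "A k / A (Suc k) = real (Suc k) / real (k + Suc N)" for k
      using geometric_power_nth_Suc[of k "Suc N"] A0[of k] A0[of "Suc k"]
      unfolding A_def[symmetric] by (simp add: field_simps)
    have "(\<lambda>k. real (Suc k) / real (k + Suc N)) \<longlonglongrightarrow> 1" by real_asymp
    then have "(\<lambda>k. A k / A (Suc k)) \<longlonglongrightarrow> 1" by (simp only: step)
    from LIMSEQ_ignore_initial_segment[OF this, of j]
    have "(\<lambda>i. A (i + j) / A (Suc (i + j))) \<longlonglongrightarrow> 1" by simp
    from tendsto_mult[OF Suc this]
    have lim: "(\<lambda>i. A i / A (i + j) * (A (i + j) / A (Suc (i + j)))) \<longlonglongrightarrow> 1"
      by (simp only: mult_1)
    have eq: "A i / A (i + j) * (A (i + j) / A (Suc (i + j))) = A i / A (i + Suc j)" for i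
      using A0[of "i + j"] by simp
    show ?case using lim unfolding eq .
  qed
  then have "(\<lambda>i. if j \<le> i + j then A (i + j - j) / A (i + j) else 0) \<longlonglongrightarrow> 1" by simp
  then show ?thesis by (rule LIMSEQ_offset)
qed

lemma poly_growth_poly: "poly_growth (\<lambda>k. poly p (real k))"
proof -
  have "\<bar>poly p (real k)\<bar> \<le> (\<Sum>i\<le>degree p. \<bar>coeff p i\<bar>) * (real k + 1) ^ degree p" for k
  proof -
    have "\<bar>poly p (real k)\<bar> \<le> (\<Sum>i\<le>degree p. \<bar>coeff p i * real k ^ i\<bar>)"
      unfolding poly_altdef by (rule sum_abs)
    also have "\<dots> \<le> (\<Sum>i\<le>degree p. \<bar>coeff p i\<bar> * (real k + 1) ^ degree p)"
    proof (rule sum_mono)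
      fix i assume i: "i \<in> {..degree p}"
      have "real k ^ i \<le> (real k + 1) ^ i" by (intro power_mono) auto
      also have "\<dots> \<le> (real k + 1) ^ degree p" using i by (intro power_increasing) auto
      finally show "\<bar>coeff p i * real k ^ i\<bar> \<le> \<bar>coeff p i\<bar> * (real k + 1) ^ degree p"
        by (simp add: abs_mult mult_left_mono)
    qed
    finally show ?thesis by (simp add: sum_distrib_right)
  qed
  then show ?thesis unfolding poly_growth_def by blast
qed

lemma poly_growth_powr:
  assumes a: "poly_growth a" and g: "0 < g" "g \<le> 1" and pos: "\<And>k. a k \<ge> 0"
  shows "poly_growth (\<lambda>k. a k powr g)"
proof (rule poly_growth_mono)
  obtain B L where B: "\<And>k. \<bar>a k\<bar> \<le> B * (real k + 1) ^ L"
    using a by (auto simp: poly_growth_def)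
  have "\<bar>1 + a k\<bar> \<le> (1 + B) * (real k + 1) ^ L" for k
  proof -
    have "1 \<le> (real k + 1) ^ L" by (intro one_le_power) auto
    moreover have "\<bar>1 + a k\<bar> = 1 + \<bar>a k\<bar>" using pos[of k] by simp
    ultimately show ?thesis using B[of k] unfolding distrib_right by linarith
  qed
  then show "poly_growth (\<lambda>k. 1 + a k)" unfolding poly_growth_def by blast
  fix k
  have "a k powr g \<le> 1 + a k"
  proof (cases "a k \<le> 1")
    case True
    then have "a k powr g \<le> 1" using pos g by (intro powr_le1) auto
    then show ?thesis using pos[of k] by simp
  next
    case False
    then have "a k powr g \<le> a k powr 1" using g by (intro powr_mono) auto
    then show ?thesis using False by simp
  qed
  then show "\<bar>a k powr g\<bar> \<le> 1 + a k" by simp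
qed

section \<open>Zonal functions and their orthogonality\<close>

lemma sphere_index_DIM:
  assumes "DIM('a::euclidean_space) \<ge> 3"
  shows "sphere_index TYPE('a) > 0" "2 * sphere_index TYPE('a) + 2 = real DIM('a)"
    "2 * sphere_index TYPE('a) = real (DIM('a) - 2)"
  using assms by (auto simp: sphere_index_def of_nat_diff field_simps)

definition zonal :: "'a::euclidean_space itself \<Rightarrow> nat \<Rightarrow> real \<Rightarrow> real" where
  "zonal T k u = zonal_coeff (sphere_index T) k u"

definition zonal_bound :: "'a::euclidean_space itself \<Rightarrow> nat \<Rightarrow> real" where
  "zonal_bound T k = (real k + sphere_index T) / sphere_index T * real ((k + (DIM('a) - 2)) choose (DIM('a) - 2))"

lemma abs_zonal_le:
  assumes dim: "DIM('a::euclidean_space) \<ge> 3" and u: "\<bar>u\<bar> \<le> 1"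
  shows "\<bar>zonal TYPE('a) k u\<bar> \<le> zonal_bound TYPE('a) k"
proof -
  note l = sphere_index_DIM[OF dim]
  have "\<bar>gegenbauer (sphere_index TYPE('a)) k u\<bar> \<le> real ((k + (DIM('a) - 2)) choose (DIM('a) - 2))"
    using l u by (intro abs_gegenbauer_le) auto
  then show ?thesis
    using l(1) by (simp add: zonal_def zonal_coeff_def zonal_bound_def abs_mult mult_left_mono del: times_divide_eq_left)
qed

lemma zonal_bound_nonneg:
  assumes dim: "DIM('a::euclidean_space) \<ge> 3"
  shows "zonal_bound TYPE('a) k \<ge> 0"
  using order.trans[OF abs_ge_zero abs_zonal_le[OF dim, of 0 k]] by simp

lemma poly_growth_zonal_bound:
  assumes dim: "DIM('a::euclidean_space) \<ge> 3"
  shows "poly_growth (zonal_bound TYPE('a))"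
proof -
  let ?l = "sphere_index TYPE('a)" and ?d = "DIM('a) - 2"
  have l: "?l > 0" by (rule sphere_index_DIM[OF dim])
  have "\<bar>(real k + ?l) / ?l\<bar> \<le> (1 + 1 / ?l) * (real k + 1) ^ 1" for k
  proof -
    have "(real k + ?l) / ?l = real k * (1 / ?l) + 1" using l by (simp add: field_simps)
    also have "\<dots> \<le> (1 + 1 / ?l) * (real k + 1)" using l by (simp add: field_simps)
    finally show ?thesis using l by simp
  qed
  then have 1: "poly_growth (\<lambda>k. (real k + ?l) / ?l)" unfolding poly_growth_def by blast
  have "\<bar>real ((k + ?d) choose ?d)\<bar> \<le> (real ?d + 1) ^ ?d * (real k + 1) ^ ?d" for k
  proof -
    have "real ((k + ?d) choose ?d) \<le> real ((k + ?d) ^ ?d)"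
      by (intro of_nat_mono binomial_le_pow) simp
    also have "\<dots> = (real k + real ?d) ^ ?d" by (simp del: of_nat_diff)
    also have "\<dots> \<le> ((real ?d + 1) * (real k + 1)) ^ ?d"
      by (intro power_mono) (auto simp: algebra_simps)
    finally show ?thesis by (simp add: power_mult_distrib)
  qed
  then have 2: "poly_growth (\<lambda>k. real ((k + ?d) choose ?d))" unfolding poly_growth_def by blast
  show ?thesis
    using poly_growth_mult[OF 1 2] by (simp add: zonal_bound_def[abs_def])
qed

lemma zonal_continuous: "continuous_on S (zonal T k)"
  unfolding zonal_def zonal_coeff_def gegenbauer_eq_poly by (intro continuous_intros)

lemma zonal_0 [simp]: "DIM('a::euclidean_space) \<ge> 3 \<Longrightarrow> zonal TYPE('a) 0 u = 1"
  using sphere_index_DIM(1)[where 'a = 'a] by (simp add: zonal_def zonal_coeff_def)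

lemma zonal_1:
  assumes dim: "DIM('a::euclidean_space) \<ge> 3"
  shows "zonal TYPE('a) (Suc 0) u = real DIM('a) * u"
  using sphere_index_DIM[OF dim] by (simp add: zonal_def zonal_coeff_def gegenbauer_1 field_simps)

lemma inner_abs_le_1: "norm x = 1 \<Longrightarrow> norm y = 1 \<Longrightarrow> \<bar>x \<bullet> y\<bar> \<le> 1"
  using Cauchy_Schwarz_ineq2[of x y] by simp

lemma zonal_inner_integrable:
  "integrable (surface_measure :: 'a::euclidean_space measure) (\<lambda>y. zonal T k (x \<bullet> y))"
  by (rule zonal_kernel_integrable[OF zonal_continuous])

text \<open>Both factors are eigenfunctions of the operator in Green's identity, with the
  eigenvalues \<open>- k (k + 2 l)\<close>, which differ because l is positive. Two poles x and z
  are allowed since the composition of kernels integrates exactly such products.\<close>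

lemma zonal_orthogonal:
  fixes x z :: "'a::euclidean_space"
  assumes dim: "DIM('a) \<ge> 3" and jk: "j \<noteq> k" and x: "norm x = 1" and z: "norm z = 1"
  shows "(LINT y|surface_measure. zonal TYPE('a) j (x \<bullet> y) * zonal TYPE('a) k (z \<bullet> y)) = 0"
proof -
  let ?l = "sphere_index TYPE('a)"
  note l = sphere_index_DIM[OF dim]
  define F where "F = gegenbauer_poly ?l j"
  define G where "G = gegenbauer_poly ?l k"
  have D: "real DIM('a) - 1 = 2 * ?l + 1" using l by linarith
  have ode: "(1 - u\<^sup>2) * poly (pderiv (pderiv (gegenbauer_poly ?l i))) u -
     (real DIM('a) - 1) * u * poly (pderiv (gegenbauer_poly ?l i)) u =
      - (real i * (real i + 2 * ?l)) * poly (gegenbauer_poly ?l i) u" for u i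
    unfolding D by (rule gegenbauer_poly_ODE)
  define I where "I = (LINT y|surface_measure. poly F (x \<bullet> y) * poly G (z \<bullet> y))"
  have "(LINT y|surface_measure. - (real j * (real j + 2 * ?l)) * poly F (x \<bullet> y) * poly G (z \<bullet> y)) =
      (LINT y|surface_measure. poly F (x \<bullet> y) * (- (real k * (real k + 2 * ?l)) * poly G (z \<bullet> y)))"
    using zonal_green[of "poly F" "poly (pderiv F)" "poly (pderiv (pderiv F))" "poly G" "poly (pderiv G)"
        "poly (pderiv (pderiv G))" x z] x z
    unfolding F_def G_def ode by (simp add: poly_DERIV continuous_on_poly continuous_on_id)
  moreover have "(LINT y|surface_measure. - (real j * (real j + 2 * ?l)) * poly F (x \<bullet> y) * poly G (z \<bullet> y)) =
      - (real j * (real j + 2 * ?l)) * I"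
    unfolding I_def mult.assoc[of "- (real j * (real j + 2 * ?l))"] by (rule integral_mult_right_zero)
  moreover have "(LINT y|surface_measure. poly F (x \<bullet> y) * (- (real k * (real k + 2 * ?l)) * poly G (z \<bullet> y))) =
      - (real k * (real k + 2 * ?l)) * I"
    unfolding I_def integral_mult_right_zero[symmetric] by (simp add: mult_ac)
  ultimately have "(real j * (real j + 2 * ?l) - real k * (real k + 2 * ?l)) * I = 0"
    by (simp add: algebra_simps)
  moreover have "real j * (real j + 2 * ?l) - real k * (real k + 2 * ?l) \<noteq> 0"
  proof -
    have "real j * (real j + 2 * ?l) - real k * (real k + 2 * ?l) = (real j - real k) * (real j + real k + 2 * ?l)"
      by (simp add: algebra_simps)
    moreover have "real j + real k + 2 * ?l > 0" using l(1) by (intro add_nonneg_pos) auto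
    ultimately show ?thesis using jk by simp
  qed
  ultimately have "I = 0" by simp
  have "(LINT y|surface_measure. zonal TYPE('a) j (x \<bullet> y) * zonal TYPE('a) k (z \<bullet> y)) =
      (LINT y|surface_measure. ((real j + ?l) / ?l * ((real k + ?l) / ?l)) * (poly F (x \<bullet> y) * poly G (z \<bullet> y)))"
    by (simp add: zonal_def zonal_coeff_def gegenbauer_eq_poly F_def G_def mult_ac)
  also have "\<dots> = 0" using \<open>I = 0\<close> unfolding integral_mult_right_zero I_def by simp
  finally show ?thesis .
qed

lemma zonal_integral:
  fixes x :: "'a::euclidean_space"
  assumes dim: "DIM('a) \<ge> 3" and x: "norm x = 1"
  shows "(LINT y|surface_measure. zonal TYPE('a) k (x \<bullet> y)) = (if k = 0 then sphere_area TYPE('a) else 0)"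
proof (cases "k = 0")
  case True
  then show ?thesis using dim by (simp add: sphere_area_def)
next
  case False
  then show ?thesis using zonal_orthogonal[OF dim False x x] dim by simp
qed

lemma zonal_1_integral:
  fixes x :: "'a::euclidean_space"
  assumes dim: "DIM('a) \<ge> 3" and x: "norm x = 1"
  shows "(LINT y|surface_measure. zonal TYPE('a) k (x \<bullet> y) * (x \<bullet> y)) = (if k = 1 then sphere_area TYPE('a) else 0)"
proof (cases "k = 1")
  case True
  \<comment> \<open>Green's identity for \<open>u^2\<close> and the constant 1 says that
    \<open>2 - 2 DIM (x \<bullet> y)^2\<close> has integral 0; this is the second moment needed in
    degree one.\<close>
  have "(LINT y|surface_measure. ((1 - (x \<bullet> y)\<^sup>2) * 2 - (real DIM('a) - 1) * (x \<bullet> y) * (2 * (x \<bullet> y))) * 1) =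
     (LINT y|surface_measure. (x \<bullet> y)\<^sup>2 * ((1 - (x \<bullet> y)\<^sup>2) * 0 - (real DIM('a) - 1) * (x \<bullet> y) * 0))"
    by (rule zonal_green[of "\<lambda>u. u\<^sup>2" "\<lambda>u. 2 * u" "\<lambda>_. 2" "\<lambda>_. 1" "\<lambda>_. 0" "\<lambda>_. 0" x x])
       (auto intro!: derivative_eq_intros simp: x)
  also have "\<dots> = 0" by simp
  also have "(\<lambda>y. ((1 - (x \<bullet> y)\<^sup>2) * 2 - (real DIM('a) - 1) * (x \<bullet> y) * (2 * (x \<bullet> y))) * 1) =
      (\<lambda>y. 2 - 2 * (real DIM('a) * (x \<bullet> y)\<^sup>2))"
    by (simp add: power2_eq_square algebra_simps)
  finally have "(LINT y|surface_measure. 2 - 2 * (real DIM('a) * (x \<bullet> y)\<^sup>2)) = 0" .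
  moreover have "integrable surface_measure (\<lambda>y. 2 * (real DIM('a) * (x \<bullet> y)\<^sup>2))"
    by (intro integrable_surface_continuous continuous_intros)
  ultimately have "(LINT y|surface_measure. real DIM('a) * (x \<bullet> y)\<^sup>2) = sphere_area TYPE('a)"
    by (subst (asm) Bochner_Integration.integral_diff) (auto simp: sphere_area_def)
  then show ?thesis using True by (simp add: zonal_1[OF dim] power2_eq_square mult.assoc)
next
  case False
  have "(LINT y|surface_measure. zonal TYPE('a) k (x \<bullet> y) * (x \<bullet> y)) =
      (LINT y|surface_measure. 1 / real DIM('a) * (zonal TYPE('a) k (x \<bullet> y) * zonal TYPE('a) (Suc 0) (x \<bullet> y)))"
    by (simp add: zonal_1[OF dim])
  also have "\<dots> = 0"
    unfolding integral_mult_right_zero using zonal_orthogonal[OF dim _ x x, of k "Suc 0"] False by simp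
  finally show ?thesis using False by simp
qed

section \<open>Kernels of absolutely summable multipliers\<close>

definition clamp1 :: "real \<Rightarrow> real" where
  "clamp1 u = max (-1) (min 1 u)"

lemma clamp1_le: "\<bar>clamp1 u\<bar> \<le> 1"
  by (auto simp: clamp1_def)

lemma clamp1_inner: "norm x = 1 \<Longrightarrow> norm y = 1 \<Longrightarrow> clamp1 (x \<bullet> y) = x \<bullet> y"
  using inner_abs_le_1[of x y] by (auto simp: clamp1_def)

lemma continuous_clamp1: "continuous_on S clamp1"
  unfolding clamp1_def by (intro continuous_intros)

text \<open>The series is only known to converge on \<open>[-1, 1]\<close>; clamping the argument makes the kernel
  continuous on the whole line.\<close>

definition mult_kernel :: "'a::euclidean_space itself \<Rightarrow> (nat \<Rightarrow> real) \<Rightarrow> real \<Rightarrow> real" where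
  "mult_kernel T m u = (\<Sum>k. m k * zonal T k (clamp1 u)) / sphere_area T"

text \<open>The weight is the bound for the zonal functions on [-1, 1], so the kernel series
  converges absolutely and uniformly. Finitely supported multipliers qualify as well as rapid ones,
  which treats partial sums and limits alike.\<close>

definition admissible :: "'a::euclidean_space itself \<Rightarrow> (nat \<Rightarrow> real) \<Rightarrow> bool" where
  "admissible T m \<longleftrightarrow> summable (\<lambda>k. \<bar>m k\<bar> * zonal_bound T k)"

lemma rapid_admissible:
  assumes dim: "DIM('a::euclidean_space) \<ge> 3" and m: "rapid m"
  shows "admissible TYPE('a) m"
  using rapid_summable[OF m poly_growth_zonal_bound[OF dim]] zonal_bound_nonneg[OF dim]
  by (simp add: admissible_def abs_mult)

lemma finite_admissible:
  assumes "\<And>k. k \<ge> K \<Longrightarrow> m k = 0"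
  shows "admissible TYPE('a::euclidean_space) m"
  unfolding admissible_def by (rule summable_finite[of "{..<K}"]) (use assms in auto)

lemma admissible_diff:
  assumes dim: "DIM('a::euclidean_space) \<ge> 3" and m: "admissible TYPE('a) m" "admissible TYPE('a) m'"
  shows "admissible TYPE('a) (\<lambda>k. m k - m' k)"
  unfolding admissible_def
proof (rule summable_comparison_test')
  show "summable (\<lambda>k. \<bar>m k\<bar> * zonal_bound TYPE('a) k + \<bar>m' k\<bar> * zonal_bound TYPE('a) k)"
    using m unfolding admissible_def by (rule summable_add)
  show "norm (\<bar>m k - m' k\<bar> * zonal_bound TYPE('a) k) \<le>
      \<bar>m k\<bar> * zonal_bound TYPE('a) k + \<bar>m' k\<bar> * zonal_bound TYPE('a) k" for k
    using zonal_bound_nonneg[OF dim, of k]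
    by (simp add: abs_mult distrib_right[symmetric] mult_right_mono)
qed

lemma mult_kernel_summand_le:
  assumes dim: "DIM('a::euclidean_space) \<ge> 3"
  shows "\<bar>m k * zonal TYPE('a) k (clamp1 u)\<bar> \<le> \<bar>m k\<bar> * zonal_bound TYPE('a) k"
  unfolding abs_mult by (intro mult_left_mono abs_zonal_le[OF dim] clamp1_le) auto

lemma mult_kernel_summable:
  assumes dim: "DIM('a::euclidean_space) \<ge> 3" and m: "admissible TYPE('a) m"
  shows "summable (\<lambda>k. \<bar>m k * zonal TYPE('a) k (clamp1 u)\<bar>)"
  using m[unfolded admissible_def]
  by (rule summable_comparison_test') (simp add: mult_kernel_summand_le[OF dim] del: abs_mult)

lemma mult_kernel_continuous:
  assumes dim: "DIM('a::euclidean_space) \<ge> 3" and m: "admissible TYPE('a) m"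
  shows "continuous_on UNIV (mult_kernel TYPE('a) m)"
proof -
  have "uniform_limit UNIV (\<lambda>n u. \<Sum>k<n. m k * zonal TYPE('a) k (clamp1 u))
      (\<lambda>u. \<Sum>k. m k * zonal TYPE('a) k (clamp1 u)) sequentially"
    using mult_kernel_summand_le[OF dim] m[unfolded admissible_def]
    by (intro Weierstrass_m_test) auto
  moreover have "continuous_on UNIV (\<lambda>u. \<Sum>k<n. m k * zonal TYPE('a) k (clamp1 u))" for n
    by (intro continuous_intros continuous_on_compose2[OF zonal_continuous[of UNIV] continuous_clamp1]) auto
  ultimately have "continuous_on UNIV (\<lambda>u. \<Sum>k. m k * zonal TYPE('a) k (clamp1 u))"
    by (intro uniform_limit_theorem[OF always_eventually]) auto
  then show ?thesis
    unfolding mult_kernel_def[abs_def] using sphere_area_pos[where 'a = 'a] by (intro continuous_intros) auto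
qed

lemma mult_kernel_diff:
  assumes dim: "DIM('a::euclidean_space) \<ge> 3" and m: "admissible TYPE('a) m" "admissible TYPE('a) m'"
  shows "mult_kernel TYPE('a) (\<lambda>k. m k - m' k) u = mult_kernel TYPE('a) m u - mult_kernel TYPE('a) m' u"
proof -
  have "summable (\<lambda>k. m k * zonal TYPE('a) k (clamp1 u))" "summable (\<lambda>k. m' k * zonal TYPE('a) k (clamp1 u))"
    using mult_kernel_summable[OF dim] m by (auto intro: summable_rabs_cancel)
  from suminf_diff[OF this] show ?thesis
    by (simp add: mult_kernel_def left_diff_distrib flip: diff_divide_distrib)
qed

lemma mult_kernel_cmult:
  assumes dim: "DIM('a::euclidean_space) \<ge> 3" and m: "admissible TYPE('a) m"
  shows "mult_kernel TYPE('a) (\<lambda>k. c * m k) u = c * mult_kernel TYPE('a) m u"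
proof -
  have "summable (\<lambda>k. m k * zonal TYPE('a) k (clamp1 u))"
    by (rule summable_rabs_cancel[OF mult_kernel_summable[OF dim m]])
  from suminf_mult[OF this, of c] show ?thesis
    by (simp add: mult_kernel_def mult.assoc)
qed

lemma abs_mult_kernel_le:
  assumes dim: "DIM('a::euclidean_space) \<ge> 3" and m: "admissible TYPE('a) m"
  shows "\<bar>mult_kernel TYPE('a) m u\<bar> \<le> (\<Sum>k. \<bar>m k\<bar> * zonal_bound TYPE('a) k) / sphere_area TYPE('a)"
proof -
  have "\<bar>\<Sum>k. m k * zonal TYPE('a) k (clamp1 u)\<bar> \<le> (\<Sum>k. \<bar>m k * zonal TYPE('a) k (clamp1 u)\<bar>)"
    by (intro summable_rabs mult_kernel_summable dim m)
  also have "\<dots> \<le> (\<Sum>k. \<bar>m k\<bar> * zonal_bound TYPE('a) k)"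
    using m unfolding admissible_def
    by (intro suminf_le mult_kernel_summand_le dim mult_kernel_summable[OF dim m])
  finally show ?thesis
    using sphere_area_pos[where 'a = 'a] by (simp add: mult_kernel_def divide_right_mono)
qed

lemma mult_kernel_integral:
  fixes g :: "'a::euclidean_space \<Rightarrow> real"
  assumes dim: "DIM('a) \<ge> 3" and m: "admissible TYPE('a) m" and g: "integrable surface_measure g" and x: "norm x = 1"
  shows "(LINT y|surface_measure. mult_kernel TYPE('a) m (x \<bullet> y) * g y) =
     (\<Sum>k. m k * (LINT y|surface_measure. zonal TYPE('a) k (x \<bullet> y) * g y)) / sphere_area TYPE('a)"
proof -
  define f where "f k y = m k * zonal TYPE('a) k (clamp1 (x \<bullet> y)) * g y" for k y
  have cz: "continuous_on UNIV (\<lambda>u. m k * zonal TYPE('a) k (clamp1 u))" for k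
    by (intro continuous_intros continuous_on_compose2[OF zonal_continuous[of UNIV] continuous_clamp1]) auto
  have fi: "integrable surface_measure (f k)" for k
    using zonal_integrable[OF cz g x] by (simp add: f_def[abs_def])
  have fle: "\<bar>f k y\<bar> \<le> (\<bar>m k\<bar> * zonal_bound TYPE('a) k) * \<bar>g y\<bar>" for k y
    unfolding f_def abs_mult[of _ "g y"]
    by (intro mult_right_mono mult_kernel_summand_le dim) simp
  note sm = m[unfolded admissible_def]
  have "(LINT y|surface_measure. (\<Sum>k. f k y)) = (\<Sum>k. (LINT y|surface_measure. f k y))"
  proof (rule integral_suminf[OF fi])
    have "summable (\<lambda>k. norm (f k y))" for y
      by (rule summable_comparison_test'[OF summable_mult2[OF sm, of "\<bar>g y\<bar>"]])
         (simp only: real_norm_def abs_idempotent fle)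
    then show "AE y in surface_measure. summable (\<lambda>k. norm (f k y))" by (intro AE_I2)
    have "\<bar>LINT y|surface_measure. \<bar>f k y\<bar>\<bar> \<le>
        (\<bar>m k\<bar> * zonal_bound TYPE('a) k) * (LINT y|surface_measure. \<bar>g y\<bar>)" for k
    proof -
      have "(LINT y|surface_measure. \<bar>f k y\<bar>) \<ge> 0" by (intro integral_nonneg_AE AE_I2) simp
      then have "\<bar>LINT y|surface_measure. \<bar>f k y\<bar>\<bar> = (LINT y|surface_measure. \<bar>f k y\<bar>)"
        by (rule abs_of_nonneg)
      also have "\<dots> \<le> (LINT y|surface_measure. (\<bar>m k\<bar> * zonal_bound TYPE('a) k) * \<bar>g y\<bar>)"
        by (intro integral_mono fle integrable_abs fi integrable_mult_right g)
      also have "\<dots> = (\<bar>m k\<bar> * zonal_bound TYPE('a) k) * (LINT y|surface_measure. \<bar>g y\<bar>)"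
        by (rule integral_mult_right_zero)
      finally show ?thesis .
    qed
    then show "summable (\<lambda>k. LINT y|surface_measure. norm (f k y))"
      unfolding real_norm_def
      by (intro summable_comparison_test'[OF summable_mult2[OF sm, of "LINT y|surface_measure. \<bar>g y\<bar>"]])
         (simp only: real_norm_def)
  qed
  moreover have "(\<Sum>k. f k y) = (\<Sum>k. m k * zonal TYPE('a) k (clamp1 (x \<bullet> y))) * g y" for y
    unfolding f_def
    by (rule suminf_mult2[symmetric]) (rule summable_rabs_cancel[OF mult_kernel_summable[OF dim m]])
  moreover have "(LINT y|surface_measure. f k y) = m k * (LINT y|surface_measure. zonal TYPE('a) k (x \<bullet> y) * g y)" for k
  proof -
    have "(LINT y|surface_measure. f k y) = (LINT y|surface_measure. m k * (zonal TYPE('a) k (x \<bullet> y) * g y))"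
      using x by (intro Bochner_Integration.integral_cong) (auto simp: f_def clamp1_inner mult.assoc)
    then show ?thesis by simp
  qed
  ultimately show ?thesis by (simp add: mult_kernel_def)
qed

text \<open>Only the degree zero survives the integration. For a nonnegative kernel the value
  \<open>m 0\<close> is therefore its \<open>L^1\<close> norm.\<close>

lemma mult_kernel_total:
  fixes x :: "'a::euclidean_space"
  assumes dim: "DIM('a) \<ge> 3" and m: "admissible TYPE('a) m" and x: "norm x = 1"
  shows "(LINT y|surface_measure. mult_kernel TYPE('a) m (x \<bullet> y)) = m 0"
proof -
  have "(LINT y|surface_measure. mult_kernel TYPE('a) m (x \<bullet> y)) =
      (\<Sum>k. m k * (if k = 0 then sphere_area TYPE('a) else 0)) / sphere_area TYPE('a)"
    using mult_kernel_integral[OF dim m _ x, of "\<lambda>_. 1"] zonal_integral[OF dim x] by simp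
  also have "(\<Sum>k. m k * (if k = 0 then sphere_area TYPE('a) else 0)) = m 0 * sphere_area TYPE('a)"
    by (subst suminf_finite[of "{0}"]) auto
  finally show ?thesis using sphere_area_pos[where 'a = 'a] by simp
qed

text \<open>The second test function of Korovkin's argument: a nonnegative kernel with
  \<open>m 0 = 1\<close> concentrates at its pole as soon as \<open>m 1\<close> approaches
  1.\<close>

lemma mult_kernel_first_moment:
  fixes x :: "'a::euclidean_space"
  assumes dim: "DIM('a) \<ge> 3" and m: "admissible TYPE('a) m" and x: "norm x = 1"
  shows "(LINT y|surface_measure. mult_kernel TYPE('a) m (x \<bullet> y) * (x \<bullet> y)) = m 1"
proof -
  have "integrable surface_measure (\<lambda>y. x \<bullet> y)"
    by (intro integrable_surface_continuous continuous_intros)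
  then have "(LINT y|surface_measure. mult_kernel TYPE('a) m (x \<bullet> y) * (x \<bullet> y)) =
      (\<Sum>k. m k * (if k = 1 then sphere_area TYPE('a) else 0)) / sphere_area TYPE('a)"
    using mult_kernel_integral[OF dim m _ x, of "\<lambda>y. x \<bullet> y"] zonal_1_integral[OF dim x] by simp
  also have "(\<Sum>k. m k * (if k = 1 then sphere_area TYPE('a) else 0)) = m 1 * sphere_area TYPE('a)"
    by (subst suminf_finite[of "{1}"]) auto
  finally show ?thesis using sphere_area_pos[where 'a = 'a] by simp
qed

text \<open>The argument of Korovkin's theorem: \<open>|f y - f x|\<close> is at most
  \<open>e + C (1 - x \<bullet> y)\<close>, whose mean under the kernel is \<open>e + C (1 - m 1)\<close>.\<close>

lemma korovkin_bound:
  fixes f :: "'a::euclidean_space \<Rightarrow> complex"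
  assumes dim: "DIM('a) \<ge> 3" and f: "continuous_on (sphere 0 1) f" and e: "e > 0"
  shows "\<exists>C\<ge>0. \<forall>m. admissible TYPE('a) m \<longrightarrow> (\<forall>u. mult_kernel TYPE('a) m u \<ge> 0) \<longrightarrow> m 0 = 1 \<longrightarrow>
     (\<forall>x\<in>sphere 0 1. norm (zonal_conv (mult_kernel TYPE('a) m) f x - f x) \<le> e + C * (1 - m 1))"
proof -
  have "uniformly_continuous_on (sphere 0 1) f"
    by (intro compact_uniformly_continuous f compact_sphere)
  then obtain d where d: "d > 0" "\<And>x y. x \<in> sphere 0 1 \<Longrightarrow> y \<in> sphere 0 1 \<Longrightarrow> dist y x < d \<Longrightarrow> dist (f y) (f x) < e"
    unfolding uniformly_continuous_on_def using e by metis
  have "bounded (f ` sphere 0 1)"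
    by (intro compact_imp_bounded compact_continuous_image f compact_sphere)
  then obtain B where B: "\<forall>x\<in>sphere 0 1. norm (f x) \<le> B" by (auto simp: bounded_iff)
  obtain x1 :: 'a where "norm x1 = 1" using exists_unit by blast
  then have B0: "B \<ge> 0" using B order.trans[OF norm_ge_zero] by force
  \<comment> \<open>At distance at least d one has \<open>1 - x \<bullet> y \<ge> d^2 / 2\<close>,
    so \<open>C * (1 - x \<bullet> y)\<close> exceeds the trivial bound \<open>2 * B\<close>. C
    depends on f and e only and is fixed before the kernel.\<close>
  define C where "C = 4 * B / d\<^sup>2"
  have C0: "C \<ge> 0" using B0 by (simp add: C_def)
  have key: "norm (f y - f x) \<le> e + C * (1 - x \<bullet> y)" if x: "norm x = 1" and y: "norm y = 1" for x y
  proof (cases "dist y x < d")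
    case True
    then have "norm (f y - f x) < e" using d(2)[of x y] x y by (simp add: dist_norm)
    moreover have "C * (1 - x \<bullet> y) \<ge> 0" using C0 inner_abs_le_1[OF x y] by (intro mult_nonneg_nonneg) auto
    ultimately show ?thesis by linarith
  next
    case False
    then have "d\<^sup>2 \<le> (norm (y - x))\<^sup>2" using d(1) by (intro power_mono) (auto simp: dist_norm)
    also have "\<dots> = 2 * (1 - x \<bullet> y)"
      using dot_norm_neg[of y x] x y by (simp add: inner_commute)
    finally have "2 * B * d\<^sup>2 \<le> 2 * B * (2 * (1 - x \<bullet> y))" using B0 by (intro mult_left_mono) auto
    then have "2 * B \<le> C * (1 - x \<bullet> y)" using d(1) by (simp add: C_def field_simps)
    moreover have "norm (f y - f x) \<le> 2 * B"
      using norm_triangle_ineq4[of "f y" "f x"] bspec[OF B, of x] bspec[OF B, of y] x y by simp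
    ultimately show ?thesis using e by linarith
  qed
  show ?thesis
  proof (intro exI[of _ C] conjI C0 allI impI ballI)
    fix m x
    assume m: "admissible TYPE('a) m" and pos: "\<forall>u. mult_kernel TYPE('a) m u \<ge> 0" and m0: "m 0 = 1"
      and "x \<in> sphere (0::'a) 1"
    then have x: "norm x = 1" by simp
    define K where "K = mult_kernel TYPE('a) m"
    have Kc: "continuous_on UNIV K" unfolding K_def by (rule mult_kernel_continuous[OF dim m])
    have fi: "integrable surface_measure f" by (rule integrable_surface_continuous[OF f])
    have xi: "integrable surface_measure (\<lambda>y. x \<bullet> y)"
      by (intro integrable_surface_continuous continuous_intros)
    have i1: "integrable surface_measure (\<lambda>y. K (x \<bullet> y))" by (rule zonal_kernel_integrable[OF Kc])
    have i2: "integrable surface_measure (\<lambda>y. K (x \<bullet> y) *\<^sub>R f y)" by (rule zonal_integrable[OF Kc fi x])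
    have i3: "integrable surface_measure (\<lambda>y. K (x \<bullet> y) * (x \<bullet> y))" using zonal_integrable[OF Kc xi x] by simp
    have i4: "integrable surface_measure (\<lambda>y. K (x \<bullet> y) *\<^sub>R (f y - f x))"
      using i1 i2 by (simp add: scaleR_diff_right)
    have t: "(LINT y|surface_measure. K (x \<bullet> y)) = 1"
      unfolding K_def using mult_kernel_total[OF dim m x] m0 by simp
    have "zonal_conv K f x - f x = (LINT y|surface_measure. K (x \<bullet> y) *\<^sub>R f y - K (x \<bullet> y) *\<^sub>R f x)"
      using i1 i2 t by (simp add: zonal_conv_def)
    also have "\<dots> = (LINT y|surface_measure. K (x \<bullet> y) *\<^sub>R (f y - f x))"
      by (simp add: scaleR_diff_right)
    also have "norm \<dots> \<le> (LINT y|surface_measure. norm (K (x \<bullet> y) *\<^sub>R (f y - f x)))"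
      by (rule integral_norm_bound)
    also have "\<dots> \<le> (LINT y|surface_measure. (e + C) * K (x \<bullet> y) - C * (K (x \<bullet> y) * (x \<bullet> y)))"
    proof (rule integral_mono)
      show "integrable surface_measure (\<lambda>y. norm (K (x \<bullet> y) *\<^sub>R (f y - f x)))"
        using i4 by (rule integrable_norm)
      show "integrable surface_measure (\<lambda>y. (e + C) * K (x \<bullet> y) - C * (K (x \<bullet> y) * (x \<bullet> y)))"
        using i1 i3 by (intro Bochner_Integration.integrable_diff integrable_mult_right)
      fix y :: 'a assume "y \<in> space surface_measure"
      then have y: "norm y = 1" by simp
      have "norm (K (x \<bullet> y) *\<^sub>R (f y - f x)) = K (x \<bullet> y) * norm (f y - f x)"
        using pos by (simp add: K_def)
      also have "\<dots> \<le> K (x \<bullet> y) * (e + C * (1 - x \<bullet> y))"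
        using pos by (intro mult_left_mono key x y) (auto simp: K_def)
      finally show "norm (K (x \<bullet> y) *\<^sub>R (f y - f x)) \<le> (e + C) * K (x \<bullet> y) - C * (K (x \<bullet> y) * (x \<bullet> y))"
        by (simp add: algebra_simps)
    qed
    also have "\<dots> = (e + C) * 1 - C * m 1"
      using i1 i3 t mult_kernel_first_moment[OF dim m x] by (simp add: K_def)
    also have "\<dots> = e + C * (1 - m 1)" by (simp add: algebra_simps)
    finally show "norm (zonal_conv (mult_kernel TYPE('a) m) f x - f x) \<le> e + C * (1 - m 1)"
      by (simp add: K_def)
  qed
qed

section \<open>Cesaro means and the reproducing property\<close>

lemma cesaro_kernel_eq:
  fixes u :: real
  assumes dim: "DIM('a::euclidean_space) \<ge> 3"
  defines "A \<equiv> fps_nth (geometric_fps ^ Suc DIM('a))"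
  shows "fps_nth (geometric_fps ^ Suc DIM('a) * Abs_fps (\<lambda>k. zonal TYPE('a) k u)) i =
      (\<Sum>j\<le>i. A (i - j) * zonal TYPE('a) j u)"
proof -
  have "fps_nth (Abs_fps (\<lambda>k. zonal TYPE('a) k u) * geometric_fps ^ Suc DIM('a)) i =
      (\<Sum>j=0..i. zonal TYPE('a) j u * A (i - j))"
    unfolding fps_mult_nth A_def by simp
  then show ?thesis by (simp add: mult.commute atMost_atLeast0 del: power_Suc)
qed

lemma cesaro_kernel_nonneg:
  assumes dim: "DIM('a::euclidean_space) \<ge> 3" and u: "\<bar>u\<bar> \<le> 1"
  shows "fps_nth (geometric_fps ^ Suc DIM('a) * Abs_fps (\<lambda>k. zonal TYPE('a) k u)) i \<ge> 0"
  unfolding zonal_def using sphere_index_DIM[OF dim] u by (intro cesaro_zonal_nonneg) auto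

text \<open>Orthogonality alone leaves the normalisation in degree k open. Convolving the zonal
  function around z with a Cesaro kernel multiplies the unknown integral by
  \<open>m i k / area\<close>; since the Cesaro kernels form an approximate identity, the limit in i
  identifies it with the value at x.\<close>

lemma zonal_reproducing:
  fixes x z :: "'a::euclidean_space"
  assumes dim: "DIM('a) \<ge> 3" and x: "norm x = 1" and z: "norm z = 1"
  shows "(LINT y|surface_measure. zonal TYPE('a) k (x \<bullet> y) * zonal TYPE('a) k (z \<bullet> y)) =
      sphere_area TYPE('a) * zonal TYPE('a) k (x \<bullet> z)"
proof -
  define A where "A = fps_nth (geometric_fps ^ Suc DIM('a))"
  have A0: "A i > 0" for i unfolding A_def by (rule geometric_power_nth_pos) simp
  \<comment> \<open>Cesaro multipliers, divided by \<open>A i\<close> so that the degree zero has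
    multiplier 1 as Korovkin's argument demands.\<close>
  define m where "m i j = (if j \<le> i then A (i - j) / A i else 0)" for i j
  have m_lim: "(\<lambda>i. m i j) \<longlonglongrightarrow> 1" for j
    unfolding m_def A_def by (rule geometric_power_ratio_tendsto)
  have adm: "admissible TYPE('a) (m i)" for i
    by (rule finite_admissible[of "Suc i"]) (simp add: m_def)
  have a0: "sphere_area TYPE('a) > 0" by (rule sphere_area_pos)
  have pos: "mult_kernel TYPE('a) (m i) u \<ge> 0" for i u
  proof -
    have "(\<Sum>j. m i j * zonal TYPE('a) j (clamp1 u)) = (\<Sum>j\<le>i. m i j * zonal TYPE('a) j (clamp1 u))"
      by (rule suminf_finite) (auto simp: m_def)
    also have "\<dots> = (\<Sum>j\<le>i. A (i - j) * zonal TYPE('a) j (clamp1 u)) / A i"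
      by (simp add: m_def sum_divide_distrib)
    also have "\<dots> \<ge> 0"
      using cesaro_kernel_nonneg[OF dim clamp1_le[of u], of i] A0[of i]
      unfolding cesaro_kernel_eq[OF dim] A_def[symmetric] by simp
    finally show ?thesis using a0 by (simp add: mult_kernel_def)
  qed
  have m0: "m i 0 = 1" for i using A0[of i] by (simp add: m_def)
  define g where "g y = zonal TYPE('a) k (z \<bullet> y)" for y :: 'a
  define f where "f y = complex_of_real (g y)" for y
  have gc: "continuous_on S g" for S
    unfolding g_def by (rule continuous_on_compose2[OF zonal_continuous[of UNIV]]) (auto intro!: continuous_intros)
  have fc: "continuous_on S f" for S
    unfolding f_def by (intro continuous_intros gc)
  have gi: "integrable surface_measure g" by (intro integrable_surface_continuous gc)
  define I where "I = (LINT y|surface_measure. zonal TYPE('a) k (x \<bullet> y) * g y)"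
  \<comment> \<open>By orthogonality the whole Cesaro sum collapses to its term of degree k.\<close>
  have conv: "zonal_conv (mult_kernel TYPE('a) (m i)) f x = complex_of_real (m i k * I / sphere_area TYPE('a))" for i
  proof -
    have "zonal_conv (mult_kernel TYPE('a) (m i)) f x =
        (LINT y|surface_measure. complex_of_real (mult_kernel TYPE('a) (m i) (x \<bullet> y) * g y))"
      by (simp add: zonal_conv_def f_def scaleR_conv_of_real)
    also have "\<dots> = complex_of_real (LINT y|surface_measure. mult_kernel TYPE('a) (m i) (x \<bullet> y) * g y)"
      by (rule integral_complex_of_real)
    also have "(LINT y|surface_measure. mult_kernel TYPE('a) (m i) (x \<bullet> y) * g y) =
        (\<Sum>j. m i j * (LINT y|surface_measure. zonal TYPE('a) j (x \<bullet> y) * g y)) / sphere_area TYPE('a)"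
      by (rule mult_kernel_integral[OF dim adm gi x])
    also have "(\<Sum>j. m i j * (LINT y|surface_measure. zonal TYPE('a) j (x \<bullet> y) * g y)) = m i k * I"
    proof (subst suminf_finite[of "{k}"])
      fix j assume "j \<notin> {k}"
      then show "m i j * (LINT y|surface_measure. zonal TYPE('a) j (x \<bullet> y) * g y) = 0"
        unfolding g_def using zonal_orthogonal[OF dim _ x z, of j k] by simp
    qed (simp_all add: I_def)
    finally show ?thesis .
  qed
  have "(\<lambda>i. zonal_conv (mult_kernel TYPE('a) (m i)) f x) \<longlonglongrightarrow> complex_of_real (1 * I / sphere_area TYPE('a))"
    unfolding conv by (intro tendsto_intros m_lim) (use a0 in simp)
  moreover have "(\<lambda>i. zonal_conv (mult_kernel TYPE('a) (m i)) f x) \<longlonglongrightarrow> f x"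
  proof (rule LIMSEQ_I)
    fix e :: real assume e: "e > 0"
    then have "e / 2 > 0" by simp
    from korovkin_bound[OF dim fc[of "sphere 0 1"] this] obtain C where C: "C \<ge> 0"
      "\<And>m x. admissible TYPE('a) m \<Longrightarrow> (\<And>u. mult_kernel TYPE('a) m u \<ge> 0) \<Longrightarrow> m 0 = 1 \<Longrightarrow>
        x \<in> sphere 0 1 \<Longrightarrow> norm (zonal_conv (mult_kernel TYPE('a) m) f x - f x) \<le> e / 2 + C * (1 - m 1)"
      by blast
    have le: "norm (zonal_conv (mult_kernel TYPE('a) (m i)) f x - f x) \<le> e / 2 + C * (1 - m i 1)" for i
      using x by (intro C(2) adm pos m0) simp
    have "(\<lambda>i. e / 2 + C * (1 - m i 1)) \<longlonglongrightarrow> e / 2 + C * (1 - 1)"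
      by (intro tendsto_intros m_lim)
    then have "\<forall>\<^sub>F i in sequentially. e / 2 + C * (1 - m i 1) < e"
      by (rule order_tendstoD(2)) (use e in simp)
    then obtain i0 where i0: "\<And>i. i \<ge> i0 \<Longrightarrow> e / 2 + C * (1 - m i 1) < e"
      by (auto simp: eventually_sequentially)
    show "\<exists>no. \<forall>n\<ge>no. norm (zonal_conv (mult_kernel TYPE('a) (m n)) f x - f x) < e"
      using i0 le by (meson le_less_trans)
  qed
  ultimately have "complex_of_real (1 * I / sphere_area TYPE('a)) = f x"
    by (rule LIMSEQ_unique)
  then have "I / sphere_area TYPE('a) = g x"
    unfolding f_def of_real_eq_iff by simp
  then have "I = sphere_area TYPE('a) * g x" using a0 by (simp add: field_simps)
  then show ?thesis by (simp add: I_def g_def inner_commute)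
qed

section \<open>Composition, partial sums and operator norms\<close>

lemma mult_kernel_compose:
  fixes x z :: "'a::euclidean_space"
  assumes dim: "DIM('a) \<ge> 3" and m: "admissible TYPE('a) m" and m': "admissible TYPE('a) m'"
    and x: "norm x = 1" and z: "norm z = 1"
  shows "(LINT y|surface_measure. mult_kernel TYPE('a) m (x \<bullet> y) * mult_kernel TYPE('a) m' (y \<bullet> z)) =
      mult_kernel TYPE('a) (\<lambda>k. m k * m' k) (x \<bullet> z)"
proof -
  have a0: "sphere_area TYPE('a) > 0" by (rule sphere_area_pos)
  have zi: "integrable surface_measure (\<lambda>y. zonal TYPE('a) k (x \<bullet> y))" for k and x :: 'a
    by (rule zonal_inner_integrable)
  \<comment> \<open>The series of one kernel is integrated at a time, so no double series arises;
    orthogonality and the reproducing property leave one term.\<close>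
  have inner: "(LINT y|surface_measure. zonal TYPE('a) k (x \<bullet> y) * mult_kernel TYPE('a) m' (y \<bullet> z)) =
      m' k * zonal TYPE('a) k (x \<bullet> z)" for k
  proof -
    have "(LINT y|surface_measure. zonal TYPE('a) k (x \<bullet> y) * mult_kernel TYPE('a) m' (y \<bullet> z)) =
        (LINT y|surface_measure. mult_kernel TYPE('a) m' (z \<bullet> y) * zonal TYPE('a) k (x \<bullet> y))"
      by (simp add: inner_commute mult.commute)
    also have "\<dots> = (\<Sum>j. m' j * (LINT y|surface_measure. zonal TYPE('a) j (z \<bullet> y) * zonal TYPE('a) k (x \<bullet> y))) / sphere_area TYPE('a)"
      by (rule mult_kernel_integral[OF dim m' zi z])
    also have "(\<Sum>j. m' j * (LINT y|surface_measure. zonal TYPE('a) j (z \<bullet> y) * zonal TYPE('a) k (x \<bullet> y))) =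
        m' k * (sphere_area TYPE('a) * zonal TYPE('a) k (z \<bullet> x))"
    proof (subst suminf_finite[of "{k}"])
      fix j assume "j \<notin> {k}"
      then show "m' j * (LINT y|surface_measure. zonal TYPE('a) j (z \<bullet> y) * zonal TYPE('a) k (x \<bullet> y)) = 0"
        using zonal_orthogonal[OF dim _ z x, of j k] by simp
    qed (simp_all add: zonal_reproducing[OF dim z x])
    finally show ?thesis using a0 by (simp add: inner_commute)
  qed
  have Ki: "integrable surface_measure (\<lambda>y. mult_kernel TYPE('a) m' (y \<bullet> z))"
    using zonal_kernel_integrable[OF mult_kernel_continuous[OF dim m'], of z] by (simp add: inner_commute)
  show ?thesis
    unfolding mult_kernel_integral[OF dim m Ki x] inner
    by (simp add: mult_kernel_def clamp1_inner[OF x z] mult.assoc)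
qed

lemma mult_op_compose:
  fixes f :: "'a::euclidean_space \<Rightarrow> complex"
  assumes dim: "DIM('a) \<ge> 3" and m: "admissible TYPE('a) m" and m': "admissible TYPE('a) m'"
    and f: "integrable surface_measure f" and x: "norm x = 1"
  shows "zonal_conv (mult_kernel TYPE('a) m) (zonal_conv (mult_kernel TYPE('a) m') f) x =
      zonal_conv (mult_kernel TYPE('a) (\<lambda>k. m k * m' k)) f x"
proof -
  define K where "K = mult_kernel TYPE('a) m"
  define K' where "K' = mult_kernel TYPE('a) m'"
  have Kc: "continuous_on UNIV K" and Kc': "continuous_on UNIV K'"
    unfolding K_def K'_def by (intro mult_kernel_continuous dim m m')+
  have [measurable]: "K \<in> borel_measurable borel" "K' \<in> borel_measurable borel"
    by (auto intro: borel_measurable_continuous_onI Kc Kc')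
  obtain B where B: "B \<ge> 0" "\<And>x y :: 'a. norm x = 1 \<Longrightarrow> norm y = 1 \<Longrightarrow> \<bar>K (x \<bullet> y)\<bar> \<le> B"
    using zonal_kernel_bounded[OF Kc] by metis
  obtain B' where B': "B' \<ge> 0" "\<And>x y :: 'a. norm x = 1 \<Longrightarrow> norm y = 1 \<Longrightarrow> \<bar>K' (x \<bullet> y)\<bar> \<le> B'"
    using zonal_kernel_bounded[OF Kc'] by metis
  have "(LINT y|surface_measure. LINT w|surface_measure. (K (x \<bullet> y) * K' (y \<bullet> w)) *\<^sub>R f w) =
      (LINT w|surface_measure. (LINT y|surface_measure. K (x \<bullet> y) * K' (y \<bullet> w)) *\<^sub>R f w)"
  proof (rule surface_fubini(2)[OF _ _ f])
    show "(\<lambda>(y, w). K (x \<bullet> y) * K' (y \<bullet> w)) \<in> borel_measurable (surface_measure \<Otimes>\<^sub>M surface_measure)"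
      by measurable
    show "\<bar>K (x \<bullet> y) * K' (y \<bullet> w)\<bar> \<le> B * B'" if "norm y = 1" "norm w = 1" for y w
      unfolding abs_mult using B B' that x by (intro mult_mono) auto
  qed
  moreover have "zonal_conv K (zonal_conv K' f) x =
      (LINT y|surface_measure. LINT w|surface_measure. (K (x \<bullet> y) * K' (y \<bullet> w)) *\<^sub>R f w)"
    unfolding zonal_conv_def by (simp flip: scaleR_scaleR)
  moreover have "(LINT w|surface_measure. (LINT y|surface_measure. K (x \<bullet> y) * K' (y \<bullet> w)) *\<^sub>R f w) =
      zonal_conv (mult_kernel TYPE('a) (\<lambda>k. m k * m' k)) f x"
    unfolding zonal_conv_def K_def K'_def
    by (intro Bochner_Integration.integral_cong refl) (simp add: mult_kernel_compose[OF dim m m' x])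
  ultimately show ?thesis by (simp add: K_def K'_def)
qed

text \<open>The constants agree because the area is DIM times the volume of the unit ball, and two
  steps of the Gamma recursion turn this into \<open>2 pi^(l + 1) / (l Gamma(l))\<close>.\<close>

lemma harmonic_proj_eq:
  fixes f :: "'a::euclidean_space \<Rightarrow> complex"
  assumes dim: "DIM('a) \<ge> 3"
  shows "harmonic_proj k f x =
      (1 / sphere_area TYPE('a)) *\<^sub>R (LINT y|surface_measure. zonal TYPE('a) k (x \<bullet> y) *\<^sub>R f y)"
proof -
  let ?l = "sphere_index TYPE('a)"
  note l = sphere_index_DIM[OF dim]
  have half: "real DIM('a) / 2 = ?l + 1" using l by linarith
  have G: "Gamma (?l + 1) = ?l * Gamma ?l"
    using l(1) by (intro Gamma_plus1) (auto elim: nonpos_Ints_cases)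
  have G2: "Gamma (?l + 1 + 1) = (?l + 1) * Gamma (?l + 1)"
    using l(1) by (intro Gamma_plus1) (auto elim: nonpos_Ints_cases)
  have Gp: "Gamma ?l > 0" using l(1) by (rule Gamma_real_pos)
  have area: "sphere_area TYPE('a) = 2 * pi powr (?l + 1) / (?l * Gamma ?l)"
  proof -
    have "sphere_area TYPE('a) = real DIM('a) * (pi powr (?l + 1) / Gamma (?l + 1 + 1))"
      by (simp add: sphere_area_eq unit_ball_vol_def half)
    also have "real DIM('a) = 2 * (?l + 1)" using l(2) by (simp add: algebra_simps)
    also have "2 * (?l + 1) * (pi powr (?l + 1) / Gamma (?l + 1 + 1)) =
        (2 * (?l + 1)) * (pi powr (?l + 1) / ((?l + 1) * (?l * Gamma ?l)))"
      unfolding G2 G ..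
    also have "\<dots> = 2 * pi powr (?l + 1) / (?l * Gamma ?l)"
    proof -
      have e: "2 * a * (P / (a * g)) = 2 * P / g" if "a \<noteq> 0" for a P g :: real
        using that by simp
      show ?thesis by (rule e) (use l(1) in simp)
    qed
    finally show ?thesis .
  qed
  have c: "Gamma ?l * (real k + ?l) / (2 * pi powr (?l + 1)) = 1 / sphere_area TYPE('a) * ((real k + ?l) / ?l)"
    unfolding area using l(1) Gp by (simp add: field_simps)
  have "harmonic_proj k f x = (1 / sphere_area TYPE('a)) *\<^sub>R
      (((real k + ?l) / ?l) *\<^sub>R (LINT y|surface_measure. gegenbauer ?l k (x \<bullet> y) *\<^sub>R f y))"
    unfolding harmonic_proj_def Let_def c by (simp only: scaleR_scaleR)
  also have "((real k + ?l) / ?l) *\<^sub>R (LINT y|surface_measure. gegenbauer ?l k (x \<bullet> y) *\<^sub>R f y) =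
      (LINT y|surface_measure. zonal TYPE('a) k (x \<bullet> y) *\<^sub>R f y)"
    unfolding zonal_def zonal_coeff_def scaleR_scaleR[symmetric] by (rule integral_scaleR_right[symmetric])
  finally show ?thesis .
qed

text \<open>Partial sums are operators with finitely supported multipliers, so the remainder of a
  series is again a multiplier operator to which the norm bounds apply.\<close>

lemma partial_sum_eq_mult_op:
  fixes f :: "'a::euclidean_space \<Rightarrow> complex"
  assumes dim: "DIM('a) \<ge> 3" and f: "integrable surface_measure f" and x: "norm x = 1"
  shows "(\<Sum>k<K. c k *\<^sub>R harmonic_proj k f x) =
      zonal_conv (mult_kernel TYPE('a) (\<lambda>k. if k < K then c k else 0)) f x"
proof -
  have zi: "integrable surface_measure (\<lambda>y. zonal TYPE('a) k (x \<bullet> y) *\<^sub>R f y)" for k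
    by (rule zonal_integrable[OF zonal_continuous f x])
  have ker: "mult_kernel TYPE('a) (\<lambda>k. if k < K then c k else 0) (x \<bullet> y) =
      (\<Sum>k<K. (c k / sphere_area TYPE('a)) * zonal TYPE('a) k (x \<bullet> y))" if "norm y = 1" for y
  proof -
    have "(\<Sum>k. (if k < K then c k else 0) * zonal TYPE('a) k (x \<bullet> y)) =
        (\<Sum>k<K. (if k < K then c k else 0) * zonal TYPE('a) k (x \<bullet> y))"
      by (rule suminf_finite) auto
    then show ?thesis
      by (simp add: mult_kernel_def clamp1_inner[OF x that] sum_divide_distrib)
  qed
  have "zonal_conv (mult_kernel TYPE('a) (\<lambda>k. if k < K then c k else 0)) f x =
      (LINT y|surface_measure. (\<Sum>k<K. (c k / sphere_area TYPE('a)) *\<^sub>R (zonal TYPE('a) k (x \<bullet> y) *\<^sub>R f y)))"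
    unfolding zonal_conv_def
    by (intro Bochner_Integration.integral_cong refl) (simp add: ker scaleR_sum_left)
  also have "\<dots> = (\<Sum>k<K. (c k / sphere_area TYPE('a)) *\<^sub>R (LINT y|surface_measure. zonal TYPE('a) k (x \<bullet> y) *\<^sub>R f y))"
    by (subst Bochner_Integration.integral_sum) (simp_all only: integrable_scaleR_right zi integral_scaleR_right)
  also have "\<dots> = (\<Sum>k<K. c k *\<^sub>R harmonic_proj k f x)"
    by (intro sum.cong refl) (simp only: harmonic_proj_eq[OF dim] scaleR_scaleR times_divide_eq_right mult_1_right)
  finally show ?thesis ..
qed

text \<open>The kernel is bounded by its absolute series divided by the area, and integration over
  the sphere cancels the area. The bound is meant for remainders, whose absolute series become
  small.\<close>

lemma mult_op_norm_trivial:
  fixes f :: "'a::euclidean_space \<Rightarrow> complex"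
  assumes dim: "DIM('a) \<ge> 3" and X: "valid_space X" and m: "admissible TYPE('a) m" and f: "f \<in> fs_carrier X"
  shows "fs_norm X (zonal_conv (mult_kernel TYPE('a) m) f) \<le> (\<Sum>k. \<bar>m k\<bar> * zonal_bound TYPE('a) k) * fs_norm X f"
proof (rule zonal_conv_norm[OF X mult_kernel_continuous[OF dim m] f])
  fix x :: 'a assume x: "norm x = 1"
  let ?S = "\<Sum>k. \<bar>m k\<bar> * zonal_bound TYPE('a) k"
  have "(LINT y|surface_measure. \<bar>mult_kernel TYPE('a) m (x \<bullet> y)\<bar>) \<le>
      (LINT y|(surface_measure :: 'a measure). ?S / sphere_area TYPE('a))"
    by (intro integral_mono integrable_abs zonal_kernel_integrable mult_kernel_continuous
        abs_mult_kernel_le dim m) simp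
  also have "\<dots> = ?S" using sphere_area_pos[where 'a = 'a] by (simp add: sphere_area_def)
  finally show "(LINT y|surface_measure. \<bar>mult_kernel TYPE('a) m (x \<bullet> y)\<bar>) \<le> ?S" .
qed

text \<open>A nonnegative kernel is its own absolute value, so its mass \<open>m 0\<close> bounds
  the operator; with \<open>m 0 = 1\<close> this is contractivity.\<close>

lemma mult_op_norm_positive:
  fixes f :: "'a::euclidean_space \<Rightarrow> complex"
  assumes dim: "DIM('a) \<ge> 3" and X: "valid_space X" and m: "admissible TYPE('a) m" and f: "f \<in> fs_carrier X"
    and pos: "\<And>u. mult_kernel TYPE('a) m u \<ge> 0"
  shows "fs_norm X (zonal_conv (mult_kernel TYPE('a) m) f) \<le> m 0 * fs_norm X f"
  by (rule zonal_conv_norm[OF X mult_kernel_continuous[OF dim m] f])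
     (simp add: pos mult_kernel_total[OF dim m])

text \<open>Summation by parts rewrites the kernel through the nonnegative Cesaro kernels, whose
  \<open>L\<^sup>1\<close> norms are their zeroth coefficients.\<close>

lemma mult_op_norm_differences:
  fixes f :: "'a::euclidean_space \<Rightarrow> complex"
  assumes dim: "DIM('a) \<ge> 3" and X: "valid_space X" and m: "rapid m" and f: "f \<in> fs_carrier X"
    and C: "\<And>K. (\<Sum>k<K. (real k + 1) ^ DIM('a) * \<bar>(fdiff ^^ Suc DIM('a)) m k\<bar>) \<le> C"
  shows "fs_norm X (zonal_conv (mult_kernel TYPE('a) m) f) \<le> C * fs_norm X f"
proof -
  \<comment> \<open>The Cesaro kernels of order DIM are nonnegative, and forming them takes DIM + 1
    partial summations.\<close>
  define J where "J = Suc DIM('a)"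
  define d where "d = (fdiff ^^ J) m"
  define A where "A = fps_nth (geometric_fps ^ J)"
  define S where "S u = fps_nth (geometric_fps ^ J * Abs_fps (\<lambda>k. zonal TYPE('a) k u))" for u
  have adm: "admissible TYPE('a) m" by (rule rapid_admissible[OF dim m])
  have rd: "rapid d" unfolding d_def by (rule rapid_iterated_fdiff[OF m])
  have a0: "sphere_area TYPE('a) > 0" by (rule sphere_area_pos)
  have A0: "A k \<ge> 0" for k unfolding A_def J_def by (intro less_imp_le geometric_power_nth_pos) simp
  have AC: "(\<Sum>k<K. A k * \<bar>d k\<bar>) \<le> C" for K
  proof -
    have "(\<Sum>k<K. A k * \<bar>d k\<bar>) \<le> (\<Sum>k<K. (real k + 1) ^ DIM('a) * \<bar>d k\<bar>)"
      unfolding A_def J_def by (intro sum_mono mult_right_mono geometric_power_nth_le) auto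
    also have "\<dots> \<le> C" unfolding d_def J_def by (rule C)
    finally show ?thesis .
  qed
  have S0: "S (clamp1 u) k \<ge> 0" for u k
    unfolding S_def J_def by (rule cesaro_kernel_nonneg[OF dim clamp1_le])
  have S_eq: "S u i = (\<Sum>j\<le>i. A (i - j) * zonal TYPE('a) j u)" for u i
    unfolding S_def A_def J_def by (rule cesaro_kernel_eq[OF dim])
  have zg: "poly_growth (fps_nth (Abs_fps (\<lambda>k. zonal TYPE('a) k (clamp1 u))))" for u
    using abs_zonal_le[OF dim clamp1_le] by (intro poly_growth_mono[OF poly_growth_zonal_bound[OF dim]]) simp
  have Sg: "poly_growth (S (clamp1 u))" for u
    unfolding S_def by (rule poly_growth_geometric_power_mult[OF zg])
  have ker: "mult_kernel TYPE('a) m u = (\<Sum>k. d k * S (clamp1 u) k) / sphere_area TYPE('a)" for u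
    unfolding mult_kernel_def d_def S_def
    using summation_by_parts[OF m zg[of u], of J] by simp
  have sm: "summable (\<lambda>k. \<bar>d k\<bar> * S (clamp1 u) k)" for u
    using rapid_summable[OF rd Sg[of u]] S0 by (simp add: abs_mult)
  have ker_le: "\<bar>mult_kernel TYPE('a) m u\<bar> \<le> (\<Sum>k. \<bar>d k\<bar> * S (clamp1 u) k) / sphere_area TYPE('a)" for u
  proof -
    have "\<bar>\<Sum>k. d k * S (clamp1 u) k\<bar> \<le> (\<Sum>k. \<bar>d k * S (clamp1 u) k\<bar>)"
      by (intro summable_rabs rapid_summable rd Sg)
    also have "\<dots> = (\<Sum>k. \<bar>d k\<bar> * S (clamp1 u) k)" using S0 by (simp add: abs_mult)
    finally show ?thesis unfolding ker using a0 by (simp add: divide_right_mono)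
  qed
  show ?thesis
  proof (rule zonal_conv_norm[OF X mult_kernel_continuous[OF dim adm] f])
    fix x :: 'a assume x: "norm x = 1"
    have zi: "integrable surface_measure (\<lambda>y. zonal TYPE('a) j (x \<bullet> y))" for j
      by (rule zonal_inner_integrable)
    define F where "F k y = \<bar>d k\<bar> * S (clamp1 (x \<bullet> y)) k" for k and y :: 'a
    have F0: "F k y \<ge> 0" for k y using S0 by (simp add: F_def)
    \<comment> \<open>Of the Cesaro kernel only the degree zero has a nonzero integral, and its
      coefficient is the Cesaro number \<open>A k\<close>.\<close>
    have SI: "integrable surface_measure (\<lambda>y. S (clamp1 (x \<bullet> y)) k)"
      "(LINT y|surface_measure. S (clamp1 (x \<bullet> y)) k) = A k * sphere_area TYPE('a)" for k
    proof -
      have i: "integrable surface_measure (\<lambda>y. \<Sum>j\<le>k. A (k - j) * zonal TYPE('a) j (x \<bullet> y))"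
        by (intro Bochner_Integration.integrable_sum integrable_mult_right zi)
      have e: "S (clamp1 (x \<bullet> y)) k = (\<Sum>j\<le>k. A (k - j) * zonal TYPE('a) j (x \<bullet> y))"
        if "y \<in> space surface_measure" for y
        using that x by (simp add: S_eq clamp1_inner)
      show "integrable surface_measure (\<lambda>y. S (clamp1 (x \<bullet> y)) k)"
        using i by (subst Bochner_Integration.integrable_cong[OF refl e])
      have "(LINT y|surface_measure. S (clamp1 (x \<bullet> y)) k) =
          (LINT y|surface_measure. (\<Sum>j\<le>k. A (k - j) * zonal TYPE('a) j (x \<bullet> y)))"
        by (rule Bochner_Integration.integral_cong[OF refl e])
      also have "\<dots> = (\<Sum>j\<le>k. A (k - j) * (if j = 0 then sphere_area TYPE('a) else 0))"
        using zi by (subst Bochner_Integration.integral_sum) (auto simp: zonal_integral[OF dim x])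
      also have "\<dots> = A k * sphere_area TYPE('a)"
        by (subst sum.mono_neutral_right[of _ "{0}"]) auto
      finally show "(LINT y|surface_measure. S (clamp1 (x \<bullet> y)) k) = A k * sphere_area TYPE('a)" .
    qed
    have Fi: "integrable surface_measure (F k)" for k
      unfolding F_def by (intro integrable_mult_right SI)
    have FI: "(LINT y|surface_measure. F k y) = A k * \<bar>d k\<bar> * sphere_area TYPE('a)" for k
      unfolding F_def integral_mult_right_zero SI by (simp add: mult_ac)
    have nF: "norm (F k y) = F k y" for k y using F0 by simp
    have s1: "summable (\<lambda>k. A k * \<bar>d k\<bar>)"
      using AC A0 by (intro summableI_nonneg_bounded[where x = C]) auto
    have sF: "summable (\<lambda>k. LINT y|surface_measure. norm (F k y))"
      unfolding nF FI by (rule summable_mult2[OF s1])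
    have aF: "AE y in surface_measure. summable (\<lambda>k. norm (F k y))"
      unfolding nF unfolding F_def by (intro AE_I2 sm)
    note sums = integrable_suminf[OF Fi aF sF] integral_suminf[OF Fi aF sF]
    have "(LINT y|surface_measure. \<bar>mult_kernel TYPE('a) m (x \<bullet> y)\<bar>) \<le>
        (LINT y|surface_measure. (\<Sum>k. F k y) / sphere_area TYPE('a))"
    proof (rule integral_mono)
      show "integrable surface_measure (\<lambda>y. \<bar>mult_kernel TYPE('a) m (x \<bullet> y)\<bar>)"
        by (intro integrable_abs zonal_kernel_integrable mult_kernel_continuous dim adm)
      show "integrable surface_measure (\<lambda>y. (\<Sum>k. F k y) / sphere_area TYPE('a))"
        using sums(1) by simp
      show "\<bar>mult_kernel TYPE('a) m (x \<bullet> y)\<bar> \<le> (\<Sum>k. F k y) / sphere_area TYPE('a)" for y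
        unfolding F_def by (rule ker_le)
    qed
    also have "\<dots> = (\<Sum>k. A k * \<bar>d k\<bar> * sphere_area TYPE('a)) / sphere_area TYPE('a)"
      by (simp add: sums(2) FI)
    also have "\<dots> = (\<Sum>k. A k * \<bar>d k\<bar>)"
      unfolding suminf_mult2[OF s1, symmetric] using a0 by simp
    also have "\<dots> \<le> C" by (rule suminf_le_const[OF s1 AC])
    finally show "(LINT y|surface_measure. \<bar>mult_kernel TYPE('a) m (x \<bullet> y)\<bar>) \<le> C" .
  qed
qed

section \<open>The exponential-type semigroup\<close>

lemma fs_same_sphere:
  assumes "\<And>x. norm x = 1 \<Longrightarrow> f x = g x"
  shows "fs_same X f g"
  using assms by (auto simp: fs_same_def intro!: AE_I2)

lemma zonal_conv_add:
  fixes f g :: "'a::euclidean_space \<Rightarrow> complex"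
  assumes K: "continuous_on UNIV K" and f: "integrable surface_measure f" and g: "integrable surface_measure g"
    and x: "norm x = 1"
  shows "zonal_conv K (\<lambda>y. f y + g y) x = zonal_conv K f x + zonal_conv K g x"
  using zonal_integrable[OF K f x] zonal_integrable[OF K g x]
  by (simp add: zonal_conv_def scaleR_add_right)

lemma zonal_conv_mult: "zonal_conv K (\<lambda>y. c * f y) x = c * zonal_conv K f x"
  by (simp add: zonal_conv_def flip: mult_scaleR_right)

lemma mult_op_diff:
  fixes f :: "'a::euclidean_space \<Rightarrow> complex"
  assumes dim: "DIM('a) \<ge> 3" and m: "admissible TYPE('a) m" and m': "admissible TYPE('a) m'"
    and f: "integrable surface_measure f" and x: "norm x = 1"
  shows "zonal_conv (mult_kernel TYPE('a) (\<lambda>k. m k - m' k)) f x =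
      zonal_conv (mult_kernel TYPE('a) m) f x - zonal_conv (mult_kernel TYPE('a) m') f x"
  using zonal_integrable[OF mult_kernel_continuous[OF dim m] f x]
    zonal_integrable[OF mult_kernel_continuous[OF dim m'] f x]
  by (simp add: zonal_conv_def mult_kernel_diff[OF dim m m'] scaleR_diff_left)

lemma mult_op_cmult:
  fixes f :: "'a::euclidean_space \<Rightarrow> complex"
  assumes dim: "DIM('a) \<ge> 3" and m: "admissible TYPE('a) m"
  shows "zonal_conv (mult_kernel TYPE('a) (\<lambda>k. c * m k)) f x = c *\<^sub>R zonal_conv (mult_kernel TYPE('a) m) f x"
  by (simp add: zonal_conv_def mult_kernel_cmult[OF dim m] flip: scaleR_scaleR)

text \<open>The remainder is the operator whose multiplier is the tail of m, and the trivial norm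
  bound for it is the tail of a convergent series.\<close>

lemma multiplier_series_tendsto:
  fixes f :: "'a::euclidean_space \<Rightarrow> complex"
  assumes dim: "DIM('a) \<ge> 3" and X: "valid_space X" and m: "admissible TYPE('a) m" and f: "f \<in> fs_carrier X"
  shows "fs_tendsto X (\<lambda>K x. \<Sum>k<K. m k *\<^sub>R harmonic_proj k f x) (zonal_conv (mult_kernel TYPE('a) m) f) sequentially"
proof -
  define t where "t K k = (if k < K then m k else 0)" for K k
  define a where "a k = \<bar>m k\<bar> * zonal_bound TYPE('a) k" for k
  have fi: "integrable surface_measure f" by (rule carrier_integrable[OF X f])
  have at: "admissible TYPE('a) (t K)" for K by (rule finite_admissible[of K]) (simp add: t_def)
  have partial: "(\<Sum>k<K. m k *\<^sub>R harmonic_proj k f x) = zonal_conv (mult_kernel TYPE('a) (t K)) f x"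
    if "norm x = 1" for K x
    unfolding t_def by (rule partial_sum_eq_mult_op[OF dim fi that])
  have car: "(\<lambda>x. \<Sum>k<K. m k *\<^sub>R harmonic_proj k f x) \<in> fs_carrier X" for K
  proof (rule carrier_continuous[OF X])
    have "continuous_on (sphere 0 1) (zonal_conv (mult_kernel TYPE('a) (t K)) f)"
      by (rule zonal_conv_continuous[OF mult_kernel_continuous[OF dim at] fi])
    then show "continuous_on (sphere 0 1) (\<lambda>x. \<Sum>k<K. m k *\<^sub>R harmonic_proj k f x)"
      by (rule continuous_on_eq) (simp add: partial)
  qed
  have carm: "zonal_conv (mult_kernel TYPE('a) m) f \<in> fs_carrier X"
    by (rule zonal_conv_carrier[OF X mult_kernel_continuous[OF dim m] f])
  have sa: "summable a" using m by (simp add: admissible_def a_def[abs_def])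
  have le: "fs_norm X (\<lambda>x. (\<Sum>k<K. m k *\<^sub>R harmonic_proj k f x) - zonal_conv (mult_kernel TYPE('a) m) f x)
      \<le> (suminf a - (\<Sum>k<K. a k)) * fs_norm X f" for K
  proof -
    have ad: "admissible TYPE('a) (\<lambda>k. t K k - m k)" by (rule admissible_diff[OF dim at m])
    have "fs_norm X (\<lambda>x. (\<Sum>k<K. m k *\<^sub>R harmonic_proj k f x) - zonal_conv (mult_kernel TYPE('a) m) f x) =
        fs_norm X (zonal_conv (mult_kernel TYPE('a) (\<lambda>k. t K k - m k)) f)"
      by (intro fs_norm_same fs_same_sphere carrier_diff X car carm
          zonal_conv_carrier mult_kernel_continuous dim ad f)
        (simp add: partial mult_op_diff[OF dim at m fi])
    also have "\<dots> \<le> (\<Sum>k. \<bar>t K k - m k\<bar> * zonal_bound TYPE('a) k) * fs_norm X f"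
      by (rule mult_op_norm_trivial[OF dim X ad f])
    also have "(\<Sum>k. \<bar>t K k - m k\<bar> * zonal_bound TYPE('a) k) = (\<Sum>k. a k - (if k < K then a k else 0))"
      by (intro suminf_cong) (simp add: t_def a_def)
    also have "\<dots> = suminf a - (\<Sum>k<K. a k)"
    proof -
      have "(\<lambda>k. if k < K then a k else 0) sums (\<Sum>k<K. a k)"
        using sums_If_finite_set[of "{..<K}" a] by simp
      from sums_diff[OF summable_sums[OF sa] this] show ?thesis by (rule sums_unique[symmetric])
    qed
    finally show ?thesis .
  qed
  have "(\<lambda>K. (suminf a - (\<Sum>k<K. a k)) * fs_norm X f) \<longlonglongrightarrow> (suminf a - suminf a) * fs_norm X f"
    by (intro tendsto_intros summable_LIMSEQ sa)
  then have lim: "(\<lambda>K. (suminf a - (\<Sum>k<K. a k)) * fs_norm X f) \<longlonglongrightarrow> 0" by simp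
  have "(\<lambda>K. fs_norm X (\<lambda>x. (\<Sum>k<K. m k *\<^sub>R harmonic_proj k f x) - zonal_conv (mult_kernel TYPE('a) m) f x)) \<longlonglongrightarrow> 0"
    by (rule tendsto_sandwich[OF always_eventually always_eventually tendsto_const lim])
       (auto intro!: fs_norm_nonneg carrier_diff X car carm le simp del: fs_norm.simps)
  then show ?thesis
    unfolding fs_tendsto_def using car carm by (auto simp del: fs_norm.simps)
qed

text \<open>Replacing f by a nearby continuous g costs little before and, by contractivity, after
  applying the operators. For g Korovkin's argument gives uniform convergence on the sphere, and
  thus convergence in X.\<close>

lemma mult_op_strongly_continuous:
  fixes f :: "'a::euclidean_space \<Rightarrow> complex" and e :: "real \<Rightarrow> nat \<Rightarrow> real"
  assumes dim: "DIM('a) \<ge> 3" and X: "valid_space X" and f: "f \<in> fs_carrier X"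
    and adm: "\<And>t. t > 0 \<Longrightarrow> admissible TYPE('a) (e t)"
    and pos: "\<And>t u. t > 0 \<Longrightarrow> mult_kernel TYPE('a) (e t) u \<ge> 0"
    and e0: "\<And>t. e t 0 = 1" and e1: "((\<lambda>t. e t 1) \<longlongrightarrow> 1) (at_right 0)"
  shows "((\<lambda>t. fs_norm X (\<lambda>x. zonal_conv (mult_kernel TYPE('a) (e t)) f x - f x)) \<longlongrightarrow> 0) (at_right 0)"
proof (rule tendstoI)
  fix \<epsilon> :: real assume \<epsilon>: "\<epsilon> > 0"
  \<comment> \<open>Two applications of \<open>fs_norm_add\<close> with its factor 4 give
    \<open>4 * (\<eta> + 4 * (2 * \<eta> + \<eta>)) = 52 * \<eta>\<close>, which is below
    \<open>\<epsilon>\<close>.\<close>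
  define \<eta> where "\<eta> = \<epsilon> / 60"
  have \<eta>: "\<eta> > 0" using \<epsilon> by (simp add: \<eta>_def)
  let ?T = "\<lambda>t. zonal_conv (mult_kernel TYPE('a) (e t))"
  let ?a = "1 + sphere_area TYPE('a)"
  have a0: "?a > 0" using sphere_area_pos[where 'a = 'a] by simp
  obtain g where g: "continuous_on (sphere 0 1) g" "fs_norm X (\<lambda>x. f x - g x) < \<eta>"
    using carrier_continuous_dense[OF X f \<eta>] by blast
  have gc: "g \<in> fs_carrier X" by (rule carrier_continuous[OF X g(1)])
  have fi: "integrable surface_measure f" and gi: "integrable surface_measure g"
    by (rule carrier_integrable[OF X f], rule carrier_integrable[OF X gc])
  have fg: "(\<lambda>x. f x - g x) \<in> fs_carrier X" by (rule carrier_diff[OF X f gc])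
  define d where "d = \<eta> / ?a"
  have d: "d > 0" using \<eta> a0 by (simp add: d_def)
  from korovkin_bound[OF dim g(1) d] obtain C where C: "C \<ge> 0"
    "\<And>m x. admissible TYPE('a) m \<Longrightarrow> (\<And>u. mult_kernel TYPE('a) m u \<ge> 0) \<Longrightarrow> m 0 = 1 \<Longrightarrow>
      x \<in> sphere 0 1 \<Longrightarrow> norm (zonal_conv (mult_kernel TYPE('a) m) g x - g x) \<le> d + C * (1 - m 1)"
    by blast
  \<comment> \<open>C was fixed before t, so the multiplier of degree one alone decides how small t
    must be, for all points of the sphere at once.\<close>
  have "((\<lambda>t. d + C * (1 - e t 1)) \<longlongrightarrow> d + C * (1 - 1)) (at_right 0)"
    by (intro tendsto_intros e1)
  then have ev: "\<forall>\<^sub>F t in at_right 0. d + C * (1 - e t 1) < 2 * d"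
    by (rule order_tendstoD(2)) (use d in simp)
  have ev0: "\<forall>\<^sub>F t in at_right (0::real). t > 0"
    by (rule eventually_at_right_less)
  show "\<forall>\<^sub>F t in at_right 0. dist (fs_norm X (\<lambda>x. ?T t f x - f x)) 0 < \<epsilon>"
    using ev ev0
  proof eventually_elim
    case (elim t)
    have t: "t > 0" using elim by simp
    have Kc: "continuous_on UNIV (mult_kernel TYPE('a) (e t))"
      by (rule mult_kernel_continuous[OF dim adm[OF t]])
    have Tf: "?T t f \<in> fs_carrier X" and Tg: "?T t g \<in> fs_carrier X" and Tfg: "?T t (\<lambda>x. f x - g x) \<in> fs_carrier X"
      by (rule zonal_conv_carrier[OF X Kc], fact)+
    have diff: "?T t f x - ?T t g x = ?T t (\<lambda>x. f x - g x) x" if "norm x = 1" for x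
      using zonal_conv_add[OF Kc fi integrable_mult_right[OF gi, of "-1"] that]
        zonal_conv_mult[of "mult_kernel TYPE('a) (e t)" "-1" g x] by simp
    have n1: "fs_norm X (\<lambda>x. ?T t f x - ?T t g x) \<le> \<eta>"
    proof -
      have "fs_norm X (\<lambda>x. ?T t f x - ?T t g x) = fs_norm X (?T t (\<lambda>x. f x - g x))"
        by (intro fs_norm_same fs_same_sphere diff carrier_diff X Tf Tg Tfg)
      also have "\<dots> \<le> e t 0 * fs_norm X (\<lambda>x. f x - g x)"
        by (rule mult_op_norm_positive[OF dim X adm[OF t] fg pos[OF t]])
      finally show ?thesis using g(2) e0 by simp
    qed
    have n2: "fs_norm X (\<lambda>x. ?T t g x - g x) \<le> 2 * \<eta>"
    proof -
      have cont: "continuous_on (sphere 0 1) (\<lambda>x. ?T t g x - g x)"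
        by (intro continuous_intros zonal_conv_continuous[OF Kc gi] g(1))
      have "norm (?T t g x - g x) \<le> 2 * d" if "norm x = 1" for x
      proof -
        have "norm (?T t g x - g x) \<le> d + C * (1 - e t 1)"
          using that by (intro C(2) adm pos t e0) simp
        then show ?thesis using elim by linarith
      qed
      from fs_norm_le_sup[OF X cont this]
      have "fs_norm X (\<lambda>x. ?T t g x - g x) \<le> ?a * (2 * d)" .
      also have "\<dots> = 2 * \<eta>" using a0 by (simp add: d_def)
      finally show ?thesis .
    qed
    have n3: "fs_norm X (\<lambda>x. g x - f x) \<le> \<eta>"
      using g(2) by (subst fs_norm_minus_commute) simp
    have "fs_norm X (\<lambda>x. (?T t g x - g x) + (g x - f x)) \<le> 4 * (2 * \<eta> + \<eta>)"
      by (rule order.trans[OF fs_norm_add[OF X carrier_diff[OF X Tg gc] carrier_diff[OF X gc f]]])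
         (intro mult_left_mono add_mono n2 n3, simp)
    moreover have "fs_norm X (\<lambda>x. (?T t f x - ?T t g x) + ((?T t g x - g x) + (g x - f x))) \<le>
        4 * (fs_norm X (\<lambda>x. ?T t f x - ?T t g x) + fs_norm X (\<lambda>x. (?T t g x - g x) + (g x - f x)))"
      by (intro fs_norm_add X carrier_add carrier_diff Tf Tg gc f)
    moreover have "4 * (u + v) \<le> 52 * \<eta>" if "u \<le> \<eta>" "v \<le> 4 * (2 * \<eta> + \<eta>)" for u v
      using that unfolding distrib_left by linarith
    ultimately have "fs_norm X (\<lambda>x. (?T t f x - ?T t g x) + ((?T t g x - g x) + (g x - f x))) \<le> 52 * \<eta>"
      using n1 by (meson order.trans)
    then have "fs_norm X (\<lambda>x. ?T t f x - f x) < \<epsilon>"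
      using \<epsilon> by (simp add: \<eta>_def)
    moreover have "fs_norm X (\<lambda>x. ?T t f x - f x) \<ge> 0"
      by (intro fs_norm_nonneg carrier_diff X Tf f)
    ultimately show ?case by (simp add: dist_real_def)
  qed
qed

lemma exp_minus_quadratic:
  fixes y :: real
  assumes "y \<ge> 0"
  shows "\<bar>exp (- y) - 1 + y\<bar> \<le> y\<^sup>2"
proof -
  have "exp (- y) \<ge> 1 - y" using exp_ge_add_one_self[of "- y"] by simp
  moreover have "exp (- y) \<le> 1 / (1 + y)"
    using exp_ge_add_one_self[of y] assms by (simp add: exp_minus field_simps)
  moreover have "1 / (1 + y) \<le> 1 - y + y\<^sup>2"
  proof -
    have "(1 - y + y\<^sup>2) * (1 + y) = 1 + y ^ 3" by (simp add: power2_eq_square power3_eq_cube algebra_simps)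
    then show ?thesis using assms by (simp add: pos_divide_le_eq)
  qed
  ultimately show ?thesis by (simp add: abs_le_iff)
qed

section \<open>The semigroup and its generator\<close>

context
  fixes X :: fspace and p :: "real poly" and \<gamma> :: real and T :: "real \<Rightarrow> ('a::euclidean_space \<Rightarrow> complex) \<Rightarrow> 'a \<Rightarrow> complex"
    and \<phi> :: "nat \<Rightarrow> real" and e :: "real \<Rightarrow> nat \<Rightarrow> real"
    and C :: "real \<Rightarrow> ('a::euclidean_space \<Rightarrow> complex) \<Rightarrow> 'a \<Rightarrow> complex"
  assumes dim: "DIM('a) \<ge> 3" and X: "valid_space X" and \<gamma>: "0 < \<gamma>" "\<gamma> \<le> 1"
    and nonneg: "\<And>k::nat. poly p (real k) \<ge> 0" and reg: "regular_symbol p"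
    and positive: "\<And>t. t > 0 \<Longrightarrow> positive_kernel TYPE('a) p \<gamma> t"
  defines "T \<equiv> exp_mult_op X p \<gamma>"
    and "\<phi> \<equiv> \<lambda>k. poly p (real k) powr \<gamma>"
    and "e \<equiv> \<lambda>t k. exp (- (poly p (real k) powr \<gamma>) * t)"
    and "C \<equiv> \<lambda>t. zonal_conv (mult_kernel TYPE('a) (\<lambda>k. exp (- (poly p (real k) powr \<gamma>) * t)))"
begin

lemma exp_symbol_eq: "e t k = exp (- \<phi> k * t)" by (simp add: e_def \<phi>_def)

lemma kernel_op_eq: "C t = zonal_conv (mult_kernel TYPE('a) (e t))" by (simp add: C_def e_def)

lemma exp_symbol_is_rapid: "t > 0 \<Longrightarrow> rapid (e t)"
  unfolding e_def using reg \<gamma> nonneg by (intro exp_symbol_rapid) (auto simp: regular_symbol_def)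

lemma exp_symbol_admissible: "t > 0 \<Longrightarrow> admissible TYPE('a) (e t)"
  by (intro rapid_admissible dim exp_symbol_is_rapid)

text \<open>Here \<open>p(0) = 0\<close> enters, together with the value
  \<open>0 powr \<gamma> = 0\<close>. The kernels have mass one, which turns positivity into
  contractivity.\<close>

lemma exp_symbol_0: "e t 0 = 1"
  using reg by (simp add: e_def regular_symbol_def)

lemma symbol_poly_growth: "poly_growth \<phi>"
  unfolding \<phi>_def by (intro poly_growth_powr poly_growth_poly \<gamma> nonneg)

lemma symbol_nonneg: "\<phi> k \<ge> 0" by (simp add: \<phi>_def)

text \<open>Positivity is assumed at \<open>cos \<theta>\<close>; the arccosine of the clamped
  argument supplies the angle.\<close>

lemma exp_symbol_kernel_nonneg:
  assumes t: "t > 0"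
  shows "mult_kernel TYPE('a) (e t) u \<ge> 0"
proof -
  have "\<bar>clamp1 u\<bar> \<le> 1" by (rule clamp1_le)
  then have "exp_mult_kernel TYPE('a) p \<gamma> t (cos (arccos (clamp1 u))) \<ge> 0"
    using positive[OF t] arccos_lbound[of "clamp1 u"] arccos_ubound[of "clamp1 u"]
    unfolding positive_kernel_def abs_le_iff by (metis minus_le_iff)
  then have "exp_mult_kernel TYPE('a) p \<gamma> t (clamp1 u) \<ge> 0"
    using \<open>\<bar>clamp1 u\<bar> \<le> 1\<close> by (simp add: cos_arccos_abs)
  then show ?thesis
    by (simp add: exp_mult_kernel_def mult_kernel_def zonal_def zonal_coeff_def sphere_area_def e_def Let_def mult.assoc)
qed

lemma kernel_op_carrier: "t > 0 \<Longrightarrow> f \<in> fs_carrier X \<Longrightarrow> C t f \<in> fs_carrier X"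
  unfolding kernel_op_eq by (intro zonal_conv_carrier X mult_kernel_continuous dim exp_symbol_admissible)

text \<open>\<open>T t f\<close> is a chosen limit. This identifies it, up to the representative,
  with the explicit convolution \<open>C t f\<close>, so properties are proved for C and transferred
  to T.\<close>

lemma exp_mult_op_same:
  assumes t: "t > 0" and f: "f \<in> fs_carrier X"
  shows "T t f \<in> fs_carrier X" and "fs_same X (T t f) (C t f)"
proof -
  have "fs_tendsto X (\<lambda>K x. \<Sum>k<K. e t k *\<^sub>R harmonic_proj k f x) (C t f) sequentially"
    unfolding kernel_op_eq by (intro multiplier_series_tendsto dim X exp_symbol_admissible t f)
  moreover have "T t f = fs_lim X sequentially (\<lambda>K x. \<Sum>k<K. e t k *\<^sub>R harmonic_proj k f x)"
    using t by (simp add: T_def exp_mult_op_def e_def)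
  ultimately show "T t f \<in> fs_carrier X" "fs_same X (T t f) (C t f)"
    using fs_lim_same[OF X trivial_limit_sequentially] by auto
qed

lemma exp_mult_op_0: "T 0 f = f" by (simp add: T_def exp_mult_op_def)

lemma exp_mult_op_carrier: "t \<ge> 0 \<Longrightarrow> f \<in> fs_carrier X \<Longrightarrow> T t f \<in> fs_carrier X"
  using exp_mult_op_same(1)[of t f] exp_mult_op_0 by (cases "t = 0") auto

lemma kernel_op_norm_le:
  assumes t: "t > 0" and f: "f \<in> fs_carrier X"
  shows "fs_norm X (C t f) \<le> fs_norm X f"
  using mult_op_norm_positive[OF dim X exp_symbol_admissible[OF t] f exp_symbol_kernel_nonneg[OF t]] by (simp add: kernel_op_eq exp_symbol_0)

lemma exp_mult_op_norm_le:
  assumes t: "t \<ge> 0" and f: "f \<in> fs_carrier X"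
  shows "fs_norm X (T t f) \<le> fs_norm X f"
proof (cases "t = 0")
  case False
  then have t': "t > 0" using t by simp
  show ?thesis
    using fs_norm_same[OF exp_mult_op_same(2)[OF t' f] exp_mult_op_same(1)[OF t' f] kernel_op_carrier[OF t' f]] kernel_op_norm_le[OF t' f] by simp
qed (simp add: exp_mult_op_0)

lemma kernel_op_cong:
  assumes "t > 0" "f \<in> fs_carrier X" "g \<in> fs_carrier X" "fs_same X f g"
  shows "C t f x = C t g x"
  unfolding kernel_op_eq using assms by (intro zonal_conv_same[of _ _ X] mult_kernel_continuous dim exp_symbol_admissible)

lemma kernel_op_compose:
  assumes s: "s > 0" and t: "t > 0" and f: "f \<in> fs_carrier X" and x: "norm x = 1"
  shows "C s (C t f) x = C (s + t) f x"
proof -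
  have "(\<lambda>k. e s k * e t k) = e (s + t)"
    by (simp add: exp_symbol_eq exp_add[symmetric] fun_eq_iff algebra_simps)
  then show ?thesis
    unfolding kernel_op_eq using mult_op_compose[OF dim exp_symbol_admissible[OF s] exp_symbol_admissible[OF t] carrier_integrable[OF X f] x]
    by simp
qed

text \<open>The inner \<open>T t f\<close> is known only up to \<open>fs_same\<close>, but the outer
  convolution does not see the difference, so the multiplication of symbols applies.\<close>

lemma exp_mult_op_compose:
  assumes s: "s > 0" and t: "t > 0" and f: "f \<in> fs_carrier X"
  shows "fs_same X (T s (T t f)) (C (s + t) f)"
proof -
  have "fs_same X (T s (T t f)) (C s (T t f))"
    by (rule exp_mult_op_same(2)[OF s exp_mult_op_same(1)[OF t f]])
  moreover have "C s (T t f) x = C s (C t f) x" for x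
    by (intro kernel_op_cong s exp_mult_op_same t f kernel_op_carrier)
  then have "fs_same X (C s (T t f)) (C (s + t) f)"
    using kernel_op_compose[OF s t f] by (intro fs_same_sphere) simp
  ultimately show ?thesis by (rule fs_same_trans)
qed

lemma exp_mult_op_bounded_linear:
  assumes t: "t \<ge> 0"
  shows "fs_bounded_linear X (T t)"
proof (cases "t = 0")
  case True
  have "fs_eq X h h" for h :: "'a \<Rightarrow> complex"
    using fs_norm_zero[OF X, where 'a = 'a] by (simp add: fs_eq_def)
  then show ?thesis
    unfolding fs_bounded_linear_def using True by (auto simp: exp_mult_op_0 simp del: fs_norm.simps intro: exI[of _ 1])
next
  case False
  then have t': "t > 0" using t by simp
  have Kc: "continuous_on UNIV (mult_kernel TYPE('a) (e t))"
    by (rule mult_kernel_continuous[OF dim exp_symbol_admissible[OF t']])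
  show ?thesis unfolding fs_bounded_linear_def
  proof (intro conjI ballI allI)
    show "T t f \<in> fs_carrier X" if "f \<in> fs_carrier X" for f
      using that by (rule exp_mult_op_same(1)[OF t'])
    show "fs_eq X (T t (\<lambda>x. f x + g x)) (\<lambda>x. T t f x + T t g x)"
      if f: "f \<in> fs_carrier X" and g: "g \<in> fs_carrier X" for f g
    proof -
      have fg: "(\<lambda>x. f x + g x) \<in> fs_carrier X" by (rule carrier_add[OF X f g])
      have "fs_same X (T t (\<lambda>x. f x + g x)) (C t (\<lambda>x. f x + g x))" by (rule exp_mult_op_same(2)[OF t' fg])
      moreover have "fs_same X (C t (\<lambda>x. f x + g x)) (\<lambda>x. C t f x + C t g x)"
        unfolding kernel_op_eq by (intro fs_same_sphere zonal_conv_add Kc carrier_integrable[OF X] f g)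
      moreover have "fs_same X (\<lambda>x. C t f x + C t g x) (\<lambda>x. T t f x + T t g x)"
        using fs_same_comb[OF fs_same_sym[OF exp_mult_op_same(2)[OF t' f]] fs_same_sym[OF exp_mult_op_same(2)[OF t' g]], of "(+)"] .
      ultimately have "fs_same X (T t (\<lambda>x. f x + g x)) (\<lambda>x. T t f x + T t g x)"
        by (meson fs_same_trans)
      then show ?thesis
        by (subst fs_eq_iff_same[OF X]) (auto intro: carrier_add X exp_mult_op_same(1)[OF t'] f g fg)
    qed
    show "fs_eq X (T t (\<lambda>x. c * f x)) (\<lambda>x. c * T t f x)" if f: "f \<in> fs_carrier X" for c f
    proof -
      have cf: "(\<lambda>x. c * f x) \<in> fs_carrier X" by (rule carrier_mult[OF f])
      have "fs_same X (T t (\<lambda>x. c * f x)) (C t (\<lambda>x. c * f x))" by (rule exp_mult_op_same(2)[OF t' cf])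
      moreover have "C t (\<lambda>x. c * f x) = (\<lambda>x. c * C t f x)"
        by (simp add: kernel_op_eq zonal_conv_mult fun_eq_iff)
      moreover have "fs_same X (\<lambda>x. c * C t f x) (\<lambda>x. c * T t f x)"
        using fs_same_comb[OF fs_same_sym[OF exp_mult_op_same(2)[OF t' f]] fs_same_refl, of "\<lambda>a b. c * a"] .
      ultimately have "fs_same X (T t (\<lambda>x. c * f x)) (\<lambda>x. c * T t f x)"
        using fs_same_trans by metis
      then show ?thesis
        by (subst fs_eq_iff_same[OF X]) (auto intro: carrier_mult exp_mult_op_same(1)[OF t'] f cf)
    qed
    show "\<exists>B. \<forall>f\<in>fs_carrier X. fs_norm X (T t f) \<le> B * fs_norm X f"
      using exp_mult_op_norm_le[OF t] by (intro exI[of _ 1]) (simp del: fs_norm.simps)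
  qed
qed

lemma exp_mult_op_semigroup:
  assumes s: "s \<ge> 0" and t: "t \<ge> 0" and f: "f \<in> fs_carrier X"
  shows "fs_eq X (T (s + t) f) (T s (T t f))"
proof -
  have refl: "fs_eq X h h" for h :: "'a \<Rightarrow> complex"
    using fs_norm_zero[OF X, where 'a = 'a] by (simp add: fs_eq_def)
  show ?thesis
  \<comment> \<open>\<open>T 0\<close> is the identity and not the convolution with one of the
    kernels, so zero times are separate.\<close>
  proof (cases "s = 0 \<or> t = 0")
    case True
    then show ?thesis using refl by (auto simp: exp_mult_op_0)
  next
    case False
    then have s': "s > 0" and t': "t > 0" using s t by auto
    have "fs_same X (T (s + t) f) (T s (T t f))"
      using fs_same_trans[OF exp_mult_op_same(2)[of "s + t" f] fs_same_sym[OF exp_mult_op_compose[OF s' t' f]]] s' t' f by simp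
    then show ?thesis
      by (subst fs_eq_iff_same[OF X]) (auto intro!: exp_mult_op_carrier s t f add_nonneg_nonneg)
  qed
qed

lemma exp_mult_op_strongly_continuous:
  assumes f: "f \<in> fs_carrier X"
  shows "fs_tendsto X (\<lambda>t. T t f) f (at_right 0)"
  unfolding fs_tendsto_def
proof (intro conjI f)
  have ev0: "\<forall>\<^sub>F t in at_right (0::real). t > 0" by (rule eventually_at_right_less)
  show "\<forall>\<^sub>F t in at_right 0. T t f \<in> fs_carrier X"
    using ev0 by eventually_elim (rule exp_mult_op_same(1)[OF _ f])
  have "((\<lambda>t. e t 1) \<longlongrightarrow> exp (- \<phi> 1 * 0)) (at_right 0)"
    unfolding exp_symbol_eq by (intro tendsto_intros)
  then have "((\<lambda>t. fs_norm X (\<lambda>x. C t f x - f x)) \<longlongrightarrow> 0) (at_right 0)"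
    unfolding kernel_op_eq by (intro mult_op_strongly_continuous dim X f exp_symbol_admissible exp_symbol_kernel_nonneg exp_symbol_0) simp_all
  moreover have "\<forall>\<^sub>F t in at_right 0. fs_norm X (\<lambda>x. C t f x - f x) = fs_norm X (\<lambda>x. T t f x - f x)"
    using ev0
  proof eventually_elim
    case (elim t)
    show ?case
      by (intro fs_norm_same fs_same_comb[of X _ _ _ _ "(-)"] fs_same_refl fs_same_sym[OF exp_mult_op_same(2)[OF elim f]]
          carrier_diff X kernel_op_carrier exp_mult_op_same(1) elim f)
  qed
  ultimately show "((\<lambda>t. fs_norm X (\<lambda>x. T t f x - f x)) \<longlongrightarrow> 0) (at_right 0)"
    by (rule Lim_transform_eventually)
qed

lemma exp_mult_op_C0_semigroup: "C0_semigroup X T"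
  unfolding C0_semigroup_def
  using exp_mult_op_bounded_linear exp_mult_op_semigroup exp_mult_op_strongly_continuous fs_norm_zero[OF X, where 'a = 'a]
  by (simp add: fs_eq_def exp_mult_op_0 del: fs_norm.simps)

text \<open>The derivative of \<open>e t k\<close> in t, hence the multiplier expected for the
  generator composed with \<open>T t\<close>.\<close>

definition generator_mult :: "real \<Rightarrow> nat \<Rightarrow> real" where
  "generator_mult t k = - \<phi> k * e t k"

lemma generator_mult_rapid: "t > 0 \<Longrightarrow> rapid (generator_mult t)"
  using rapid_mult_poly_growth[OF exp_symbol_is_rapid symbol_poly_growth]
  by (simp add: generator_mult_def[abs_def] rapid_def abs_mult mult.commute)

text \<open>The multiplier of the difference quotient differs from its limit by a Taylor remainder
  of at most \<open>h * (\<phi> k)^2 * e t k\<close>. Since \<open>e t\<close> decays rapidly for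
  fixed t > 0, the trivial norm bound is a finite multiple of h, for every f in the space.\<close>

lemma generator_tendsto:
  assumes t: "t > 0" and f: "f \<in> fs_carrier X"
  shows "fs_tendsto X (diff_quotient T (T t f)) (zonal_conv (mult_kernel TYPE('a) (generator_mult t)) f) (at_right 0)"
proof -
  define G where "G = zonal_conv (mult_kernel TYPE('a) (generator_mult t)) f"
  have ag: "admissible TYPE('a) (generator_mult t)" by (rule rapid_admissible[OF dim generator_mult_rapid[OF t]])
  have Gc: "G \<in> fs_carrier X"
    unfolding G_def by (intro zonal_conv_carrier X mult_kernel_continuous dim ag f)
  have fi: "integrable surface_measure f" by (rule carrier_integrable[OF X f])
  have Tc: "T t f \<in> fs_carrier X" by (rule exp_mult_op_same(1)[OF t f])
  \<comment> \<open>The absolute series of the Taylor remainders without the factor h; it depends on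
    t, which is fixed here.\<close>
  define D where "D = (\<Sum>k. ((\<phi> k)\<^sup>2 * e t k) * zonal_bound TYPE('a) k)"
  have pg: "poly_growth (\<lambda>k. (\<phi> k)\<^sup>2 * zonal_bound TYPE('a) k)"
    unfolding power2_eq_square by (intro poly_growth_mult symbol_poly_growth poly_growth_zonal_bound dim)
  have zb0: "zonal_bound TYPE('a) k \<ge> 0" for k by (rule zonal_bound_nonneg[OF dim])
  have e0: "e t k > 0" for t k by (simp add: exp_symbol_eq)
  have sD: "summable (\<lambda>k. ((\<phi> k)\<^sup>2 * e t k) * zonal_bound TYPE('a) k)"
    using rapid_summable[OF exp_symbol_is_rapid[OF t] pg] zb0 e0[of t] by (simp add: abs_mult mult_ac abs_of_pos)
  have dqc: "diff_quotient T (T t f) h \<in> fs_carrier X" if h: "h > 0" for h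
    unfolding diff_quotient_def[abs_def]
    by (intro carrier_scaleR carrier_diff X Tc exp_mult_op_same(1)[OF h])
  have bound: "fs_norm X (\<lambda>x. diff_quotient T (T t f) h x - G x) \<le> h * D * fs_norm X f" if h: "h > 0" for h
  proof -
    define m1 where "m1 k = e (h + t) k - e t k" for k
    define m2 where "m2 k = inverse h * m1 k" for k
    define Q where "Q k = m2 k - generator_mult t k" for k
    have aht: "admissible TYPE('a) (e (h + t))" and at: "admissible TYPE('a) (e t)"
      using h t by (auto intro: exp_symbol_admissible)
    have a1: "admissible TYPE('a) m1" unfolding m1_def by (rule admissible_diff[OF dim aht at])
    have a2: "admissible TYPE('a) m2"
    proof -
      have "summable (\<lambda>k. inverse h * (\<bar>m1 k\<bar> * zonal_bound TYPE('a) k))"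
        using a1 unfolding admissible_def by (rule summable_mult)
      then show ?thesis using h by (simp add: admissible_def m2_def abs_mult mult.assoc)
    qed
    have aQ: "admissible TYPE('a) Q" unfolding Q_def by (rule admissible_diff[OF dim a2 ag])
    have Qle: "\<bar>Q k\<bar> \<le> h * ((\<phi> k)\<^sup>2 * e t k)" for k
    proof -
      have "Q k = inverse h * (exp (- (h * \<phi> k)) - 1 + h * \<phi> k) * e t k"
        using h by (simp add: Q_def m2_def m1_def generator_mult_def exp_symbol_eq exp_add[symmetric] distrib_left algebra_simps)
      then have "\<bar>Q k\<bar> = inverse h * \<bar>exp (- (h * \<phi> k)) - 1 + h * \<phi> k\<bar> * e t k"
        using h e0[of t k] by (simp add: abs_mult)
      also have "\<dots> \<le> inverse h * (h * \<phi> k)\<^sup>2 * e t k"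
        using h e0[of t k] symbol_nonneg[of k]
        by (intro mult_right_mono mult_left_mono exp_minus_quadratic) auto
      also have "\<dots> = h * ((\<phi> k)\<^sup>2 * e t k)" using h by (simp add: power2_eq_square field_simps)
      finally show ?thesis .
    qed
    have same: "fs_same X (\<lambda>x. diff_quotient T (T t f) h x - G x) (zonal_conv (mult_kernel TYPE('a) Q) f)"
    proof -
      have "fs_same X (\<lambda>x. diff_quotient T (T t f) h x - G x) (\<lambda>x. (C (h + t) f x - C t f x) /\<^sub>R h - G x)"
        unfolding diff_quotient_def
        using fs_same_comb[OF fs_same_comb[OF exp_mult_op_compose[OF h t f] exp_mult_op_same(2)[OF t f], of "\<lambda>a b. (a - b) /\<^sub>R h"] fs_same_refl[of X G], of "(-)"] .
      moreover have "(C (h + t) f x - C t f x) /\<^sub>R h - G x = zonal_conv (mult_kernel TYPE('a) Q) f x"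
        if x: "norm x = 1" for x
      proof -
        have "zonal_conv (mult_kernel TYPE('a) Q) f x = zonal_conv (mult_kernel TYPE('a) m2) f x - G x"
          unfolding Q_def G_def by (rule mult_op_diff[OF dim a2 ag fi x])
        also have "zonal_conv (mult_kernel TYPE('a) m2) f x = inverse h *\<^sub>R zonal_conv (mult_kernel TYPE('a) m1) f x"
          unfolding m2_def by (rule mult_op_cmult[OF dim a1])
        also have "zonal_conv (mult_kernel TYPE('a) m1) f x = C (h + t) f x - C t f x"
          unfolding m1_def kernel_op_eq by (rule mult_op_diff[OF dim aht at fi x])
        finally show ?thesis by simp
      qed
      then have "fs_same X (\<lambda>x. (C (h + t) f x - C t f x) /\<^sub>R h - G x) (zonal_conv (mult_kernel TYPE('a) Q) f)"
        by (rule fs_same_sphere)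
      ultimately show ?thesis by (rule fs_same_trans)
    qed
    have "fs_norm X (\<lambda>x. diff_quotient T (T t f) h x - G x) = fs_norm X (zonal_conv (mult_kernel TYPE('a) Q) f)"
      by (intro fs_norm_same same carrier_diff X dqc h Gc zonal_conv_carrier mult_kernel_continuous dim aQ f)
    also have "\<dots> \<le> (\<Sum>k. \<bar>Q k\<bar> * zonal_bound TYPE('a) k) * fs_norm X f"
      by (rule mult_op_norm_trivial[OF dim X aQ f])
    also have "\<dots> \<le> (h * D) * fs_norm X f"
    proof (intro mult_right_mono fs_norm_nonneg f)
      have "(\<Sum>k. \<bar>Q k\<bar> * zonal_bound TYPE('a) k) \<le> (\<Sum>k. h * (((\<phi> k)\<^sup>2 * e t k) * zonal_bound TYPE('a) k))"
      proof (rule suminf_le)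
        show "\<bar>Q k\<bar> * zonal_bound TYPE('a) k \<le> h * (((\<phi> k)\<^sup>2 * e t k) * zonal_bound TYPE('a) k)" for k
          using mult_right_mono[OF Qle[of k] zb0[of k]] by (simp add: mult.assoc)
        show "summable (\<lambda>k. \<bar>Q k\<bar> * zonal_bound TYPE('a) k)" using aQ by (simp add: admissible_def)
        show "summable (\<lambda>k. h * (((\<phi> k)\<^sup>2 * e t k) * zonal_bound TYPE('a) k))"
          by (rule summable_mult[OF sD])
      qed
      also have "\<dots> = h * D" unfolding D_def by (rule suminf_mult[OF sD])
      finally show "(\<Sum>k. \<bar>Q k\<bar> * zonal_bound TYPE('a) k) \<le> h * D" .
    qed
    finally show ?thesis .
  qed
  have ev0: "\<forall>\<^sub>F h in at_right (0::real). h > 0" by (rule eventually_at_right_less)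
  have "((\<lambda>h. h * D * fs_norm X f) \<longlongrightarrow> 0 * D * fs_norm X f) (at_right 0)"
    by (intro tendsto_intros)
  then have lim: "((\<lambda>h. h * D * fs_norm X f) \<longlongrightarrow> 0) (at_right 0)" by simp
  have "((\<lambda>h. fs_norm X (\<lambda>x. diff_quotient T (T t f) h x - G x)) \<longlongrightarrow> 0) (at_right 0)"
  proof (rule tendsto_sandwich[OF _ _ tendsto_const lim])
    show "\<forall>\<^sub>F h in at_right 0. 0 \<le> fs_norm X (\<lambda>x. diff_quotient T (T t f) h x - G x)"
      using ev0 by eventually_elim (intro fs_norm_nonneg carrier_diff X dqc Gc)
    show "\<forall>\<^sub>F h in at_right 0. fs_norm X (\<lambda>x. diff_quotient T (T t f) h x - G x) \<le> h * D * fs_norm X f"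
      using ev0 by eventually_elim (rule bound)
  qed
  moreover have "\<forall>\<^sub>F h in at_right 0. diff_quotient T (T t f) h \<in> fs_carrier X"
    using ev0 by eventually_elim (rule dqc)
  ultimately show ?thesis
    using Gc unfolding fs_tendsto_def G_def[symmetric] by blast
qed

lemma exp_mult_op_in_generator_dom:
  assumes t: "t > 0" and f: "f \<in> fs_carrier X"
  shows "T t f \<in> generator_dom X T"
  unfolding generator_dom_def using generator_tendsto[OF t f] exp_mult_op_same(1)[OF t f] by blast

text \<open>The difference estimate supplies N from p, \<open>\<gamma>\<close> and the dimension,
  before t and f are chosen.\<close>

lemma generator_norm_bound:
  "\<exists>N. \<forall>t>0. \<forall>f\<in>fs_carrier X. fs_norm X (generator X T (T t f)) \<le> N / t * fs_norm X f"
proof -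
  have "lead_coeff p > 0" "degree p > 0" using reg by (auto simp: regular_symbol_def)
  from exp_symbol_difference_bound[OF this \<gamma> nonneg, of "DIM('a)"] obtain N where N:
    "\<And>t K. t > 0 \<Longrightarrow> (\<Sum>k<K. (real k + 1) ^ DIM('a) *
       \<bar>(fdiff ^^ Suc DIM('a)) (\<lambda>k. t * \<phi> k * exp (- (t * \<phi> k))) k\<bar>) \<le> N"
    unfolding \<phi>_def by blast
  show ?thesis
  proof (intro exI[of _ N] allI impI ballI)
    fix t :: real and f :: "'a \<Rightarrow> complex"
    assume t: "t > 0" and f: "f \<in> fs_carrier X"
    \<comment> \<open>This is \<open>- t\<close> times the multiplier of the generator. Its weighted
      differences have a sum bounded uniformly in t, and undoing the factor produces 1 / t.\<close>
    define m where "m k = t * \<phi> k * exp (- (t * \<phi> k))" for k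
    have m_eq: "m = (\<lambda>k. - t * generator_mult t k)"
      by (simp add: m_def generator_mult_def exp_symbol_eq fun_eq_iff mult_ac)
    have g_eq: "generator_mult t = (\<lambda>k. - inverse t * m k)"
      using t by (simp add: m_eq fun_eq_iff)
    have "poly_growth (\<lambda>k. - t)" unfolding poly_growth_def
      by (intro exI[of _ t] exI[of _ 0]) (use t in simp)
    from rapid_mult_poly_growth[OF generator_mult_rapid[OF t] this]
    have rm: "rapid m" by (simp add: m_eq mult.commute)
    have am: "admissible TYPE('a) m" by (rule rapid_admissible[OF dim rm])
    have ag: "admissible TYPE('a) (generator_mult t)"
      by (rule rapid_admissible[OF dim generator_mult_rapid[OF t]])
    have Mc: "zonal_conv (mult_kernel TYPE('a) m) f \<in> fs_carrier X"
      by (intro zonal_conv_carrier X mult_kernel_continuous dim am f)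
    have Gc: "zonal_conv (mult_kernel TYPE('a) (generator_mult t)) f \<in> fs_carrier X"
      by (intro zonal_conv_carrier X mult_kernel_continuous dim ag f)
    have nt: "at_right (0::real) \<noteq> bot" by (rule trivial_limit_at_right_real)
    \<comment> \<open>\<open>generator\<close> chooses some limit of the difference quotients;
      uniqueness up to \<open>fs_same\<close> gives it the norm of the explicit one.\<close>
    note lim = fs_lim_same[OF X nt generator_tendsto[OF t f]]
    have "fs_norm X (generator X T (T t f)) = fs_norm X (zonal_conv (mult_kernel TYPE('a) (generator_mult t)) f)"
      unfolding generator_def by (rule fs_norm_same[OF lim(2) lim(1) Gc])
    also have "zonal_conv (mult_kernel TYPE('a) (generator_mult t)) f =
        (\<lambda>x. complex_of_real (- inverse t) * zonal_conv (mult_kernel TYPE('a) m) f x)"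
      unfolding g_eq by (simp add: fun_eq_iff mult_op_cmult[OF dim am, of "- inverse t", simplified] scaleR_conv_of_real)
    also have "fs_norm X \<dots> = norm (complex_of_real (- inverse t)) * fs_norm X (zonal_conv (mult_kernel TYPE('a) m) f)"
      by (rule fs_norm_mult[OF X Mc])
    also have "norm (complex_of_real (- inverse t)) = inverse t" using t by (simp add: norm_inverse)
    also have "inverse t * fs_norm X (zonal_conv (mult_kernel TYPE('a) m) f) \<le> inverse t * (N * fs_norm X f)"
      using t N[OF t] unfolding m_def[symmetric]
      by (intro mult_left_mono mult_op_norm_differences[OF dim X rm f]) (auto simp: m_def[abs_def])
    also have "\<dots> = N / t * fs_norm X f" by (simp add: divide_inverse)
    finally show "fs_norm X (generator X T (T t f)) \<le> N / t * fs_norm X f" .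
  qed
qed

end

theorem theorem4p2p3:
  fixes n :: nat and X :: fspace and p :: "real poly" and \<gamma> :: real
  assumes "n \<ge> 2" and "DIM('a::euclidean_space) = n + 1"
    and "X = Cont \<or> (\<exists>q\<ge>1. X = Lq q)"
    and "0 < \<gamma>" and "\<gamma> \<le> 1"
    and "\<And>k::nat. poly p (real k) \<ge> 0"
    and "regular_symbol p"
    and "\<And>t. t > 0 \<Longrightarrow> positive_kernel TYPE('a) p \<gamma> t"
  shows "let T = (exp_mult_op X p \<gamma> :: real \<Rightarrow> ('a \<Rightarrow> complex) \<Rightarrow> 'a \<Rightarrow> complex) in
    C0_semigroup X T \<and> contractive X T \<and>
    (\<forall>t>0. \<forall>f\<in>fs_carrier X. T t f \<in> generator_dom X T) \<and>
    (\<exists>N. \<forall>t>0. \<forall>f\<in>fs_carrier X.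
       fs_norm X (generator X T (T t f)) \<le> N / t * fs_norm X f)"
proof -
  have "DIM('a) \<ge> 3" using assms(1,2) by simp
  moreover have "valid_space X" using assms(3) by (simp add: valid_space_def)
  ultimately have *: "DIM('a) \<ge> 3" "valid_space X" "0 < \<gamma>" "\<gamma> \<le> 1"
      "\<And>k::nat. poly p (real k) \<ge> 0" "regular_symbol p"
      "\<And>t. t > 0 \<Longrightarrow> positive_kernel TYPE('a) p \<gamma> t"
    using assms(4-8) by auto
  show ?thesis
    unfolding Let_def contractive_def
    using exp_mult_op_C0_semigroup[OF *] exp_mult_op_norm_le[OF *] exp_mult_op_in_generator_dom[OF *] generator_norm_bound[OF *]
    by blast
qed

end
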